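(* Let $\mu>0$ and let $\nu,\eta$ be reals satisfying $110\nu+250\eta+10\sqrt{\mu}<\frac{1}{2000}$. Let $G$ be an $n$-vertex graph of minimum degree at least $\frac{n}{2}$ with a $\mu n$-bounded incompatibility system $\mathcal{F}$, and suppose there are two sets $A,B\subseteq V(G)$ with $|A|,|B|\ge(\frac12-\nu)n$ and $e(A,B)\le\eta n^2$. Then $G$ contains a Hamilton cycle compatible with $\mathcal{F}$.
   Context: All graphs are finite and simple. For sets of vertices $X,Y$, $e(X,Y)$ is the number of edges with one endpoint in $X$ and the other in $Y$, counted with multiplicity (so $e(X,X)$ is twice the number of edges inside $X$). An incompatibility system $\mathcal{F}$ over $G=(V,E)$ is a family $\{F_v\}_{v\in V}$ where each $F_v$ is a set of unordered pairs $\{e,e'\}$ of distinct edges with $e\cap e'=\{v\}$; edges $e,e'$ are incompatible if $\{e,e'\}\in F_v$ for some $v$, compatible otherwise. A cycle is compatible with $\mathcal{F}$ if every pair of its edges is compatible. For a positive real $\Delta$, $\mathcal{F}$ is $\Delta$-bounded if for every vertex $v$ and edge $e\ni v$, at most $\Delta$ other edges $e'\ni v$ satisfy $\{e,e'\}\in F_v$.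
   Formalization: The hypothesis n ≥ 3 is added: without it the statement fails for the single-edge graph on n = 2 vertices (and for the empty graph), which meets all the hypotheses but has no Hamilton cycle. *)

theory Defs
  imports Complex_Main
begin

definition simple_graph :: "'a set \<Rightarrow> 'a set set \<Rightarrow> bool" where
  "simple_graph V E \<longleftrightarrow> finite V \<and> (\<forall>e\<in>E. \<exists>u v. e = {u, v} \<and> u \<in> V \<and> v \<in> V \<and> u \<noteq> v)"

definition degree :: "'a set set \<Rightarrow> 'a \<Rightarrow> nat" where
  "degree E v = card {u. {u, v} \<in> E}"

text \<open>e(X,Y): edges with one endpoint in X and the other in Y, counted with multiplicity
  (ordered pairs), so e(X,X) is twice the number of edges inside X.\<close>
definition e_between :: "'a set set \<Rightarrow> 'a set \<Rightarrow> 'a set \<Rightarrow> nat" where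
  "e_between E X Y = card {(x, y). x \<in> X \<and> y \<in> Y \<and> {x, y} \<in> E}"

definition incompatibility_system :: "'a set \<Rightarrow> 'a set set \<Rightarrow> ('a \<Rightarrow> 'a set set set) \<Rightarrow> bool" where
  "incompatibility_system V E F \<longleftrightarrow>
     (\<forall>v\<in>V. \<forall>p\<in>F v. \<exists>e e'. p = {e, e'} \<and> e \<in> E \<and> e' \<in> E \<and> e \<noteq> e' \<and> e \<inter> e' = {v})
     \<and> (\<forall>v. v \<notin> V \<longrightarrow> F v = {})"

definition bounded_system :: "'a set \<Rightarrow> 'a set set \<Rightarrow> ('a \<Rightarrow> 'a set set set) \<Rightarrow> real \<Rightarrow> bool" where
  "bounded_system V E F \<Delta> \<longleftrightarrow>
     (\<forall>v\<in>V. \<forall>e\<in>E. v \<in> e \<longrightarrow>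
        real (card {e'. e' \<in> E \<and> v \<in> e' \<and> e' \<noteq> e \<and> {e, e'} \<in> F v}) \<le> \<Delta>)"

definition incompatible :: "('a \<Rightarrow> 'a set set set) \<Rightarrow> 'a set \<Rightarrow> 'a set \<Rightarrow> bool" where
  "incompatible F e e' \<longleftrightarrow> (\<exists>v. {e, e'} \<in> F v)"

definition cycle_edges :: "'a list \<Rightarrow> 'a set set" where
  "cycle_edges vs = {{vs ! i, vs ! ((i + 1) mod length vs)} | i. i < length vs}"

definition hamilton_cycle :: "'a set \<Rightarrow> 'a set set \<Rightarrow> 'a list \<Rightarrow> bool" where
  "hamilton_cycle V E vs \<longleftrightarrow> length vs \<ge> 3 \<and> distinct vs \<and> set vs = V \<and> cycle_edges vs \<subseteq> E"

definition compatible_cycle :: "('a \<Rightarrow> 'a set set set) \<Rightarrow> 'a list \<Rightarrow> bool" where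
  "compatible_cycle F vs \<longleftrightarrow>
     (\<forall>e\<in>cycle_edges vs. \<forall>e'\<in>cycle_edges vs. e \<noteq> e' \<longrightarrow> \<not> incompatible F e e')"

end

theory Submission
  imports Defs "HOL-Library.Multiset"
begin

text \<open>
  Since \<open>e(A,B)\<close> is small and degrees are at least \<open>n/2\<close>, almost all pairs between \<open>A\<close> and the
  complement of \<open>B\<close> are edges; comparing \<open>A \<inter> B\<close> with \<open>A - B\<close> shows that one of them is tiny. So
  the graph is close to \<open>K\<^bsub>n/2,n/2\<^esub>\<close> or to two disjoint cliques of order \<open>n/2\<close>.

  In both situations a long compatible cycle is built greedily and the remaining vertices are absorbed
  one after the other. Inserting a vertex \<open>v\<close> between two consecutive vertices of the cycle may fail
  everywhere because of \<open>\<F>\<close>. Instead the cycle is cut at several places and its segments are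
  rearranged, so that the neighbours \<open>b, c\<close> of \<open>v\<close> on the new cycle get new second neighbours as
  well. Each compatibility condition then involves two independently chosen positions, a
  \<open>\<Delta>\<close>-bounded system violates it for few pairs of positions, and a union bound applies.

  In the bipartite situation, vertices are moved to the smaller side or a matching inside the larger
  side is used to balance the sides, and vertices are absorbed in pairs.
\<close>

section \<open>Counting bad pairs\<close>

text \<open>If \<open>v\<close> is put between consecutive vertices of a fixed cycle, the edge kept
  at its new neighbour \<open>b\<close> is determined by \<open>b\<close>, so even a 1-bounded
  system can spoil every place. Boundedness helps only where the two edges at a vertex come from
  independent choices; hence both old edges at \<open>b\<close> and at \<open>c\<close> are given
  up. The conditions on the four positions then form a 4-cycle of binary relations, and a good
  quadruple exists once \<open>5 * bad + 12 * k * \<Delta> < k^2\<close>, where each position has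
  \<open>k\<close> candidates and \<open>bad\<close> counts missing pairs. A vertex to be absorbed
  may have only about a quarter of all vertices as neighbours in the relevant part, and roughly
  \<open>4 * k\<close> of them are used. So \<open>k\<close> is taken near n/32, and the missing
  pairs must stay below about n^2/5120; the recurring bound 18/100000 n^2 comes from there.\<close>

definition badn :: "('s \<Rightarrow> 't \<Rightarrow> bool) \<Rightarrow> 's set \<Rightarrow> 't set \<Rightarrow> real" where
  "badn R S T = (\<Sum>s\<in>S. \<Sum>t\<in>T. of_bool (R s t))"

lemma badn_nonneg: "badn R S T \<ge> 0"
  unfolding badn_def by (intro sum_nonneg) auto

lemma sum_of_bool_card:
  assumes "finite T" shows "(\<Sum>t\<in>T. of_bool (P t) :: real) = card {t \<in> T. P t}"
proof -
  have "(\<Sum>t\<in>T. of_bool (P t) :: real) = (\<Sum>t\<in>{t\<in>T. P t}. 1)"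
    by (rule sum.mono_neutral_cong_right) (use assms in auto)
  then show ?thesis by simp
qed

lemma badn_swap: "badn R S T = badn (\<lambda>t s. R s t) T S"
  unfolding badn_def by (rule sum.swap)

lemma badn_card:
  assumes "finite S" "finite T"
  shows "badn R S T = card {(s, t). s \<in> S \<and> t \<in> T \<and> R s t}"
proof -
  have "badn R S T = (\<Sum>p\<in>S\<times>T. of_bool (R (fst p) (snd p)))"
    unfolding badn_def by (simp add: sum.cartesian_product case_prod_beta)
  also have "\<dots> = card {p \<in> S \<times> T. R (fst p) (snd p)}"
    by (rule sum_of_bool_card) (use assms in auto)
  also have "{p \<in> S \<times> T. R (fst p) (snd p)} = {(s, t). s \<in> S \<and> t \<in> T \<and> R s t}" by auto
  finally show ?thesis .
qed

lemma badn_or_le: "badn (\<lambda>s t. R s t \<or> Q s t) S T \<le> badn R S T + badn Q S T"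
  unfolding badn_def by (simp add: sum.distrib[symmetric]) (intro sum_mono; simp)

lemma badn_row_le:
  assumes "finite T" "\<And>s. s \<in> S \<Longrightarrow> real (card {t \<in> T. R s t}) \<le> d"
  shows "badn R S T \<le> real (card S) * d"
proof -
  have "badn R S T \<le> (\<Sum>s\<in>S. d)"
    unfolding badn_def by (rule sum_mono) (use assms in \<open>simp only: sum_of_bool_card\<close>)
  then show ?thesis by simp
qed

lemma badn_col_le:
  assumes "finite S" "\<And>t. t \<in> T \<Longrightarrow> real (card {s \<in> S. R s t}) \<le> d"
  shows "badn R S T \<le> real (card T) * d"
  unfolding badn_swap[of R] by (rule badn_row_le) (use assms in auto)

text \<open>Allows pairs of positions on a path to be counted through the pairs of vertices that
  they carry.\<close>

lemma badn_inj_le: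
  assumes "finite X" "finite Y" "inj_on f S" "inj_on g T" "f ` S \<subseteq> X" "g ` T \<subseteq> Y"
    "\<And>s t. s \<in> S \<Longrightarrow> t \<in> T \<Longrightarrow> R s t \<Longrightarrow> Q (f s) (g t)"
  shows "badn R S T \<le> badn Q X Y"
proof -
  have "badn R S T \<le> (\<Sum>s\<in>S. \<Sum>t\<in>T. of_bool (Q (f s) (g t)))"
    unfolding badn_def by (intro sum_mono) (use assms(7) in auto)
  also have "\<dots> = (\<Sum>s\<in>S. \<Sum>y\<in>g ` T. of_bool (Q (f s) y))"
    by (rule sum.cong) (use assms in \<open>auto simp: sum.reindex\<close>)
  also have "\<dots> = (\<Sum>x\<in>f ` S. \<Sum>y\<in>g ` T. of_bool (Q x y))"
    using assms by (simp add: sum.reindex)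
  also have "\<dots> \<le> (\<Sum>x\<in>X. \<Sum>y\<in>g ` T. of_bool (Q x y))"
    by (rule sum_mono2) (use assms in \<open>auto intro: sum_nonneg\<close>)
  also have "\<dots> \<le> (\<Sum>x\<in>X. \<Sum>y\<in>Y. of_bool (Q x y))"
    by (intro sum_mono sum_mono2) (use assms in auto)
  finally show ?thesis unfolding badn_def .
qed

lemma badn_mono:
  assumes "finite X" "finite Y" "S \<subseteq> X" "T \<subseteq> Y"
    "\<And>s t. s \<in> S \<Longrightarrow> t \<in> T \<Longrightarrow> R s t \<Longrightarrow> Q s t"
  shows "badn R S T \<le> badn Q X Y"
  by (rule badn_inj_le[where f = id and g = id]) (use assms in auto)

lemma pair_choice:
  assumes "finite S" "finite T" "badn R S T < real (card S) * real (card T)"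
  shows "\<exists>s\<in>S. \<exists>t\<in>T. \<not> R s t"
proof (rule ccontr)
  assume "\<not> ?thesis"
  then have "badn R S T = (\<Sum>s\<in>S. \<Sum>t\<in>T. 1)"
    unfolding badn_def by (intro sum.cong) auto
  then show False using assms by simp
qed

text \<open>Each relation constrains two of the four coordinates, so each of its bad pairs spoils
  k^2 of the k^4 quadruples; a union bound finishes. The relations sit on the edges of the 4-cycle
  \<open>A\<close>, \<open>B\<close>, \<open>C\<close>, \<open>D\<close>.\<close>

lemma four_choice:
  assumes fin: "finite A" "finite B" "finite C" "finite D"
    and card: "card A = k" "card B = k" "card C = k" "card D = k"
    and lt: "badn R1 B C + badn R2 C D + badn R3 A B + badn R4 A D < (real k)\<^sup>2"
  shows "\<exists>a\<in>A. \<exists>b\<in>B. \<exists>c\<in>C. \<exists>d\<in>D. \<not> R1 b c \<and> \<not> R2 c d \<and> \<not> R3 a b \<and> \<not> R4 a d"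
proof (rule ccontr)
  assume neg: "\<not> ?thesis"
  let ?K = "(real k)\<^sup>2"
  have "?K * ?K = (\<Sum>a\<in>A. \<Sum>b\<in>B. \<Sum>c\<in>C. \<Sum>d\<in>D. 1)"
    using card by (simp add: power2_eq_square)
  also have "\<dots> \<le> (\<Sum>a\<in>A. \<Sum>b\<in>B. \<Sum>c\<in>C. \<Sum>d\<in>D.
      of_bool (R1 b c) + of_bool (R2 c d) + of_bool (R3 a b) + of_bool (R4 a d))"
    by (intro sum_mono) (use neg in auto)
  also have "\<dots> = ?K * badn R1 B C + ?K * badn R2 C D + ?K * badn R3 A B + ?K * badn R4 A D"
    using card unfolding badn_def
    by (simp add: sum.distrib power2_eq_square sum_distrib_left[symmetric] algebra_simps
        sum.swap[of _ B A])
  also have "\<dots> = ?K * (badn R1 B C + badn R2 C D + badn R3 A B + badn R4 A D)"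
    by (simp add: algebra_simps)
  finally have *: "?K * ?K \<le> ?K * (badn R1 B C + badn R2 C D + badn R3 A B + badn R4 A D)" .
  have "?K > 0" using lt badn_nonneg[of R1 B C] badn_nonneg[of R2 C D] badn_nonneg[of R3 A B]
      badn_nonneg[of R4 A D] by linarith
  then show False using * lt by (simp only: mult_le_cancel_left_pos)
qed

section \<open>Compatible paths\<close>

text \<open>\<open>adj\<close> need not be the full edge relation. It will be a subgraph in which
  the neighbours of most vertices are confined to one part, so that a path reveals where the
  vertices next to a given position lie.\<close>

locale compat_graph =
  fixes adj :: "'a \<Rightarrow> 'a \<Rightarrow> bool" and comp :: "'a \<Rightarrow> 'a \<Rightarrow> 'a \<Rightarrow> bool"
    and V :: "'a set" and \<Delta> :: real
  assumes finite_V: "finite V"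
    and adj_V: "adj u v \<Longrightarrow> u \<in> V"
    and adj_sym: "adj u v \<Longrightarrow> adj v u"
    and adj_irrefl: "\<not> adj u u"
    and comp_sym: "comp u v w \<Longrightarrow> comp w v u"
    and comp_bound: "adj u v \<Longrightarrow> real (card {w. adj v w \<and> \<not> comp u v w}) \<le> \<Delta>"
    and \<Delta>_nonneg: "0 \<le> \<Delta>"
begin

lemma adj_commute: "adj u v \<longleftrightarrow> adj v u"
  using adj_sym by blast

lemma comp_commute: "comp u v w \<longleftrightarrow> comp w v u"
  using comp_sym by blast

text \<open>Vertices may repeat, so that a cycle can be written as a sequence running two vertices
  past its start; distinctness is stated separately.\<close>

fun cpath :: "'a list \<Rightarrow> bool" where
  "cpath [] \<longleftrightarrow> True"
| "cpath [x] \<longleftrightarrow> True"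
| "cpath [x, y] \<longleftrightarrow> adj x y"
| "cpath (x # y # z # zs) \<longleftrightarrow> adj x y \<and> comp x y z \<and> cpath (y # z # zs)"

lemma cpath_Cons:
  "ys \<noteq> [] \<Longrightarrow> cpath (x # ys) \<longleftrightarrow>
     cpath ys \<and> adj x (hd ys) \<and> (2 \<le> length ys \<longrightarrow> comp x (hd ys) (ys ! 1))"
  by (cases ys; cases "tl ys") auto

lemma cpath_append:
  assumes "xs \<noteq> []" "ys \<noteq> []"
  shows "cpath (xs @ ys) \<longleftrightarrow> cpath xs \<and> cpath ys \<and> adj (last xs) (hd ys)
     \<and> (2 \<le> length xs \<longrightarrow> comp (xs ! (length xs - 2)) (last xs) (hd ys))
     \<and> (2 \<le> length ys \<longrightarrow> comp (last xs) (hd ys) (ys ! 1))"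
  using assms
proof (induction xs)
  case (Cons x xs)
  show ?case
  proof (cases xs)
    case Nil
    then show ?thesis using Cons.prems cpath_Cons[of ys x] by auto
  next
    case xs: (Cons y zs)
    have IH: "cpath (xs @ ys) \<longleftrightarrow> cpath xs \<and> cpath ys \<and> adj (last xs) (hd ys)
     \<and> (2 \<le> length xs \<longrightarrow> comp (xs ! (length xs - 2)) (last xs) (hd ys))
     \<and> (2 \<le> length ys \<longrightarrow> comp (last xs) (hd ys) (ys ! 1))"
      using Cons xs by auto
    have 1: "cpath (x # xs @ ys) \<longleftrightarrow> cpath (xs @ ys) \<and> adj x y \<and> comp x y ((xs @ ys) ! 1)"
      using cpath_Cons[of "xs @ ys" x] Cons.prems xs by (cases ys) auto
    show ?thesis
    proof (cases zs)
      case Nil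
      then show ?thesis using 1 IH xs Cons.prems by (cases ys) auto
    next
      case zs: (Cons z ws)
      have "(x # xs) ! (length (x # xs) - 2) = xs ! (length xs - 2)" using xs zs by auto
      then show ?thesis using 1 IH xs zs Cons.prems cpath_Cons[of xs x] by auto
    qed
  qed
qed simp

lemma cpath_nth_adj: "cpath xs \<Longrightarrow> Suc i < length xs \<Longrightarrow> adj (xs ! i) (xs ! Suc i)"
proof (induction xs arbitrary: i rule: cpath.induct)
  case (3 x y)
  then show ?case by (cases i) auto
next
  case (4 x y z zs)
  then show ?case by (cases i) auto
qed auto

lemma cpath_nth_comp:
  "cpath xs \<Longrightarrow> Suc (Suc i) < length xs \<Longrightarrow> comp (xs ! i) (xs ! Suc i) (xs ! Suc (Suc i))"
proof (induction xs arbitrary: i rule: cpath.induct)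
  case (4 x y z zs)
  then show ?case by (cases i) auto
qed auto

lemma cpath_appendD:
  assumes "cpath (xs @ ys)" shows "cpath xs" "cpath ys"
  using assms cpath_append[of xs ys] by (cases "xs = []"; cases "ys = []"; auto)+

lemma cpath_rev: "cpath xs \<Longrightarrow> cpath (rev xs)"
proof (induction xs)
  case (Cons x xs)
  show ?case
  proof (cases "xs = []")
    case False
    have c: "cpath xs" "adj x (hd xs)" "2 \<le> length xs \<longrightarrow> comp x (hd xs) (xs ! 1)"
      using Cons.prems cpath_Cons[OF False] by auto
    have "rev xs ! (length xs - 2) = xs ! 1" if "2 \<le> length xs"
      using that by (simp add: rev_nth)
    then show ?thesis
      using Cons.IH c False
      by (auto simp: cpath_append last_rev adj_commute comp_commute)
  qed simp
qed simp

section \<open>Cutting a path into segments and reassembling them\<close>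

definition seg :: "'a list \<Rightarrow> nat \<Rightarrow> nat \<Rightarrow> 'a list" where
  "seg D i j = map ((!) D) [i..<j]"

lemma length_seg [simp]: "length (seg D i j) = j - i"
  by (simp add: seg_def)

lemma hd_seg [simp]: "i < j \<Longrightarrow> hd (seg D i j) = D ! i"
  by (simp add: seg_def hd_map)

lemma last_seg [simp]: "i < j \<Longrightarrow> last (seg D i j) = D ! (j - 1)"
  by (simp add: seg_def last_map)

lemma nth_seg: "m < j - i \<Longrightarrow> seg D i j ! m = D ! (i + m)"
  by (simp add: seg_def)

lemma seg_eq_Nil [simp]: "seg D i j = [] \<longleftrightarrow> j \<le> i"
  by (auto simp: seg_def)

lemma seg_split: "i \<le> m \<Longrightarrow> m \<le> j \<Longrightarrow> seg D i j = seg D i m @ seg D m j"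
  unfolding seg_def by (metis le_Suc_ex map_append upt_add_eq_append)

lemma seg_all: "seg D 0 (length D) = D"
  by (simp add: seg_def map_nth)

lemma seg_single: "seg D i (i + 1) = [D ! i]"
  by (simp add: seg_def)

lemma cpath_seg:
  assumes "cpath D" "j \<le> length D" shows "cpath (seg D i j)"
proof (cases "i \<le> j")
  case True
  have "D = seg D 0 i @ seg D i j @ seg D j (length D)"
    using True assms seg_split[of 0 i "length D" D] seg_split[of i j "length D" D] seg_all[of D] by simp
  then show ?thesis using assms(1) cpath_appendD by metis
next
  case False
  then show ?thesis by (simp add: seg_def)
qed

lemma seg_last2: "i < j - 1 \<Longrightarrow> seg D i j ! (j - i - 2) = D ! (j - 2)"
  by (subst nth_seg) auto

lemma seg_second: "i < j - 1 \<Longrightarrow> seg D i j ! 1 = D ! (i + 1)"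
  by (subst nth_seg) auto

lemma rev_seg_last2: "i < j - 1 \<Longrightarrow> rev (seg D i j) ! (j - i - 2) = D ! (i + 1)"
  by (subst rev_nth) (auto simp: nth_seg)

lemma rev_seg_second: "i < j - 1 \<Longrightarrow> rev (seg D i j) ! 1 = D ! (j - 2)"
  by (subst rev_nth) (auto simp: nth_seg)

lemma cpath_join:
  assumes "cpath xs" "cpath ys" "2 \<le> length xs" "2 \<le> length ys" "adj (last xs) (hd ys)"
    "comp (xs ! (length xs - 2)) (last xs) (hd ys)" "comp (last xs) (hd ys) (ys ! 1)"
  shows "cpath (xs @ ys)"
  using assms by (subst cpath_append) auto

lemma penult_append:
  "2 \<le> length ys \<Longrightarrow> (xs @ ys) ! (length (xs @ ys) - 2) = ys ! (length ys - 2)"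
  by (auto simp: nth_append)

lemma last_append': "2 \<le> length ys \<Longrightarrow> last (xs @ ys) = last ys"
  by (cases ys) auto

lemma last2_append:
  "2 \<le> length ys \<Longrightarrow> drop (length (xs @ ys) - 2) (xs @ ys) = drop (length ys - 2) ys"
  by simp

text \<open>The new path is \<open>S\<^sub>0 S\<^sub>3 c q b S\<^sub>1\<^sup>R S\<^sub>2\<^sup>R S\<^sub>4\<close>, where the old one is
  \<open>S\<^sub>0 b S\<^sub>1 S\<^sub>2 c S\<^sub>3 S\<^sub>4\<close>. Both edges at \<open>b\<close> and at \<open>c\<close> are replaced, so that each compatibility
  condition involves two freely chosen positions.\<close>

lemma switch_cpath:
  assumes D: "cpath D" and q: "q \<noteq> []"
    and ord: "2 \<le> b" "b + 3 \<le> i" "i + 2 \<le> c" "c + 3 \<le> j" "j + 2 \<le> length D"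
    and bc: "adj (D ! (b-1)) (D ! (c+1))" "comp (D ! (b-2)) (D ! (b-1)) (D ! (c+1))"
      "comp (D ! (b-1)) (D ! (c+1)) (D ! (c+2))"
      "adj (D ! (b+1)) (D ! (c-1))" "comp (D ! (b+2)) (D ! (b+1)) (D ! (c-1))"
      "comp (D ! (b+1)) (D ! (c-1)) (D ! (c-2))"
      "cpath ([D ! c] @ q @ [D ! b])"
    and cj: "adj (D ! (j-1)) (D ! c)" "comp (D ! (j-2)) (D ! (j-1)) (D ! c)"
      "comp (D ! (j-1)) (D ! c) (hd q)"
    and bi: "adj (D ! b) (D ! (i-1))" "comp (last q) (D ! b) (D ! (i-1))"
      "comp (D ! b) (D ! (i-1)) (D ! (i-2))"
    and ij: "adj (D ! i) (D ! j)" "comp (D ! (i+1)) (D ! i) (D ! j)"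
      "comp (D ! i) (D ! j) (D ! (j+1))"
  shows "\<exists>D'. cpath D' \<and> mset D' = mset D + mset q \<and> take 2 D' = take 2 D \<and>
    drop (length D' - 2) D' = drop (length D - 2) D"
proof -
  let ?L = "length D"
  define S0 where "S0 = seg D 0 b"
  define S1 where "S1 = seg D (b+1) i"
  define S2 where "S2 = seg D i c"
  define S3 where "S3 = seg D (c+1) j"
  define S4 where "S4 = seg D j ?L"
  define Mid where "Mid = [D ! c] @ q @ [D ! b]"
  note S = S0_def S1_def S2_def S3_def S4_def
  have len: "2 \<le> length S0" "2 \<le> length S1" "2 \<le> length S2" "2 \<le> length S3" "2 \<le> length S4"
    "2 \<le> length Mid"
    using ord by (auto simp: S Mid_def)
  have cp: "cpath S0" "cpath S1" "cpath S2" "cpath S3" "cpath S4" "cpath Mid"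
    using D ord bc by (auto simp: S Mid_def intro!: cpath_seg)
  have Mid: "last Mid = D ! b" "hd Mid = D ! c" "Mid ! (length Mid - 2) = last q" "Mid ! 1 = hd q"
    using q by (auto simp: Mid_def nth_append last_conv_nth hd_conv_nth nth_Cons')
  define x y where "x = D ! b" and "y = D ! c"
  have Deq: "D = (S0 @ [x] @ S1 @ S2 @ [y] @ S3) @ S4"
  proof -
    have "seg D 0 ?L = seg D 0 b @ seg D b (Suc b) @ seg D (Suc b) i @ seg D i c @
       seg D c (Suc c) @ seg D (Suc c) j @ seg D j ?L"
      using ord seg_split[of 0 b ?L D] seg_split[of b "Suc b" ?L D] seg_split[of "Suc b" i ?L D]
        seg_split[of i c ?L D] seg_split[of c "Suc c" ?L D] seg_split[of "Suc c" j ?L D] by simp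
    then show ?thesis by (simp only: seg_all seg_single S Suc_eq_plus1 x_def y_def append_assoc)
  qed
  have T1: "cpath (S0 @ S3)"
    by (rule cpath_join) (use cp len bc ord in \<open>auto simp: S seg_last2[of 0, simplified] nth_seg\<close>)
  have T2: "cpath ((S0 @ S3) @ Mid)"
  proof (rule cpath_join)
    show "comp ((S0 @ S3) ! (length (S0 @ S3) - 2)) (last (S0 @ S3)) (hd Mid)"
      using cj ord len(4) by (simp only: penult_append last_append' Mid)
        (auto simp: S seg_last2[of "c+1" j, simplified])
  qed (use cp len cj ord T1 Mid in \<open>auto simp: last_append' S\<close>)
  have T3: "cpath (((S0 @ S3) @ Mid) @ rev S1)"
  proof (rule cpath_join)
    show "comp ((((S0 @ S3) @ Mid)) ! (length ((S0 @ S3) @ Mid) - 2)) (last ((S0 @ S3) @ Mid)) (hd (rev S1))"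
      using bi ord len(6) by (simp only: penult_append last_append' Mid hd_rev) (auto simp: S)
    show "comp (last ((S0 @ S3) @ Mid)) (hd (rev S1)) (rev S1 ! 1)"
      using bi ord len(6) by (simp only: last_append' Mid hd_rev) (auto simp: S rev_seg_second simp del: One_nat_def)
  qed (use cp len bi ord T2 Mid in \<open>auto simp: last_append' S hd_rev cpath_rev\<close>)
  \<comment> \<open>\<open>S1\<close> and \<open>S2\<close> are reversed separately: the seam
    between the reversals joins positions \<open>b + 1\<close> and \<open>c - 1\<close>, and the
    next seam joins \<open>i\<close> and \<open>j\<close>.\<close>
  have T4: "cpath ((((S0 @ S3) @ Mid) @ rev S1) @ rev S2)"
  proof (rule cpath_join)
    show "comp ((((S0 @ S3) @ Mid) @ rev S1) ! (length (((S0 @ S3) @ Mid) @ rev S1) - 2))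
        (last (((S0 @ S3) @ Mid) @ rev S1)) (hd (rev S2))"
      using bc ord len(2) by (simp only: penult_append last_append' length_rev hd_rev last_rev)
       (auto simp: S rev_seg_last2[of "b+1" i, simplified])
    show "comp (last (((S0 @ S3) @ Mid) @ rev S1)) (hd (rev S2)) (rev S2 ! 1)"
      using bc ord len(2) by (simp only: last_append' length_rev hd_rev last_rev)
        (auto simp: S rev_seg_second simp del: One_nat_def)
  qed (use cp len bc ord T3 in \<open>auto simp: last_append' last_rev S hd_rev cpath_rev\<close>)
  have T5: "cpath (((((S0 @ S3) @ Mid) @ rev S1) @ rev S2) @ S4)" (is "cpath ?T")
  proof (rule cpath_join)
    show "comp (((((S0 @ S3) @ Mid) @ rev S1) @ rev S2) ! (length ((((S0 @ S3) @ Mid) @ rev S1) @ rev S2) - 2))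
        (last ((((S0 @ S3) @ Mid) @ rev S1) @ rev S2)) (hd S4)"
      using ij ord len(3) by (simp only: penult_append last_append' length_rev last_rev)
       (auto simp: S rev_seg_last2[of i c, simplified])
    show "comp (last ((((S0 @ S3) @ Mid) @ rev S1) @ rev S2)) (hd S4) (S4 ! 1)"
      using ij ord len(3) by (simp only: last_append' length_rev last_rev)
        (auto simp: S seg_second simp del: One_nat_def)
  qed (use cp len ij ord T4 in \<open>auto simp: last_append' last_rev S cpath_rev\<close>)
  have m: "mset ?T = mset D + mset q"
    by (subst Deq) (simp add: Mid_def x_def y_def)
  have t: "take 2 ?T = take 2 D"
    by (subst Deq) (use len(1) in simp)
  have "drop (length ?T - 2) ?T = drop (length S4 - 2) S4"
    by (rule last2_append[OF len(5)])
  also have "\<dots> = drop (length D - 2) D"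
    by (subst (1 2) Deq) (rule last2_append[OF len(5), symmetric])
  finally show ?thesis using T5 m t by blast
qed

text \<open>Deleting a single vertex would join its two old neighbours, which leaves no freedom.
  Deleting two and reversing the segment between them creates the edges \<open>i - 1\<close>,
  \<open>j - 1\<close> and \<open>i + 1\<close>, \<open>j + 1\<close>, each governed by both
  positions.\<close>

lemma excise_cpath:
  assumes D: "cpath D"
    and ord: "2 \<le> i" "i + 3 \<le> j" "j + 3 \<le> length D"
    and l: "adj (D ! (i-1)) (D ! (j-1))" "comp (D ! (i-2)) (D ! (i-1)) (D ! (j-1))"
      "comp (D ! (i-1)) (D ! (j-1)) (D ! (j-2))"
    and r: "adj (D ! (i+1)) (D ! (j+1))" "comp (D ! (i+2)) (D ! (i+1)) (D ! (j+1))"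
      "comp (D ! (i+1)) (D ! (j+1)) (D ! (j+2))"
  shows "\<exists>D'. cpath D' \<and> mset D = mset D' + {#D ! i, D ! j#} \<and> take 2 D' = take 2 D \<and>
    drop (length D' - 2) D' = drop (length D - 2) D"
proof -
  let ?L = "length D"
  define S0 where "S0 = seg D 0 i"
  define S1 where "S1 = seg D (i+1) j"
  define S2 where "S2 = seg D (j+1) ?L"
  note S = S0_def S1_def S2_def
  have len: "2 \<le> length S0" "2 \<le> length S1" "2 \<le> length S2"
    using ord by (auto simp: S)
  have cp: "cpath S0" "cpath S1" "cpath S2"
    using D ord by (auto simp: S intro!: cpath_seg)
  define x y where "x = D ! i" and "y = D ! j"
  have Deq: "D = (S0 @ [x] @ S1 @ [y]) @ S2"
  proof -
    have "seg D 0 ?L = seg D 0 i @ seg D i (Suc i) @ seg D (Suc i) j @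
       seg D j (Suc j) @ seg D (Suc j) ?L"
      using ord seg_split[of 0 i ?L D] seg_split[of i "Suc i" ?L D] seg_split[of "Suc i" j ?L D]
        seg_split[of j "Suc j" ?L D] by simp
    then show ?thesis by (simp only: seg_all seg_single S Suc_eq_plus1 x_def y_def append_assoc)
  qed
  have T1: "cpath (S0 @ rev S1)"
    by (rule cpath_join) (use cp len l ord in
      \<open>auto simp: S seg_last2[of 0, simplified] rev_seg_second hd_rev cpath_rev simp del: One_nat_def\<close>)
  have T2: "cpath ((S0 @ rev S1) @ S2)" (is "cpath ?T")
  proof (rule cpath_join)
    show "comp ((S0 @ rev S1) ! (length (S0 @ rev S1) - 2)) (last (S0 @ rev S1)) (hd S2)"
      using r ord len(2) by (simp only: penult_append last_append' length_rev last_rev)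
        (auto simp: S rev_seg_last2[of "i+1" j, simplified])
    show "comp (last (S0 @ rev S1)) (hd S2) (S2 ! 1)"
      using r ord len(2) by (simp only: last_append' length_rev last_rev)
        (auto simp: S seg_second[of "j+1", simplified] )
  qed (use cp len r ord T1 in \<open>auto simp: last_append' last_rev S\<close>)
  have m: "mset D = mset ?T + {#D ! i, D ! j#}"
    unfolding x_def[symmetric] y_def[symmetric] by (subst Deq) simp
  have t: "take 2 ?T = take 2 D"
    by (subst Deq) (use len(1) in simp)
  have "drop (length ?T - 2) ?T = drop (length S2 - 2) S2"
    by (rule last2_append[OF len(3)])
  also have "\<dots> = drop (length D - 2) D"
    by (subst (1 2) Deq) (rule last2_append[OF len(3), symmetric])
  finally show ?thesis using T2 m t by blast
qed

end

section \<open>Separating sets of positions\<close>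

lemma card_initial:
  fixes N :: "nat set"
  assumes "finite N" "k \<le> card N"
  shows "\<exists>t. card (N \<inter> {..<t}) = k"
proof -
  define f where "f t = card (N \<inter> {..<t})" for t
  have step: "f (Suc t) \<le> Suc (f t)" for t
  proof -
    have "N \<inter> {..<Suc t} \<subseteq> insert t (N \<inter> {..<t})" by auto
    then have "f (Suc t) \<le> card (insert t (N \<inter> {..<t}))"
      unfolding f_def by (intro card_mono) auto
    then show ?thesis unfolding f_def by (simp add: card_insert_if)
  qed
  obtain m where "\<forall>x\<in>N. x < m" using assms(1) finite_nat_set_iff_bounded by blast
  then have "N \<inter> {..<m} = N" by auto
  then have ex: "k \<le> f m" using assms by (simp add: f_def)
  define t where "t = (LEAST t. k \<le> f t)"
  have t: "k \<le> f t" using ex unfolding t_def by (rule LeastI)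
  have "f t \<le> k"
  proof (cases t)
    case 0
    then show ?thesis by (simp add: f_def)
  next
    case (Suc s)
    then have "\<not> k \<le> f s" using not_less_Least[of s "\<lambda>t. k \<le> f t"] t_def by auto
    then show ?thesis using step[of s] Suc by simp
  qed
  then show ?thesis using t f_def by auto
qed

text \<open>\<open>I\<close> consists of the first \<open>k\<close> elements. The window of length
  \<open>g\<close> behind them contains at most \<open>g\<close> elements, so \<open>k\<close> are
  left for \<open>J\<close>.\<close>

lemma split_ordered:
  fixes N :: "nat set"
  assumes "finite N" "2 * k + g \<le> card N"
  shows "\<exists>I J. I \<subseteq> N \<and> J \<subseteq> N \<and> card I = k \<and> card J = k \<and> (\<forall>i\<in>I. \<forall>j\<in>J. i + g + 1 \<le> j)"
proof -
  obtain t where t: "card (N \<inter> {..<t}) = k" using card_initial[of N k] assms by auto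
  have "N \<subseteq> (N \<inter> {..<t}) \<union> {t..<t+g} \<union> (N \<inter> {t+g..})" by auto
  then have "card N \<le> card ((N \<inter> {..<t}) \<union> {t..<t+g} \<union> (N \<inter> {t+g..}))"
    using assms by (intro card_mono) auto
  also have "\<dots> \<le> k + g + card (N \<inter> {t+g..})"
    using card_Un_le[of "(N \<inter> {..<t}) \<union> {t..<t+g}" "N \<inter> {t+g..}"]
      card_Un_le[of "N \<inter> {..<t}" "{t..<t+g}"] t by simp
  finally have "k \<le> card (N \<inter> {t+g..})" using assms by simp
  then obtain J where "J \<subseteq> N \<inter> {t+g..}" "card J = k" by (meson obtain_subset_with_card_n)
  then show ?thesis using t by (intro exI[of _ "N \<inter> {..<t}"] exI[of _ J]) force
qed

text \<open>Cut behind the first \<open>k\<close> elements of \<open>M\<close>. If \<open>N\<close>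
  has fewer than \<open>k\<close> elements beyond the window of length \<open>g\<close>, it has
  \<open>k\<close> before the cut, while \<open>M\<close> has \<open>k\<close> beyond the window;
  the order is then reversed.\<close>

lemma split_two:
  fixes M N :: "nat set"
  assumes "finite M" "finite N" "2 * k + g \<le> card M" "2 * k + g \<le> card N"
  shows "\<exists>I J. I \<subseteq> M \<and> J \<subseteq> N \<and> k \<le> card I \<and> k \<le> card J \<and>
    ((\<forall>i\<in>I. \<forall>j\<in>J. i + g \<le> j) \<or> (\<forall>i\<in>I. \<forall>j\<in>J. j + g \<le> i))"
proof -
  obtain t where t: "card (M \<inter> {..<t}) = k" using card_initial[of M k] assms by auto
  have upper: "card K \<le> card (K \<inter> {..<t}) + g + card (K \<inter> {t+g..})" if "finite K" for K :: "nat set"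
  proof -
    have "card K \<le> card ((K \<inter> {..<t}) \<union> {t..<t+g} \<union> (K \<inter> {t+g..}))"
      using that by (intro card_mono) auto
    then show ?thesis
      using card_Un_le[of "(K \<inter> {..<t}) \<union> {t..<t+g}" "K \<inter> {t+g..}"]
        card_Un_le[of "K \<inter> {..<t}" "{t..<t+g}"] by simp
  qed
  show ?thesis
  proof (cases "k \<le> card (N \<inter> {t+g..})")
    case True
    then show ?thesis using t
      by (intro exI[of _ "M \<inter> {..<t}"] exI[of _ "N \<inter> {t+g..}"]) force
  next
    case False
    then have "k \<le> card (N \<inter> {..<t})" "k \<le> card (M \<inter> {t+g..})"
      using upper[of N] upper[of M] assms t by simp_all
    then show ?thesis
      by (intro exI[of _ "M \<inter> {t+g..}"] exI[of _ "N \<inter> {..<t}"]) force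
  qed
qed

section \<open>Bad pairs of positions on a path\<close>

context compat_graph
begin

text \<open>A vertex is not a missing neighbour of itself; this matters when both classes are the
  same set.\<close>

abbreviation nonadj :: "'a \<Rightarrow> 'a \<Rightarrow> bool" where
  "nonadj x y \<equiv> x \<noteq> y \<and> \<not> adj x y"

lemma finite_adj: "finite {w. adj v w \<and> P w}"
  by (rule finite_subset[OF _ finite_V]) (use adj_V adj_sym in blast)

lemma comp_row:
  assumes "adj u v" "inj_on g T" "finite T"
  shows "real (card {t \<in> T. adj v (g t) \<and> \<not> comp u v (g t)}) \<le> \<Delta>"
proof -
  have "card {t \<in> T. adj v (g t) \<and> \<not> comp u v (g t)} \<le> card {w. adj v w \<and> \<not> comp u v w}"
    by (rule card_inj_on_le[of g]) (use assms in \<open>auto intro: inj_on_subset finite_adj\<close>)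
  then show ?thesis using comp_bound[OF assms(1)] by linarith
qed

lemma badn_nonadj_sym: "badn nonadj Y X = badn nonadj X Y"
  by (subst badn_swap) (simp add: adj_commute eq_commute[of _ "_ :: 'a"] cong: if_cong)

text \<open>A new edge must be compatible with the old edge kept at each of its ends. For fixed
  \<open>s\<close> the old edge at \<open>f s\<close> is fixed and rules out at most
  \<open>\<Delta>\<close> partners \<open>g t\<close>, and symmetrically for fixed \<open>t\<close>.
  This is how boundedness enters the union bound.\<close>

lemma badn_new_edge:
  assumes fin: "finite S" "finite T" "finite X" "finite Y" and card: "card S = k" "card T = k"
    and inj: "inj_on f S" "inj_on g T" and sub: "f ` S \<subseteq> X" "g ` T \<subseteq> Y"
    and neq: "\<And>s t. s \<in> S \<Longrightarrow> t \<in> T \<Longrightarrow> f s \<noteq> g t"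
    and old: "\<And>s. s \<in> S \<Longrightarrow> adj (f' s) (f s)" "\<And>t. t \<in> T \<Longrightarrow> adj (g' t) (g t)"
  shows "badn (\<lambda>s t. \<not> (adj (f s) (g t) \<and> comp (f' s) (f s) (g t) \<and> comp (f s) (g t) (g' t))) S T
     \<le> badn nonadj X Y + 2 * real k * \<Delta>"
proof -
  let ?R1 = "\<lambda>s t. \<not> adj (f s) (g t)"
  let ?R2 = "\<lambda>s t. adj (f s) (g t) \<and> \<not> comp (f' s) (f s) (g t)"
  let ?R3 = "\<lambda>s t. adj (g t) (f s) \<and> \<not> comp (g' t) (g t) (f s)"
  have 1: "badn ?R1 S T \<le> badn nonadj X Y"
    by (rule badn_inj_le[OF fin(3,4) inj sub]) (use neq in auto)
  have 2: "badn ?R2 S T \<le> real k * \<Delta>"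
    using badn_row_le[of T S ?R2 \<Delta>] comp_row[OF old(1) inj(2) fin(2)] fin card by auto
  have 3: "badn ?R3 S T \<le> real k * \<Delta>"
    using badn_col_le[of S T ?R3 \<Delta>] comp_row[OF old(2) inj(1) fin(1)] fin card by auto
  have "badn (\<lambda>s t. \<not> (adj (f s) (g t) \<and> comp (f' s) (f s) (g t) \<and> comp (f s) (g t) (g' t))) S T
     \<le> badn (\<lambda>s t. ?R1 s t \<or> (?R2 s t \<or> ?R3 s t)) S T"
    by (rule badn_mono) (use fin adj_commute comp_commute in auto)
  also have "\<dots> \<le> badn ?R1 S T + badn (\<lambda>s t. ?R2 s t \<or> ?R3 s t) S T" by (rule badn_or_le)
  also have "\<dots> \<le> badn ?R1 S T + (badn ?R2 S T + badn ?R3 S T)"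
    using badn_or_le[of ?R2 ?R3 S T] by simp
  finally show ?thesis using 1 2 3 by simp
qed

text \<open>If \<open>q\<close> is one vertex, a single condition links \<open>s\<close> and
  \<open>t\<close>. If \<open>q\<close> is longer, each of its ends carries a fixed edge of
  \<open>q\<close>, which rules out at most \<open>\<Delta>\<close> neighbours at that end and hence
  at most \<open>k * \<Delta>\<close> pairs. So the bound does not depend on the length of
  \<open>q\<close>.\<close>

lemma badn_item:
  assumes fin: "finite S" "finite T" and card: "card S = k" "card T = k"
    and inj: "inj_on f S" "inj_on g T" and q: "q \<noteq> []" "cpath q"
    and adj: "\<And>s. s \<in> S \<Longrightarrow> adj (last q) (f s)" "\<And>t. t \<in> T \<Longrightarrow> adj (hd q) (g t)"
  shows "badn (\<lambda>s t. \<not> cpath ([g t] @ q @ [f s])) S T \<le> 2 * real k * \<Delta>"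
proof (cases "2 \<le> length q")
  case False
  then obtain v where v: "q = [v]" using q by (cases q; cases "tl q") auto
  let ?R = "\<lambda>s t. adj v (g t) \<and> \<not> comp (f s) v (g t)"
  have "badn (\<lambda>s t. \<not> cpath ([g t] @ q @ [f s])) S T \<le> badn ?R S T"
    by (rule badn_mono) (use fin adj v adj_commute comp_commute in auto)
  also have "\<dots> \<le> real k * \<Delta>"
    using badn_row_le[of T S ?R \<Delta>] comp_row[of _ v g T] adj v adj_commute inj fin card by auto
  finally show ?thesis using \<Delta>_nonneg mult_nonneg_nonneg[of "real k" \<Delta>] by linarith
next
  case True
  let ?p = "q ! (length q - 2)" and ?s = "q ! 1"
  have a: "adj ?p (last q)" "adj ?s (hd q)"
    using cpath_nth_adj[OF q(2), of "length q - 2"] cpath_nth_adj[OF q(2), of 0] True q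
    by (auto simp: last_conv_nth hd_conv_nth adj_commute numeral_2_eq_2 Suc_diff_Suc)
  let ?R1 = "\<lambda>s t. adj (last q) (f s) \<and> \<not> comp ?p (last q) (f s)"
  let ?R2 = "\<lambda>s t. adj (hd q) (g t) \<and> \<not> comp ?s (hd q) (g t)"
  have cp: "cpath ([g t] @ q @ [f s]) \<longleftrightarrow> adj (g t) (hd q) \<and> comp (g t) (hd q) ?s \<and>
      adj (last q) (f s) \<and> comp ?p (last q) (f s)" for s t
  proof -
    have "(q @ [f s]) ! Suc 0 = q ! Suc 0" using True by (auto simp: nth_append)
    then show ?thesis using q True cpath_append[of q "[f s]"] cpath_Cons[of "q @ [f s]" "g t"] by auto
  qed
  have "badn (\<lambda>s t. \<not> cpath ([g t] @ q @ [f s])) S T \<le> badn (\<lambda>s t. ?R1 s t \<or> ?R2 s t) S T"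
    unfolding cp by (rule badn_mono) (use fin adj adj_commute comp_commute in auto)
  also have "\<dots> \<le> badn ?R1 S T + badn ?R2 S T" by (rule badn_or_le)
  also have "badn ?R1 S T \<le> real k * \<Delta>"
    using badn_col_le[of S T ?R1 \<Delta>] comp_row[OF a(1) inj(1) fin(1)] fin card by auto
  also have "badn ?R2 S T \<le> real k * \<Delta>"
    using badn_row_le[of T S ?R2 \<Delta>] comp_row[OF a(2) inj(2) fin(2)] fin card by auto
  finally show ?thesis by (simp add: algebra_simps)
qed

text \<open>\<open>X\<close> and \<open>Y\<close> are the two sides of a nearly complete bipartite graph, or both equal to the
  vertex set of a nearly complete graph; \<open>Xi\<close> and \<open>Yi\<close> are the vertices whose neighbours on any
  path are known to lie on the other side.\<close>

definition insertable :: "'a set \<Rightarrow> 'a set \<Rightarrow> 'a set \<Rightarrow> 'a set \<Rightarrow> bool" where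
  "insertable X Y Xi Yi \<longleftrightarrow> X \<subseteq> V \<and> Y \<subseteq> V \<and> Xi \<subseteq> X \<and> Yi \<subseteq> Y \<and>
     (\<forall>x\<in>Xi. \<forall>w. adj x w \<longrightarrow> w \<in> Y) \<and> (\<forall>y\<in>Yi. \<forall>w. adj y w \<longrightarrow> w \<in> X)"

text \<open>A cycle is unrolled with an overlap of two vertices, so keeping two vertices at each end
  is what allows a rearranged sequence to close up again.\<close>

definition same_ends :: "'a list \<Rightarrow> 'a list \<Rightarrow> bool" where
  "same_ends D' D \<longleftrightarrow> take 2 D' = take 2 D \<and> drop (length D' - 2) D' = drop (length D - 2) D"

text \<open>In an unrolled cycle the first two vertices reappear at the end, but the positions other
  than the first and the last carry distinct vertices.\<close>

lemma nth_eq_interior: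
  assumes "distinct (butlast (tl D))" "1 \<le> i" "i + 2 \<le> length D" "1 \<le> j" "j + 2 \<le> length D"
  shows "D ! i = D ! j \<longleftrightarrow> i = j"
proof -
  have "butlast (tl D) ! m = D ! Suc m" if "m + 3 \<le> length D" for m
    using that by (subst nth_butlast) (auto simp: nth_tl)
  from this[of "i - 1"] this[of "j - 1"] show ?thesis
    using assms nth_eq_iff_index_eq[OF assms(1), of "i - 1" "j - 1"] by auto
qed

lemma inj_on_interior:
  assumes "distinct (butlast (tl D))" "inj_on h S" "\<And>s. s \<in> S \<Longrightarrow> 1 \<le> h s \<and> h s + 2 \<le> length D"
  shows "inj_on (\<lambda>s. D ! h s) S"
proof (rule inj_onI)
  fix x y assume xy: "x \<in> S" "y \<in> S" "D ! h x = D ! h y"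
  then have "h x = h y" using nth_eq_interior[OF assms(1), of "h x" "h y"] assms(3) by blast
  then show "x = y" using assms(2) xy by (auto dest: inj_onD)
qed

lemma cpath_adj_prev: "cpath D \<Longrightarrow> 1 \<le> i \<Longrightarrow> i < length D \<Longrightarrow> adj (D ! (i - 1)) (D ! i)"
  using cpath_nth_adj[of D "i - 1"] by simp

lemma badn_new_edge_nth:
  assumes D: "distinct (butlast (tl D))"
    and fin: "finite X" "finite Y" "finite S" "finite T" and card: "card S = k" "card T = k"
    and inj: "inj_on h S" "inj_on h' T"
    and neq: "\<And>s t. s \<in> S \<Longrightarrow> t \<in> T \<Longrightarrow> h s < h' t \<or> h' t < h s"
    and S: "\<And>s. s \<in> S \<Longrightarrow> 1 \<le> h s \<and> h s + 2 \<le> length D \<and> D ! h s \<in> X \<and> adj (f' s) (D ! h s)"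
    and T: "\<And>t. t \<in> T \<Longrightarrow> 1 \<le> h' t \<and> h' t + 2 \<le> length D \<and> D ! h' t \<in> Y \<and> adj (g' t) (D ! h' t)"
  shows "badn (\<lambda>s t. \<not> (adj (D ! h s) (D ! h' t) \<and> comp (f' s) (D ! h s) (D ! h' t) \<and>
      comp (D ! h s) (D ! h' t) (g' t))) S T \<le> badn nonadj X Y + 2 * real k * \<Delta>"
proof (rule badn_new_edge[OF fin(3,4,1,2) card])
  show "inj_on (\<lambda>s. D ! h s) S" "inj_on (\<lambda>s. D ! h' s) T"
    by (rule inj_on_interior[OF D]; use inj S T in blast)+
  show "D ! h s \<noteq> D ! h' t" if st: "s \<in> S" "t \<in> T" for s t
    using nth_eq_interior[OF D, of "h s" "h' t"] neq[OF st] S[OF st(1)] T[OF st(2)] by auto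
qed (use S T in auto)

lemma inj_on_shift:
  fixes S :: "nat set"
  assumes "\<And>b. b \<in> S \<Longrightarrow> 2 \<le> b"
  shows "inj_on (\<lambda>b. b) S" "inj_on (\<lambda>b. b - 1) S" "inj_on (\<lambda>b. b + 1) S"
proof -
  show "inj_on (\<lambda>b. b - 1) S"
  proof (rule inj_onI)
    fix x y assume "x \<in> S" "y \<in> S" "x - 1 = y - 1"
    then show "x = y" using assms[of x] assms[of y] by linarith
  qed
qed (auto simp: inj_on_def)

text \<open>The positions satisfy b < i < c < j. The pair (b,c) is responsible for two new edges and
  for the inserted path, which costs \<open>2 * bad + 6 * k * \<Delta>\<close>; the pairs (c,j),
  (i,b) and (i,j) are responsible for one new edge each, at \<open>bad + 2 * k * \<Delta>\<close>.
  The total is the left side of \<open>lt\<close>.\<close>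

lemma insert_ordered:
  assumes D: "cpath D" "distinct (butlast (tl D))" and q: "q \<noteq> []" "cpath q"
    and ins: "insertable X Y Xi Yi"
    and Nb: "\<And>b. b \<in> Nb \<Longrightarrow> 2 \<le> b \<and> b + 3 \<le> length D \<and> D ! b \<in> Xi \<and> adj (last q) (D ! b)"
    and Nc: "\<And>c. c \<in> Nc \<Longrightarrow> 2 \<le> c \<and> c + 3 \<le> length D \<and> D ! c \<in> Yi \<and> adj (hd q) (D ! c)"
    and cards: "2 * k + 2 \<le> card Nb" "2 * k + 2 \<le> card Nc"
    and ord: "\<And>b c. b \<in> Nb \<Longrightarrow> c \<in> Nc \<Longrightarrow> b + 2 \<le> c"
    and lt: "5 * badn nonadj X Y + 12 * real k * \<Delta> < (real k)\<^sup>2"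
  shows "\<exists>D'. cpath D' \<and> mset D' = mset D + mset q \<and> same_ends D' D"
proof -
  have finXY: "finite X" "finite Y" using ins finite_V finite_subset unfolding insertable_def by blast+
  have fin: "finite Nb" "finite Nc"
    by (rule finite_subset[of _ "{..length D}"]; use Nb Nc in force)+
  obtain B I where BI: "B \<subseteq> Nb" "I \<subseteq> Nb" "card B = k" "card I = k"
    "\<And>b i. b \<in> B \<Longrightarrow> i \<in> I \<Longrightarrow> b + 3 \<le> i"
    using split_ordered[OF fin(1) cards(1)] by (auto simp: numeral_eq_Suc)
  obtain C J where CJ: "C \<subseteq> Nc" "J \<subseteq> Nc" "card C = k" "card J = k"
    "\<And>b i. b \<in> C \<Longrightarrow> i \<in> J \<Longrightarrow> b + 3 \<le> i"
    using split_ordered[OF fin(2) cards(2)] by (auto simp: numeral_eq_Suc)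
  have fs: "finite B" "finite I" "finite C" "finite J"
    using BI CJ fin finite_subset by blast+
  have XiY: "w \<in> Y" if "x \<in> Xi" "adj x w" for x w using ins that unfolding insertable_def by blast
  have YiX: "w \<in> X" if "x \<in> Yi" "adj x w" for x w using ins that unfolding insertable_def by blast
  have sub: "Xi \<subseteq> X" "Yi \<subseteq> Y" using ins unfolding insertable_def by auto
  have pX: "2 \<le> b" "b + 3 \<le> length D" "D ! b \<in> X" "D ! (b - 1) \<in> Y" "D ! (b + 1) \<in> Y"
    "adj (D ! (b - 2)) (D ! (b - 1))" "adj (D ! (b + 2)) (D ! (b + 1))" "adj (D ! (b + 1)) (D ! b)"
    "adj (last q) (D ! b)" if "b \<in> Nb" for b
    using Nb[OF that] cpath_adj_prev[OF D(1), of b] cpath_adj_prev[OF D(1), of "b+1"]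
      cpath_adj_prev[OF D(1), of "b-1"] cpath_adj_prev[OF D(1), of "b+2"] XiY adj_commute sub
    by (auto simp: numeral_eq_Suc)
  have pY: "2 \<le> b" "b + 3 \<le> length D" "D ! b \<in> Y" "D ! (b - 1) \<in> X" "D ! (b + 1) \<in> X"
    "adj (D ! (b - 2)) (D ! (b - 1))" "adj (D ! (b + 2)) (D ! (b + 1))" "adj (D ! (b + 1)) (D ! b)"
    "adj (hd q) (D ! b)" if "b \<in> Nc" for b
    using Nc[OF that] cpath_adj_prev[OF D(1), of b] cpath_adj_prev[OF D(1), of "b+1"]
      cpath_adj_prev[OF D(1), of "b-1"] cpath_adj_prev[OF D(1), of "b+2"] YiX adj_commute sub
    by (auto simp: numeral_eq_Suc)
  let ?E = "\<lambda>f' f g g' s t. \<not> (adj (f s) (g t) \<and> comp (f' s) (f s) (g t) \<and> comp (f s) (g t) (g' t))"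
  note E = badn_new_edge_nth[OF D(2)]
  let ?R1a = "?E (\<lambda>b. D ! (b-2)) (\<lambda>b. D ! (b-1)) (\<lambda>c. D ! (c+1)) (\<lambda>c. D ! (c+2))"
  let ?R1b = "?E (\<lambda>b. D ! (b+2)) (\<lambda>b. D ! (b+1)) (\<lambda>c. D ! (c-1)) (\<lambda>c. D ! (c-2))"
  let ?R1c = "\<lambda>b c. \<not> cpath ([D ! c] @ q @ [D ! b])"
  let ?R2 = "\<lambda>c j. ?E (\<lambda>j. D ! (j-2)) (\<lambda>j. D ! (j-1)) (\<lambda>c. D ! c) (\<lambda>c. hd q) j c"
  let ?R3 = "\<lambda>i b. ?E (\<lambda>b. last q) (\<lambda>b. D ! b) (\<lambda>i. D ! (i-1)) (\<lambda>i. D ! (i-2)) b i"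
  let ?R4 = "?E (\<lambda>i. D ! (i+1)) (\<lambda>i. D ! i) (\<lambda>j. D ! j) (\<lambda>j. D ! (j+1))"
  let ?N = "badn nonadj X Y"
  have oBI: "b + 3 \<le> i" if "b \<in> B" "i \<in> I" for b i using BI(5) that .
  have oCJ: "b + 3 \<le> i" if "b \<in> C" "i \<in> J" for b i using CJ(5) that .
  have pB: "\<And>b. b \<in> B \<Longrightarrow> b \<in> Nb" "\<And>b. b \<in> I \<Longrightarrow> b \<in> Nb" "\<And>b. b \<in> C \<Longrightarrow> b \<in> Nc" "\<And>b. b \<in> J \<Longrightarrow> b \<in> Nc"
    using BI CJ by auto
  have oIJ: "b + 2 \<le> i" if "b \<in> I" "i \<in> J" for b i using ord pB that by blast
  have oBC: "b + 2 \<le> c" if "b \<in> B" "c \<in> C" for b c using ord pB that by blast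
  have oIC: "b + 2 \<le> c" if "b \<in> I" "c \<in> C" for b c using ord pB that by blast
  have 1: "badn ?R1a B C \<le> badn nonadj Y X + 2 * real k * \<Delta>"
  proof (rule E[OF finXY(2,1) fs(1,3) BI(3) CJ(3)])
    show "b - 1 < c + 1 \<or> c + 1 < b - 1" if "b \<in> B" "c \<in> C" for b c using oBC that by force
    show "1 \<le> b - 1 \<and> b - 1 + 2 \<le> length D \<and> D ! (b - 1) \<in> Y \<and> adj (D ! (b-2)) (D ! (b-1))"
      if "b \<in> B" for b using pX[OF pB(1)[OF that]] by simp
    show "1 \<le> b + 1 \<and> b + 1 + 2 \<le> length D \<and> D ! (b + 1) \<in> X \<and> adj (D ! (b+2)) (D ! (b+1))"
      if "b \<in> C" for b using pY[OF pB(3)[OF that]] by simp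
  qed (rule inj_on_shift; use pX(1) pY(1) pB in blast)+
  have 2: "badn ?R1b B C \<le> badn nonadj Y X + 2 * real k * \<Delta>"
  proof (rule E[OF finXY(2,1) fs(1,3) BI(3) CJ(3)])
    show "b + 1 < c - 1 \<or> c - 1 < b + 1" if "b \<in> B" "c \<in> C" for b c
    proof -
      note bc = that
      \<comment> \<open>An element of \<open>I\<close> lies between \<open>b\<close> and
        \<open>c\<close>. It is needed because \<open>b + 2 \<le> c\<close> alone would allow
        \<open>b + 1\<close> and \<open>c - 1\<close> to coincide.\<close>
      obtain i where "i \<in> I" using BI(3,4) bc(1) fs by (metis card_eq_0_iff equals0D ex_in_conv)
      then show ?thesis using oBI[OF bc(1), of i] oIC[of i c] bc by force
    qed
    show "1 \<le> b + 1 \<and> b + 1 + 2 \<le> length D \<and> D ! (b + 1) \<in> Y \<and> adj (D ! (b+2)) (D ! (b+1))"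
      if "b \<in> B" for b using pX[OF pB(1)[OF that]] by simp
    show "1 \<le> b - 1 \<and> b - 1 + 2 \<le> length D \<and> D ! (b - 1) \<in> X \<and> adj (D ! (b-2)) (D ! (b-1))"
      if "b \<in> C" for b using pY[OF pB(3)[OF that]] by simp
  qed (rule inj_on_shift; use pX(1) pY(1) pB in blast)+
  have 3: "badn ?R1c B C \<le> 2 * real k * \<Delta>"
  proof (rule badn_item[OF fs(1,3) BI(3) CJ(3) _ _ q])
    show "inj_on ((!) D) B" "inj_on ((!) D) C"
      by (rule inj_on_interior[OF D(2)]; use pX pY pB in \<open>force simp: inj_on_def\<close>)+
  qed (use pX pY pB in auto)
  have "badn (?E (\<lambda>j. D ! (j-2)) (\<lambda>j. D ! (j-1)) (\<lambda>c. D ! c) (\<lambda>c. hd q)) J C \<le> ?N + 2 * real k * \<Delta>"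
  proof (rule E[OF finXY fs(4,3) CJ(4,3)])
    show "j - 1 < c \<or> c < j - 1" if "j \<in> J" "c \<in> C" for j c using oCJ[of c j] that by force
    show "1 \<le> b - 1 \<and> b - 1 + 2 \<le> length D \<and> D ! (b - 1) \<in> X \<and> adj (D ! (b-2)) (D ! (b-1))"
      if "b \<in> J" for b using pY[OF pB(4)[OF that]] by simp
    show "1 \<le> b \<and> b + 2 \<le> length D \<and> D ! b \<in> Y \<and> adj (hd q) (D ! b)"
      if "b \<in> C" for b using pY[OF pB(3)[OF that]] by simp
  qed (rule inj_on_shift; use pX(1) pY(1) pB in blast)+
  then have 4: "badn ?R2 C J \<le> ?N + 2 * real k * \<Delta>" by (subst badn_swap)
  have "badn (?E (\<lambda>b. last q) (\<lambda>b. D ! b) (\<lambda>i. D ! (i-1)) (\<lambda>i. D ! (i-2))) B I \<le> ?N + 2 * real k * \<Delta>"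
  proof (rule E[OF finXY fs(1,2) BI(3,4)])
    show "b < i - 1 \<or> i - 1 < b" if "b \<in> B" "i \<in> I" for b i using oBI[of b i] that by force
    show "1 \<le> b - 1 \<and> b - 1 + 2 \<le> length D \<and> D ! (b - 1) \<in> Y \<and> adj (D ! (b-2)) (D ! (b-1))"
      if "b \<in> I" for b using pX[OF pB(2)[OF that]] by simp
    show "1 \<le> b \<and> b + 2 \<le> length D \<and> D ! b \<in> X \<and> adj (last q) (D ! b)"
      if "b \<in> B" for b using pX[OF pB(1)[OF that]] by simp
  qed (rule inj_on_shift; use pX(1) pY(1) pB in blast)+
  then have 5: "badn ?R3 I B \<le> ?N + 2 * real k * \<Delta>" by (subst badn_swap)
  have 6: "badn ?R4 I J \<le> ?N + 2 * real k * \<Delta>"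
  proof (rule E[OF finXY fs(2,4) BI(4) CJ(4)])
    show "i < j \<or> j < i" if "i \<in> I" "j \<in> J" for i j using oIJ[of i j] that by force
    show "1 \<le> b \<and> b + 2 \<le> length D \<and> D ! b \<in> X \<and> adj (D ! (b+1)) (D ! b)"
      if "b \<in> I" for b using pX[OF pB(2)[OF that]] by simp
    show "1 \<le> b \<and> b + 2 \<le> length D \<and> D ! b \<in> Y \<and> adj (D ! (b+1)) (D ! b)"
      if "b \<in> J" for b using pY[OF pB(4)[OF that]] by simp
  qed (rule inj_on_shift; use pX(1) pY(1) pB in blast)+
  let ?R1 = "\<lambda>b c. ?R1a b c \<or> (?R1b b c \<or> ?R1c b c)"
  have 7: "badn ?R1 B C \<le> 2 * ?N + 6 * real k * \<Delta>"
    using badn_or_le[of ?R1a "\<lambda>b c. ?R1b b c \<or> ?R1c b c" B C] badn_or_le[of ?R1b ?R1c B C] 1 2 3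
      badn_nonadj_sym[of Y X] by linarith
  have "badn ?R1 B C + badn ?R2 C J + badn ?R3 I B + badn ?R4 I J < (real k)\<^sup>2"
    using 4 5 6 7 lt by linarith
  from four_choice[OF fs(2,1,3,4) BI(4,3) CJ(3,4) this] obtain i b c j where
    m: "i \<in> I" "b \<in> B" "c \<in> C" "j \<in> J" and R: "\<not> ?R1 b c" "\<not> ?R2 c j" "\<not> ?R3 i b" "\<not> ?R4 i j"
    by blast
  have o: "2 \<le> b" "b + 3 \<le> i" "i + 2 \<le> c" "c + 3 \<le> j" "j + 2 \<le> length D"
    using pX(1)[OF pB(1)[OF m(2)]] oBI[OF m(2,1)] oIC[OF m(1,3)] oCJ[OF m(3,4)] pY(2)[OF pB(4)[OF m(4)]]
    by auto
  show ?thesis unfolding same_ends_def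
    by (rule switch_cpath[OF D(1) q(1) o]) (use R in \<open>simp_all only: not_not de_Morgan_disj\<close>)
qed

lemma cpath_nth_nbrs:
  assumes "cpath D" "2 \<le> b" "b + 3 \<le> length D"
  shows "adj (D ! b) (D ! (b - 1))" "adj (D ! b) (D ! (b + 1))"
    "adj (D ! (b - 2)) (D ! (b - 1))" "adj (D ! (b + 2)) (D ! (b + 1))" "adj (D ! (b + 1)) (D ! b)"
  using cpath_adj_prev[OF assms(1), of b] cpath_adj_prev[OF assms(1), of "b+1"]
      cpath_adj_prev[OF assms(1), of "b-1"] cpath_adj_prev[OF assms(1), of "b+2"] adj_commute assms
  by (auto simp: numeral_eq_Suc)

text \<open>\<open>R\<close> lets a caller impose its own conditions on the two deleted vertices and
  have them met by the same union bound.\<close>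

lemma excise_ordered:
  assumes D: "cpath D" "distinct (butlast (tl D))"
    and ins: "insertable X Y Xi Yi"
    and I: "\<And>i. i \<in> I \<Longrightarrow> 2 \<le> i \<and> i + 3 \<le> length D \<and> D ! i \<in> Xi"
    and J: "\<And>j. j \<in> J \<Longrightarrow> 2 \<le> j \<and> j + 3 \<le> length D \<and> D ! j \<in> Yi"
    and card: "card I = k" "card J = k"
    and ord: "\<And>i j. i \<in> I \<Longrightarrow> j \<in> J \<Longrightarrow> i + 3 \<le> j"
    and lt: "2 * badn nonadj X Y + 4 * real k * \<Delta> + badn R I J < (real k)\<^sup>2"
  shows "\<exists>i\<in>I. \<exists>j\<in>J. \<not> R i j \<and>
    (\<exists>D'. cpath D' \<and> mset D = mset D' + {#D ! i, D ! j#} \<and> same_ends D' D)"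
proof -
  have finXY: "finite X" "finite Y" using ins finite_V finite_subset unfolding insertable_def by blast+
  have fin: "finite I" "finite J"
    by (rule finite_subset[of _ "{..length D}"]; use I J in force)+
  have XiY: "w \<in> Y" if "x \<in> Xi" "adj x w" for x w using ins that unfolding insertable_def by blast
  have YiX: "w \<in> X" if "x \<in> Yi" "adj x w" for x w using ins that unfolding insertable_def by blast
  let ?E = "\<lambda>f' f g g' s t. \<not> (adj (f s) (g t) \<and> comp (f' s) (f s) (g t) \<and> comp (f s) (g t) (g' t))"
  note E = badn_new_edge_nth[OF D(2)]
  let ?R1 = "?E (\<lambda>b. D ! (b-2)) (\<lambda>b. D ! (b-1)) (\<lambda>c. D ! (c-1)) (\<lambda>c. D ! (c-2))"
  let ?R2 = "?E (\<lambda>b. D ! (b+2)) (\<lambda>b. D ! (b+1)) (\<lambda>c. D ! (c+1)) (\<lambda>c. D ! (c+2))"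
  have 1: "badn ?R1 I J \<le> badn nonadj Y X + 2 * real k * \<Delta>"
  proof (rule E[OF finXY(2,1) fin card])
    show "b - 1 < c - 1 \<or> c - 1 < b - 1" if "b \<in> I" "c \<in> J" for b c using ord[OF that] by force
    show "1 \<le> b - 1 \<and> b - 1 + 2 \<le> length D \<and> D ! (b - 1) \<in> Y \<and> adj (D ! (b-2)) (D ! (b-1))"
      if "b \<in> I" for b using I[OF that] cpath_nth_nbrs[OF D(1), of b] XiY by auto
    show "1 \<le> b - 1 \<and> b - 1 + 2 \<le> length D \<and> D ! (b - 1) \<in> X \<and> adj (D ! (b-2)) (D ! (b-1))"
      if "b \<in> J" for b using J[OF that] cpath_nth_nbrs[OF D(1), of b] YiX by auto
  qed (rule inj_on_shift; use I J in blast)+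
  have 2: "badn ?R2 I J \<le> badn nonadj Y X + 2 * real k * \<Delta>"
  proof (rule E[OF finXY(2,1) fin card])
    show "b + 1 < c + 1 \<or> c + 1 < b + 1" if "b \<in> I" "c \<in> J" for b c using ord[OF that] by force
    show "1 \<le> b + 1 \<and> b + 1 + 2 \<le> length D \<and> D ! (b + 1) \<in> Y \<and> adj (D ! (b+2)) (D ! (b+1))"
      if "b \<in> I" for b using I[OF that] cpath_nth_nbrs[OF D(1), of b] XiY by auto
    show "1 \<le> b + 1 \<and> b + 1 + 2 \<le> length D \<and> D ! (b + 1) \<in> X \<and> adj (D ! (b+2)) (D ! (b+1))"
      if "b \<in> J" for b using J[OF that] cpath_nth_nbrs[OF D(1), of b] YiX by auto
  qed (rule inj_on_shift; use I J in blast)+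
  have "badn (\<lambda>i j. ?R1 i j \<or> (?R2 i j \<or> R i j)) I J < (real k)\<^sup>2"
    using badn_or_le[of ?R1 "\<lambda>i j. ?R2 i j \<or> R i j" I J] badn_or_le[of ?R2 R I J] 1 2
      badn_nonadj_sym[of Y X] lt by linarith
  then obtain i j where m: "i \<in> I" "j \<in> J" and R: "\<not> ?R1 i j" "\<not> ?R2 i j" "\<not> R i j"
    using pair_choice[OF fin, of "\<lambda>i j. ?R1 i j \<or> (?R2 i j \<or> R i j)"] card
    by (auto simp: power2_eq_square)
  have o: "2 \<le> i" "i + 3 \<le> j" "j + 3 \<le> length D" using I[OF m(1)] J[OF m(2)] ord[OF m] by auto
  have "\<exists>D'. cpath D' \<and> mset D = mset D' + {#D ! i, D ! j#} \<and> same_ends D' D"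
    unfolding same_ends_def
    by (rule excise_cpath[OF D(1) o]) (use R in \<open>simp_all only: not_not de_Morgan_disj\<close>)
  then show ?thesis using m R by blast
qed

text \<open>Appending the first two vertices makes \<open>cpath\<close> check the closing edge and
  the two compatibility conditions next to it, so every operation on paths applies to
  cycles.\<close>

definition ccycle :: "'a list \<Rightarrow> bool" where
  "ccycle C \<longleftrightarrow> distinct C \<and> 3 \<le> length C \<and> cpath (C @ take 2 C)"

lemma ccycle_distinct: "ccycle C \<Longrightarrow> distinct (butlast (tl (C @ take 2 C)))"
  unfolding ccycle_def by (cases C; cases "tl C") (auto simp: butlast_append)

text \<open>The rearranged sequence starts and ends with the same two vertices as before, so it is
  again some \<open>C'\<close> followed by its own first two vertices.\<close>

lemma ccycle_of_path:
  assumes C: "ccycle C" and D': "cpath D'" "same_ends D' (C @ take 2 C)"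
    and m: "mset D' = mset (take 2 C) + mset xs" and xs: "distinct xs" "3 \<le> length xs"
  shows "\<exists>C'. ccycle C' \<and> set C' = set xs"
proof -
  have l: "3 \<le> length C" using C ccycle_def by auto
  define C' where "C' = take (length D' - 2) D'"
  have ld: "length D' = 2 + length xs" using arg_cong[OF m, of size] l by simp
  have "drop (length (C @ take 2 C) - 2) (C @ take 2 C) = take 2 C" using l by simp
  then have 1: "D' = C' @ take 2 C" using D' unfolding same_ends_def C'_def by (metis append_take_drop_id)
  have "take 2 C' = take 2 D'" using ld xs unfolding C'_def by (simp add: min_def)
  also have "\<dots> = take 2 C" using D' l unfolding same_ends_def by simp
  finally have 2: "take 2 C' = take 2 C" .
  have 3: "mset C' = mset xs" using m 1 by simp
  have "distinct C'" using mset_eq_imp_distinct_iff[OF 3] xs by simp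
  moreover have "length C' = length xs" using 3 mset_eq_length by blast
  moreover have "set C' = set xs" using 3 mset_eq_setD by blast
  ultimately show ?thesis using D' 1 2 xs unfolding ccycle_def by auto
qed

section \<open>Absorbing vertices into a cycle\<close>

lemma card_positions:
  assumes "distinct C"
  shows "card {w \<in> set C. P w} \<le> card {i. 2 \<le> i \<and> i < length C \<and> P (C ! i)} + 2"
proof -
  let ?N = "{i. 2 \<le> i \<and> i < length C \<and> P (C ! i)}"
  have "{w \<in> set C. P w} \<subseteq> (!) C ` ?N \<union> {C ! 0, C ! 1}"
  proof
    fix w assume "w \<in> {w \<in> set C. P w}"
    then obtain i where i: "i < length C" "C ! i = w" "P w" by (auto simp: in_set_conv_nth)
    then show "w \<in> (!) C ` ?N \<union> {C ! 0, C ! 1}"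
      by (cases "2 \<le> i") (auto simp: not_le less_2_cases_iff)
  qed
  then have "card {w \<in> set C. P w} \<le> card ((!) C ` ?N \<union> {C ! 0, C ! 1})"
    by (intro card_mono) auto
  also have "\<dots> \<le> card ((!) C ` ?N) + card {C ! 0, C ! 1}" by (rule card_Un_le)
  also have "card ((!) C ` ?N) \<le> card ?N" by (rule card_image_le) auto
  also have "card {C ! 0, C ! 1} \<le> 2" by (simp add: card_insert_if)
  finally show ?thesis by simp
qed

lemma same_ends_rev:
  assumes "same_ends D' (rev D)" "2 \<le> length D" "2 \<le> length D'"
  shows "same_ends (rev D') D"
proof -
  have "take 2 (rev D') = rev (drop (length D' - 2) D')" by (simp add: take_rev)
  also have "\<dots> = take 2 D" using assms unfolding same_ends_def by (simp add: drop_rev)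
  finally have 1: "take 2 (rev D') = take 2 D" .
  have "drop (length (rev D') - 2) (rev D') = rev (take 2 D')" using assms by (simp add: drop_rev)
  also have "\<dots> = drop (length D - 2) D" using assms unfolding same_ends_def by (simp add: take_rev)
  finally show ?thesis using 1 unfolding same_ends_def by blast
qed

text \<open>Positions 0 and 1 stay fixed, which costs at most two of the \<open>4 * k + 8\<close>
  neighbours. The other \<open>4 * k + 6\<close> allow the neighbours of the two ends of
  \<open>q\<close> to be separated into blocks of \<open>2 * k + 2\<close>, and each block yields
  two sets of \<open>k\<close> with two positions in between.\<close>

lemma insert_cycle:
  assumes C: "ccycle C" and q: "q \<noteq> []" "cpath q" "distinct q" "set q \<inter> set C = {}"
    and ins: "insertable X Y Xi Yi"
    and b: "4 * k + 8 \<le> card {w \<in> set C. w \<in> Xi \<and> adj (last q) w}"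
    and c: "4 * k + 8 \<le> card {w \<in> set C. w \<in> Yi \<and> adj (hd q) w}"
    and lt: "5 * badn nonadj X Y + 12 * real k * \<Delta> < (real k)\<^sup>2"
  shows "\<exists>C'. ccycle C' \<and> set C' = set C \<union> set q"
proof -
  define D where "D = C @ take 2 C"
  define Nb where "Nb = {i. 2 \<le> i \<and> i < length C \<and> C ! i \<in> Xi \<and> adj (last q) (C ! i)}"
  define Nc where "Nc = {i. 2 \<le> i \<and> i < length C \<and> C ! i \<in> Yi \<and> adj (hd q) (C ! i)}"
  have Cd: "distinct C" "3 \<le> length C" using C ccycle_def by auto
  have D: "cpath D" "distinct (butlast (tl D))" "length D = length C + 2"
    using C ccycle_distinct[OF C] unfolding ccycle_def D_def by auto
  have nb: "2 * (2*k+2) + 2 \<le> card Nb"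
    using card_positions[OF Cd(1), of "\<lambda>w. w \<in> Xi \<and> adj (last q) w"] b by (simp add: Nb_def)
  have nc: "2 * (2*k+2) + 2 \<le> card Nc"
    using card_positions[OF Cd(1), of "\<lambda>w. w \<in> Yi \<and> adj (hd q) w"] c by (simp add: Nc_def)
  have "finite Nb" "finite Nc" unfolding Nb_def Nc_def by auto
  from split_two[OF this nb nc] obtain I J where IJ: "I \<subseteq> Nb" "J \<subseteq> Nc" "2*k+2 \<le> card I" "2*k+2 \<le> card J"
    and o: "(\<forall>i\<in>I. \<forall>j\<in>J. i + 2 \<le> j) \<or> (\<forall>i\<in>I. \<forall>j\<in>J. j + 2 \<le> i)" by metis
  have I: "2 \<le> i \<and> i + 3 \<le> length D \<and> D ! i \<in> Xi \<and> adj (last q) (D ! i)" if "i \<in> I" for i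
    using that IJ(1) D(3) unfolding Nb_def D_def by (auto simp: nth_append)
  have J: "2 \<le> i \<and> i + 3 \<le> length D \<and> D ! i \<in> Yi \<and> adj (hd q) (D ! i)" if "i \<in> J" for i
    using that IJ(2) D(3) unfolding Nc_def D_def by (auto simp: nth_append)
  have "\<exists>D'. cpath D' \<and> mset D' = mset D + mset q \<and> same_ends D' D"
  proof (cases "\<forall>i\<in>I. \<forall>j\<in>J. i + 2 \<le> j")
    case True
    then show ?thesis
      by (intro insert_ordered[OF D(1,2) q(1,2) ins I J IJ(3,4) _ lt]) auto
  next
    case False
    then have o: "\<And>i j. i \<in> I \<Longrightarrow> j \<in> J \<Longrightarrow> j + 2 \<le> i" using o by blast
    \<comment> \<open>If the neighbours of \<open>hd q\<close> come first, the cycle is read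
      backwards. This corrects the order while \<open>q\<close> and the roles of \<open>X\<close>
      and \<open>Y\<close> stay as they are.\<close>
    let ?r = "\<lambda>i. length D - 1 - i"
    have r: "rev D ! ?r i = D ! i" "?r (?r i) = i" if "i + 3 \<le> length D" for i
      using that by (auto simp: rev_nth)
    have "inj_on ?r I" "inj_on ?r J" by (rule inj_on_inverseI[of _ ?r]; use r I J in blast)+
    then have cr: "2*k+2 \<le> card (?r ` I)" "2*k+2 \<le> card (?r ` J)" using IJ by (simp_all add: card_image)
    have "tl (rev D) = rev (butlast D)" by (metis butlast_rev rev_rev_ident)
    then have Dr: "cpath (rev D)" "distinct (butlast (tl (rev D)))"
      using cpath_rev[OF D(1)] D(2) by (simp_all add: butlast_rev butlast_tl)
    have "\<exists>D'. cpath D' \<and> mset D' = mset (rev D) + mset q \<and> same_ends D' (rev D)"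
    proof (rule insert_ordered[OF Dr q(1,2) ins _ _ cr _ lt])
      fix b assume "b \<in> ?r ` I"
      then show "2 \<le> b \<and> b + 3 \<le> length (rev D) \<and> rev D ! b \<in> Xi \<and> adj (last q) (rev D ! b)"
        using I r by force
    next
      fix b assume "b \<in> ?r ` J"
      then show "2 \<le> b \<and> b + 3 \<le> length (rev D) \<and> rev D ! b \<in> Yi \<and> adj (hd q) (rev D ! b)"
        using J r by force
    next
      fix b c assume "b \<in> ?r ` I" "c \<in> ?r ` J"
      then show "b + 2 \<le> c" using o I J by force
    qed
    then obtain D' where D': "cpath D'" "mset D' = mset (rev D) + mset q" "same_ends D' (rev D)" by blast
    have "length D' = length D + length q" using arg_cong[OF D'(2), of size] by simp
    then have "same_ends (rev D') D" using same_ends_rev[OF D'(3)] Cd D(3) by simp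
    then show ?thesis using D' cpath_rev by (intro exI[of _ "rev D'"]) simp
  qed
  then obtain D' where D': "cpath D'" "mset D' = mset D + mset q" "same_ends D' D" by blast
  have "\<exists>C'. ccycle C' \<and> set C' = set (C @ q)"
    by (rule ccycle_of_path[OF C D'(1)]) (use D' D_def Cd q in auto)
  then show ?thesis by simp
qed

lemma insertable_sym: "insertable X Y Xi Yi \<Longrightarrow> insertable Y X Yi Xi"
  unfolding insertable_def by blast

text \<open>To avoid assuming that \<open>v\<close> is adjacent to \<open>U\<close>, two vertices \<open>x, y\<close> are first removed from the
  cycle, and then the path \<open>v y x U\<close> is inserted.\<close>

lemma insert_pair:
  assumes C: "ccycle C" and U: "U \<noteq> []" "cpath U" "distinct (v # U)" "set (v # U) \<inter> set C = {}"
    and ins: "insertable X Y Xi Yi"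
    and v: "4 * k + 10 \<le> card {w \<in> set C. w \<in> Yi \<and> adj v w}"
    and hU: "4 * k + 10 \<le> card {w \<in> set C. w \<in> Xi \<and> adj (hd U) w}"
    and lU: "4 * k + 10 \<le> card {w \<in> set C. w \<in> Xi \<and> adj (last U) w}"
    and lt: "5 * badn nonadj X Y + 12 * real k * \<Delta> < (real k)\<^sup>2"
  shows "\<exists>C'. ccycle C' \<and> set C' = set C \<union> set (v # U)"
proof -
  define D where "D = C @ take 2 C"
  define N where "N = {i. 2 \<le> i \<and> i < length C \<and> C ! i \<in> Xi \<and> adj (hd U) (C ! i)}"
  define M where "M = {i. 2 \<le> i \<and> i < length C \<and> C ! i \<in> Yi \<and> adj v (C ! i)}"
  have Cd: "distinct C" "3 \<le> length C" using C ccycle_def by auto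
  have D: "cpath D" "distinct (butlast (tl D))" "length D = length C + 2"
    using C ccycle_distinct[OF C] unfolding ccycle_def D_def by auto
  have finXY: "finite X" "finite Y" using ins finite_V finite_subset unfolding insertable_def by blast+
  have sub: "Xi \<subseteq> X" "Yi \<subseteq> Y" using ins unfolding insertable_def by auto
  have n: "2 * k + 3 \<le> card N"
    using card_positions[OF Cd(1), of "\<lambda>w. w \<in> Xi \<and> adj (hd U) w"] hU by (simp add: N_def)
  have m: "2 * k + 3 \<le> card M"
    using card_positions[OF Cd(1), of "\<lambda>w. w \<in> Yi \<and> adj v w"] v by (simp add: M_def)
  have "finite N" "finite M" unfolding N_def M_def by auto
  from split_two[OF this n m] obtain I0 J0 where IJ0: "I0 \<subseteq> N" "J0 \<subseteq> M" "k \<le> card I0" "k \<le> card J0"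
    and o0: "(\<forall>i\<in>I0. \<forall>j\<in>J0. i + 3 \<le> j) \<or> (\<forall>i\<in>I0. \<forall>j\<in>J0. j + 3 \<le> i)" by metis
  obtain I J where IJ: "I \<subseteq> I0" "J \<subseteq> J0" "card I = k" "card J = k" "finite I" "finite J"
    using IJ0 obtain_subset_with_card_n by metis
  have o: "(\<forall>i\<in>I. \<forall>j\<in>J. i + 3 \<le> j) \<or> (\<forall>i\<in>I. \<forall>j\<in>J. j + 3 \<le> i)" using IJ o0 by blast
  have I: "2 \<le> i \<and> i + 3 \<le> length D \<and> D ! i \<in> Xi \<and> adj (hd U) (D ! i) \<and> D ! i = C ! i" if "i \<in> I" for i
    using that IJ IJ0(1) D(3) unfolding N_def D_def by (force simp: nth_append)
  have J: "2 \<le> i \<and> i + 3 \<le> length D \<and> D ! i \<in> Yi \<and> adj v (D ! i) \<and> D ! i = C ! i" if "i \<in> J" for i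
    using that IJ IJ0(2) D(3) unfolding M_def D_def by (force simp: nth_append)
  \<comment> \<open>These are the conditions inside the path \<open>v y x U\<close>. Handing them to
    the excision yields a pair that can be removed from the cycle and also fits into the new
    path.\<close>
  let ?R1 = "\<lambda>i j. \<not> (adj (D ! i) (D ! j) \<and> comp (hd U) (D ! i) (D ! j) \<and> comp (D ! i) (D ! j) v)"
  let ?R2 = "\<lambda>i j. 2 \<le> length U \<and> adj (hd U) (D ! i) \<and> \<not> comp (U ! 1) (hd U) (D ! i)"
  let ?R = "\<lambda>i j. ?R1 i j \<or> ?R2 i j"
  have "badn ?R1 I J \<le> badn nonadj X Y + 2 * real k * \<Delta>"
  proof (rule badn_new_edge_nth[OF D(2) finXY IJ(5,6,3,4)])
    show "i < j \<or> j < i" if "i \<in> I" "j \<in> J" for i j using o that by force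
    show "1 \<le> i \<and> i + 2 \<le> length D \<and> D ! i \<in> X \<and> adj (hd U) (D ! i)" if "i \<in> I" for i
      using I[OF that] sub by auto
    show "1 \<le> i \<and> i + 2 \<le> length D \<and> D ! i \<in> Y \<and> adj v (D ! i)" if "i \<in> J" for i
      using J[OF that] sub by auto
  qed (auto simp: inj_on_def)
  moreover have "badn ?R2 I J \<le> real k * \<Delta>"
  proof (cases "2 \<le> length U")
    case True
    have "adj (U ! 1) (hd U)" using cpath_nth_adj[OF U(2), of 0] True U(1) by (simp add: hd_conv_nth adj_commute)
    moreover have "inj_on (\<lambda>i. D ! i) I"
    proof (rule inj_on_interior[OF D(2)])
      show "1 \<le> i \<and> i + 2 \<le> length D" if "i \<in> I" for i using I[OF that] by auto
    qed (auto simp: inj_on_def)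
    ultimately show ?thesis
      using badn_col_le[of I J ?R2 \<Delta>] comp_row[of "U ! 1" "hd U" "\<lambda>i. D ! i" I] IJ True by auto
  next
    case False
    then have "badn ?R2 I J = 0" unfolding badn_def by simp
    then show ?thesis using \<Delta>_nonneg by simp
  qed
  ultimately have R: "badn ?R I J \<le> badn nonadj X Y + 3 * real k * \<Delta>"
    using badn_or_le[of ?R1 ?R2 I J] by linarith
  have kD: "0 \<le> real k * \<Delta>" using \<Delta>_nonneg by simp
  \<comment> \<open>The excision costs at most \<open>3 * bad + 7 * k * \<Delta>\<close>, no more
    than the insertion that follows.\<close>
  have lt1: "2 * badn nonadj X Y + 4 * real k * \<Delta> + badn ?R I J < (real k)\<^sup>2"
    using lt R kD badn_nonneg[of nonadj X Y] by linarith
  have "\<exists>i\<in>I. \<exists>j\<in>J. \<not> ?R i j \<and> (\<exists>D'. cpath D' \<and> mset D = mset D' + {#D ! i, D ! j#} \<and> same_ends D' D)"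
  proof (cases "\<forall>i\<in>I. \<forall>j\<in>J. i + 3 \<le> j")
    case True
    show ?thesis
      by (rule excise_ordered[OF D(1,2) ins _ _ IJ(3,4) _ lt1]) (use I J True in blast)+
  next
    case False
    then have o: "\<And>i j. i \<in> I \<Longrightarrow> j \<in> J \<Longrightarrow> j + 3 \<le> i" using o by blast
    have "2 * badn nonadj Y X + 4 * real k * \<Delta> + badn (\<lambda>j i. ?R i j) J I < (real k)\<^sup>2"
      using lt1 badn_swap[of ?R I J] badn_nonadj_sym[of Y X] by simp
    from excise_ordered[OF D(1,2) insertable_sym[OF ins] _ _ IJ(4,3) _ this]
    obtain j i D' where "j \<in> J" "i \<in> I" "\<not> ?R i j" "cpath D'" "mset D = mset D' + {#D ! j, D ! i#}"
      "same_ends D' D" using I J o by blast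
    then show ?thesis using add_mset_commute[of "D ! i" "D ! j"]
      by (intro bexI[of _ i] bexI[of _ j] conjI exI[of _ D']) auto
  qed
  then obtain i j D' where ij: "i \<in> I" "j \<in> J" "\<not> ?R i j" and
    D': "cpath D'" "mset D = mset D' + {#D ! i, D ! j#}" "same_ends D' D" by blast
  define x y where "x = D ! i" and "y = D ! j"
  have xy: "x \<in> set C" "y \<in> set C" "x \<noteq> y"
  proof -
    have "i < length C" "j < length C" "i \<noteq> j" using I[OF ij(1)] J[OF ij(2)] D(3) o ij by force+
    then show "x \<in> set C" "y \<in> set C" "x \<noteq> y"
      using I[OF ij(1)] J[OF ij(2)] nth_eq_iff_index_eq[OF Cd(1)] unfolding x_def y_def by auto
  qed
  have mC: "mset C = mset (remove1 x (remove1 y C)) + {#x, y#}"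
  proof -
    have rm: "mset zs = add_mset z (mset (remove1 z zs))" if "z \<in> set zs" for z and zs :: "'a list"
      using that by simp
    have "mset C = add_mset y (mset (remove1 y C))" by (rule rm[OF xy(2)])
    also have "mset (remove1 y C) = add_mset x (mset (remove1 x (remove1 y C)))"
      by (rule rm) (use xy in \<open>simp add: in_set_remove1\<close>)
    also have "add_mset y (add_mset x M) = M + {#x, y#}" for M :: "'a multiset" by simp
    finally show ?thesis .
  qed
  have "mset D = mset (take 2 C) + mset (remove1 x (remove1 y C)) + {#x, y#}"
    unfolding D_def mset_append by (subst mC) (simp only: ac_simps)
  then have mD': "mset D' = mset (take 2 C) + mset (remove1 x (remove1 y C))"
    using D'(2) x_def y_def by simp
  have len: "4 * k + 10 \<le> length C"
  proof -
    have "card {w \<in> set C. w \<in> Yi \<and> adj v w} \<le> card (set C)" by (rule card_mono) auto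
    then show ?thesis using v card_length[of C] by simp
  qed
  have "3 \<le> length (remove1 x (remove1 y C))" using xy len by (simp add: length_remove1)
  then obtain C1 where C1: "ccycle C1" "set C1 = set (remove1 x (remove1 y C))"
    using ccycle_of_path[OF C D'(1) _ mD'] D'(3) Cd D_def by auto
  have sC1: "set C1 = set C - {x, y}" using C1 Cd by (auto simp: set_remove1_eq)
  define q where "q = [v, y, x] @ U"
  have cq: "cpath q"
  proof -
    have 1: "adj v y" "adj (hd U) x" using I[OF ij(1)] J[OF ij(2)] x_def y_def by auto
    have 2: "adj x y" "comp (hd U) x y" "comp x y v" "2 \<le> length U \<longrightarrow> comp (U ! 1) (hd U) x"
      using ij(3) 1 unfolding x_def y_def by auto
    have "cpath [v, y, x]" using 1 2 adj_commute comp_commute by auto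
    then show ?thesis unfolding q_def using U 1 2 adj_commute comp_commute
      by (subst cpath_append) (auto simp: numeral_2_eq_2)
  qed
  \<comment> \<open>Only \<open>x\<close> and \<open>y\<close> have left the cycle; they account for
    the difference between \<open>4 * k + 10\<close> and \<open>4 * k + 8\<close>.\<close>
  have cnt: "4 * k + 8 \<le> card {w \<in> set C1. P w}" if "4 * k + 10 \<le> card {w \<in> set C. P w}" for P
  proof -
    have "{w \<in> set C. P w} \<subseteq> {w \<in> set C1. P w} \<union> {x, y}" using sC1 by auto
    then have "card {w \<in> set C. P w} \<le> card ({w \<in> set C1. P w} \<union> {x, y})" by (intro card_mono) auto
    also have "\<dots> \<le> card {w \<in> set C1. P w} + card {x, y}" by (rule card_Un_le)
    also have "card {x, y} \<le> 2" by (simp add: card_insert_if)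
    finally show ?thesis using that by simp
  qed
  have "\<exists>C'. ccycle C' \<and> set C' = set C1 \<union> set q"
  proof (rule insert_cycle[OF C1(1) _ cq _ _ ins _ _ lt])
    show "4 * k + 8 \<le> card {w \<in> set C1. w \<in> Xi \<and> adj (last q) w}"
      using cnt[OF lU] U(1) by (simp add: q_def)
    show "4 * k + 8 \<le> card {w \<in> set C1. w \<in> Yi \<and> adj (hd q) w}"
      using cnt[OF v] by (simp add: q_def)
  qed (use U xy sC1 in \<open>auto simp: q_def\<close>)
  then show ?thesis using sC1 xy by (auto simp: q_def)
qed

section \<open>Greedy construction of long paths\<close>

lemma card_available:
  assumes "finite P" "real (card {p \<in> P. \<not> adj l p}) \<le> \<tau>" "adj l' l" "real (card (W \<inter> P)) \<le> m"
  shows "real (card P) - m - \<tau> - \<Delta> \<le> real (card {p \<in> P. p \<notin> W \<and> adj l p \<and> comp l' l p})"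
proof -
  let ?G = "{p \<in> P. p \<notin> W \<and> adj l p \<and> comp l' l p}"
  have "P \<subseteq> ?G \<union> (W \<inter> P) \<union> {p \<in> P. \<not> adj l p} \<union> {p \<in> P. adj l p \<and> \<not> comp l' l p}" by auto
  then have "card P \<le> card (?G \<union> (W \<inter> P) \<union> {p \<in> P. \<not> adj l p} \<union> {p \<in> P. adj l p \<and> \<not> comp l' l p})"
    using assms(1) by (intro card_mono) auto
  also have "\<dots> \<le> card ?G + card (W \<inter> P) + card {p \<in> P. \<not> adj l p} + card {p \<in> P. adj l p \<and> \<not> comp l' l p}"
    using card_Un_le[of "?G \<union> (W \<inter> P) \<union> {p \<in> P. \<not> adj l p}" "{p \<in> P. adj l p \<and> \<not> comp l' l p}"]
      card_Un_le[of "?G \<union> (W \<inter> P)" "{p \<in> P. \<not> adj l p}"] card_Un_le[of ?G "W \<inter> P"] by linarith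
  finally show ?thesis using assms comp_row[of l' l "\<lambda>p. p" P] by (simp add: inj_on_def)
qed

lemma cpath_snoc:
  assumes "2 \<le> length xs"
  shows "cpath (xs @ [p]) \<longleftrightarrow> cpath xs \<and> adj (last xs) p \<and> comp (xs ! (length xs - 2)) (last xs) p"
  using assms by (subst cpath_append) auto

lemma cpath_adj_last: "cpath xs \<Longrightarrow> 2 \<le> length xs \<Longrightarrow> adj (xs ! (length xs - 2)) (last xs)"
  using cpath_nth_adj[of xs "length xs - 2"]
  by (cases "xs = []") (auto simp: last_conv_nth numeral_2_eq_2 Suc_diff_Suc)

lemma penult_snoc: "xs \<noteq> [] \<Longrightarrow> (xs @ [p]) ! (length (xs @ [p]) - 2) = last xs"
  by (cases xs rule: rev_cases) (auto simp: nth_append)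

lemma ex_in_card_pos: "0 < real (card S) \<Longrightarrow> \<exists>x. x \<in> S"
  by (metis card.empty ex_in_conv less_irrefl of_nat_0)

text \<open>The next vertex can be blocked only by the vertices used so far, by
  \<open>\<tau>\<close> non-neighbours and by \<open>\<Delta>\<close> incompatible edges. The
  initial edge \<open>st\<close> is prescribed so that paths can later be joined along it; as
  \<open>t\<close> need not lie in \<open>Q\<close>, the bound on the non-neighbours of the current
  end is carried through the induction.\<close>

lemma greedy_path:
  fixes \<tau> :: real
  assumes fin: "finite P" "finite Q" and dis: "P \<inter> Q = {}" and st: "adj s t"
    and gP: "\<And>p. p \<in> P \<Longrightarrow> real (card {q \<in> Q. \<not> adj p q}) \<le> \<tau>"
    and gQ: "\<And>q. q \<in> Q \<Longrightarrow> real (card {p \<in> P. \<not> adj q p}) \<le> \<tau>"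
    and gt: "real (card {p \<in> P. \<not> adj t p}) \<le> \<tau>"
    and cP: "real r + \<tau> + \<Delta> < real (card P)" "real r + \<tau> + \<Delta> < real (card Q)"
    and "m \<le> r"
  shows "\<exists>W. distinct W \<and> set W \<subseteq> P \<union> Q \<and> card (set W \<inter> P) = m \<and> card (set W \<inter> Q) = m \<and>
     cpath ([s, t] @ W) \<and> real (card {p \<in> P. \<not> adj (last (t # W)) p}) \<le> \<tau>"
  using \<open>m \<le> r\<close>
proof (induction m)
  case 0
  show ?case by (rule exI[of _ "[]"]) (use st gt in auto)
next
  case (Suc m)
  then obtain W where W: "distinct W" "set W \<subseteq> P \<union> Q" "card (set W \<inter> P) = m" "card (set W \<inter> Q) = m"
     "cpath ([s, t] @ W)" "real (card {p \<in> P. \<not> adj (last (t # W)) p}) \<le> \<tau>" by auto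
  have mr: "real m \<le> real r" using Suc.prems by simp
  let ?D = "[s, t] @ W"
  let ?l' = "?D ! (length ?D - 2)" and ?l = "last (t # W)"
  have ll: "last ?D = ?l" by simp
  have a: "adj ?l' ?l" using cpath_adj_last[OF W(5)] ll by simp
  have "0 < real (card {p \<in> P. p \<notin> set W \<and> adj ?l p \<and> comp ?l' ?l p})"
    using card_available[OF fin(1) W(6) a, of "set W" "real m"] W(3) cP(1) mr by linarith
  then obtain p where p: "p \<in> P" "p \<notin> set W" "adj ?l p" "comp ?l' ?l p" using ex_in_card_pos by blast
  have c1: "cpath (?D @ [p])" using cpath_snoc[of ?D p] W(5) p ll by simp
  have "0 < real (card {q \<in> Q. q \<notin> set W \<and> adj p q \<and> comp ?l p q})"
    using card_available[OF fin(2) gP[OF p(1)] p(3), of "set W" "real m"] W(4) cP(2) mr by linarith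
  then obtain q where q: "q \<in> Q" "q \<notin> set W" "adj p q" "comp ?l p q" using ex_in_card_pos by blast
  have "(?D @ [p]) ! (length (?D @ [p]) - 2) = ?l"
    by (subst penult_snoc) simp_all
  then have c2: "cpath ((?D @ [p]) @ [q])" using cpath_snoc[of "?D @ [p]" q] c1 q by simp
  have neq: "p \<notin> Q" "q \<notin> P" "p \<noteq> q" using p q dis by auto
  have "set (W @ [p, q]) \<inter> P = insert p (set W \<inter> P)" "set (W @ [p, q]) \<inter> Q = insert q (set W \<inter> Q)"
    using p q neq by auto
  then have "card (set (W @ [p, q]) \<inter> P) = Suc m" "card (set (W @ [p, q]) \<inter> Q) = Suc m"
    using W p q fin by auto
  then show ?case
    using W p q neq c2 gQ[OF q(1)] by (intro exI[of _ "W @ [p, q]"]) auto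
qed

text \<open>The last two vertices \<open>p\<close> and \<open>q\<close> have to be chosen together,
  because for a fixed \<open>p\<close> the condition \<open>comp t' q p\<close> could fail for every
  \<open>q\<close>. Over candidate sets of size \<open>k > \<tau> + 2 * \<Delta>\<close> the bad
  pairs number at most \<open>k * (\<tau> + 2 * \<Delta>)\<close>, fewer than k^2.\<close>

lemma long_path:
  fixes \<tau> :: real
  assumes fin: "finite P" "finite Q" and dis: "P \<inter> Q = {}" and st: "adj s t" "adj s' t'"
    and gP: "\<And>p. p \<in> P \<Longrightarrow> real (card {q \<in> Q. \<not> adj p q}) \<le> \<tau>"
    and gQ: "\<And>q. q \<in> Q \<Longrightarrow> real (card {p \<in> P. \<not> adj q p}) \<le> \<tau>"
    and gt: "real (card {p \<in> P. \<not> adj t p}) \<le> \<tau>" "real (card {q \<in> Q. \<not> adj t' q}) \<le> \<tau>"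
    and cP: "real r + 2 * \<tau> + 3 * \<Delta> + 1 \<le> real (card P)" "real r + 2 * \<tau> + 3 * \<Delta> + 1 \<le> real (card Q)"
  shows "\<exists>W. distinct W \<and> set W \<subseteq> P \<union> Q \<and> card (set W \<inter> P) = r + 1 \<and> card (set W \<inter> Q) = r + 1 \<and>
     cpath ([s, t] @ W @ [t', s'])"
proof -
  have \<tau>: "0 \<le> \<tau>" using gt(1) of_nat_0_le_iff order_trans by blast
  have "\<exists>W. distinct W \<and> set W \<subseteq> P \<union> Q \<and> card (set W \<inter> P) = r \<and> card (set W \<inter> Q) = r \<and>
     cpath ([s, t] @ W) \<and> real (card {p \<in> P. \<not> adj (last (t # W)) p}) \<le> \<tau>"
    by (rule greedy_path[OF fin dis st(1) gP gQ gt(1), of r]) (use cP \<tau> \<Delta>_nonneg in auto)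
  then obtain W where W: "distinct W" "set W \<subseteq> P \<union> Q" "card (set W \<inter> P) = r" "card (set W \<inter> Q) = r"
     "cpath ([s, t] @ W)" "real (card {p \<in> P. \<not> adj (last (t # W)) p}) \<le> \<tau>" by blast
  let ?D = "[s, t] @ W"
  let ?l' = "?D ! (length ?D - 2)" and ?l = "last (t # W)"
  have ll: "last ?D = ?l" by simp
  have a: "adj ?l' ?l" using cpath_adj_last[OF W(5)] ll by simp
  let ?G1 = "{p \<in> P. p \<notin> set W \<and> adj ?l p \<and> comp ?l' ?l p}"
  let ?G2 = "{q \<in> Q. q \<notin> set W \<and> adj t' q \<and> comp s' t' q}"
  \<comment> \<open>The size hypothesis is met with \<open>\<tau> + \<Delta>\<close> for vertices
    excluded at one end and \<open>\<tau> + 2 * \<Delta> + 1\<close> for the \<open>k\<close>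
    candidates.\<close>
  define k where "k = nat \<lfloor>\<tau> + 2 * \<Delta>\<rfloor> + 1"
  have k: "\<tau> + 2 * \<Delta> < real k" "real k \<le> \<tau> + 2 * \<Delta> + 1" unfolding k_def using \<tau> \<Delta>_nonneg by linarith+
  have "k \<le> card ?G1"
    using card_available[OF fin(1) W(6) a, of "set W" "real r"] W(3) cP(1) k by linarith
  then obtain G1 where G1: "G1 \<subseteq> ?G1" "card G1 = k" "finite G1" by (rule obtain_subset_with_card_n)
  have "k \<le> card ?G2"
    using card_available[OF fin(2) gt(2) st(2), of "set W" "real r"] W(4) cP(2) k by linarith
  then obtain G2 where G2: "G2 \<subseteq> ?G2" "card G2 = k" "finite G2" by (rule obtain_subset_with_card_n)
  let ?R1 = "\<lambda>p q. \<not> adj p q"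
  let ?R2 = "\<lambda>p q. adj p q \<and> \<not> comp ?l p q"
  let ?R3 = "\<lambda>p q. adj q p \<and> \<not> comp t' q p"
  have 1: "badn ?R1 G1 G2 \<le> real k * \<tau>"
  proof -
    have "real (card {q \<in> G2. \<not> adj p q}) \<le> \<tau>" if "p \<in> G1" for p
    proof -
      have "card {q \<in> G2. \<not> adj p q} \<le> card {q \<in> Q. \<not> adj p q}"
        by (rule card_mono) (use fin G2 in auto)
      then show ?thesis using gP[of p] that G1 by force
    qed
    then show ?thesis using badn_row_le[of G2 G1 ?R1 \<tau>] G1 G2 by auto
  qed
  have 2: "badn ?R2 G1 G2 \<le> real k * \<Delta>"
  proof -
    have "real (card {q \<in> G2. ?R2 p q}) \<le> \<Delta>" if "p \<in> G1" for p
    proof (rule comp_row[of _ _ "\<lambda>q. q"])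
      show "adj ?l p" using that G1(1) by blast
    qed (use G2 in simp_all)
    then show ?thesis using badn_row_le[of G2 G1 ?R2 \<Delta>] G1 G2 by auto
  qed
  have 3: "badn ?R3 G1 G2 \<le> real k * \<Delta>"
  proof -
    have "real (card {p \<in> G1. ?R3 p q}) \<le> \<Delta>" if "q \<in> G2" for q
    proof (rule comp_row[of _ _ "\<lambda>q. q"])
      show "adj t' q" using that G2(1) by blast
    qed (use G1 in simp_all)
    then show ?thesis using badn_col_le[of G1 G2 ?R3 \<Delta>] G1 G2 by auto
  qed
  have "badn (\<lambda>p q. ?R1 p q \<or> (?R2 p q \<or> ?R3 p q)) G1 G2 \<le> real k * (\<tau> + 2 * \<Delta>)"
    using badn_or_le[of ?R1 "\<lambda>p q. ?R2 p q \<or> ?R3 p q" G1 G2] badn_or_le[of ?R2 ?R3 G1 G2] 1 2 3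
    by (simp add: algebra_simps)
  also have "\<dots> < real k * real k" using k \<tau> \<Delta>_nonneg by (intro mult_strict_left_mono) auto
  finally have "\<exists>p\<in>G1. \<exists>q\<in>G2. \<not> (?R1 p q \<or> (?R2 p q \<or> ?R3 p q))"
    by (intro pair_choice) (use G1 G2 in simp_all)
  then obtain p q where pq: "p \<in> G1" "q \<in> G2" "adj p q" "comp ?l p q" "comp t' q p"
    using adj_sym by blast
  have p: "p \<in> P" "p \<notin> set W" "adj ?l p" "comp ?l' ?l p" using pq G1 by auto
  have q: "q \<in> Q" "q \<notin> set W" "adj t' q" "comp s' t' q" using pq G2 by auto
  have c1: "cpath (?D @ [p])" using cpath_snoc[of ?D p] W(5) p ll by simp
  have "(?D @ [p]) ! (length (?D @ [p]) - 2) = ?l"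
    by (subst penult_snoc) simp_all
  then have c2: "cpath ((?D @ [p]) @ [q])" using cpath_snoc[of "?D @ [p]" q] c1 pq by simp
  have c3: "cpath ((?D @ [p, q]) @ [t', s'])"
  proof (rule cpath_join)
    show "comp ((?D @ [p, q]) ! (length (?D @ [p, q]) - 2)) (last (?D @ [p, q])) (hd [t', s'])"
      using penult_snoc[of "?D @ [p]" q] comp_sym[OF pq(5)] by simp
    show "comp (last (?D @ [p, q])) (hd [t', s']) ([t', s'] ! 1)"
      using comp_sym[OF q(4)] by simp
    show "adj (last (?D @ [p, q])) (hd [t', s'])" using adj_sym[OF q(3)] by simp
    show "cpath [t', s']" using adj_sym[OF st(2)] by simp
  qed (use c2 in simp_all)
  have neq: "p \<notin> Q" "q \<notin> P" "p \<noteq> q" using p q dis by auto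
  have "set (W @ [p, q]) \<inter> P = insert p (set W \<inter> P)" "set (W @ [p, q]) \<inter> Q = insert q (set W \<inter> Q)"
    using p q neq by auto
  then have "card (set (W @ [p, q]) \<inter> P) = r + 1" "card (set (W @ [p, q]) \<inter> Q) = r + 1"
    using W p q fin by auto
  then show ?thesis
    using W p q neq c3 by (intro exI[of _ "W @ [p, q]"]) auto
qed

end

section \<open>Hamilton cycles in the two extremal configurations\<close>

context compat_graph
begin

text \<open>\<open>S\<close> lies on the initial cycle and stays on all later ones, so the degree
  condition has to be checked only once.\<close>

lemma insert_singletons:
  assumes ins: "insertable X X Xi Xi" and lt: "5 * badn nonadj X X + 12 * real k * \<Delta> < (real k)\<^sup>2"
    and "\<And>v. v \<in> set vs \<Longrightarrow> 4 * k + 8 \<le> card {w \<in> S. w \<in> Xi \<and> adj v w}"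
    and "ccycle C" "S \<subseteq> set C" "distinct vs" "set vs \<inter> set C = {}"
  shows "\<exists>C'. ccycle C' \<and> set C' = set C \<union> set vs"
  using assms(3-)
proof (induction vs arbitrary: C)
  case (Cons v vs)
  have "card {w \<in> S. w \<in> Xi \<and> adj v w} \<le> card {w \<in> set C. w \<in> Xi \<and> adj v w}"
    by (rule card_mono) (use Cons.prems in auto)
  then have n: "4 * k + 8 \<le> card {w \<in> set C. w \<in> Xi \<and> adj v w}" using Cons.prems(1)[of v] by simp
  have "\<exists>C'. ccycle C' \<and> set C' = set C \<union> set [v]"
    by (rule insert_cycle[OF Cons.prems(2) _ _ _ _ ins _ _ lt]) (use n Cons.prems in auto)
  then obtain C' where C': "ccycle C'" "set C' = insert v (set C)" by auto
  have "\<exists>C''. ccycle C'' \<and> set C'' = set C' \<union> set vs"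
    by (rule Cons.IH) (use C' Cons.prems in auto)
  then show ?case using C' by auto
qed auto

text \<open>Each step absorbs a vertex \<open>v\<close> together with a path \<open>u\<close> whose
  ends have many neighbours in \<open>Xi\<close>. That \<open>u\<close> may be an edge inside the
  larger side is what uses up the surplus of that side.\<close>

lemma insert_pairs:
  assumes ins: "insertable X Y Xi Yi" and lt: "5 * badn nonadj X Y + 12 * real k * \<Delta> < (real k)\<^sup>2"
    and "length xs = length us"
    and "\<And>v. v \<in> set xs \<Longrightarrow> 4 * k + 10 \<le> card {w \<in> S. w \<in> Yi \<and> adj v w}"
    and "\<And>u. u \<in> set us \<Longrightarrow> u \<noteq> [] \<and> cpath u \<and> 4 * k + 10 \<le> card {w \<in> S. w \<in> Xi \<and> adj (hd u) w}
         \<and> 4 * k + 10 \<le> card {w \<in> S. w \<in> Xi \<and> adj (last u) w}"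
    and "ccycle C" "S \<subseteq> set C" "distinct (C @ xs @ concat us)"
  shows "\<exists>C'. ccycle C' \<and> set C' = set C \<union> set xs \<union> set (concat us)"
  using assms(3-)
proof (induction xs us arbitrary: C rule: list_induct2)
  case (Cons v xs u us)
  have mono: "m \<le> card {w \<in> set C. P w}" if "m \<le> card {w \<in> S. P w}" for m P
    by (rule order_trans[OF that card_mono]) (use Cons.prems in auto)
  have u: "u \<noteq> []" "cpath u" "4 * k + 10 \<le> card {w \<in> S. w \<in> Xi \<and> adj (hd u) w}"
    "4 * k + 10 \<le> card {w \<in> S. w \<in> Xi \<and> adj (last u) w}" using Cons.prems(2)[of u] by auto
  have v: "4 * k + 10 \<le> card {w \<in> S. w \<in> Yi \<and> adj v w}" using Cons.prems(1)[of v] by simp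
  have "\<exists>C'. ccycle C' \<and> set C' = set C \<union> set (v # u)"
    by (rule insert_pair[OF Cons.prems(3) u(1,2) _ _ ins mono[OF v] mono[OF u(3)] mono[OF u(4)] lt])
      (use Cons.prems(5) in auto)
  then obtain C' where C': "ccycle C'" "set C' = set C \<union> set (v # u)" by auto
  have "\<exists>C''. ccycle C'' \<and> set C'' = set C' \<union> set xs \<union> set (concat us)"
  proof (rule Cons.IH)
    have "distinct C'" using C' ccycle_def by blast
    then show "distinct (C' @ xs @ concat us)" using Cons.prems(5) C'(2) by auto
  qed (use C' Cons.prems in auto)
  then show ?case using C' by auto
qed auto

text \<open>With an overlap of two vertices, every compatibility condition at the seam already
  occurs in one of the two pieces.\<close>

lemma cpath_glue:
  assumes "cpath (xs @ [a, b])" "cpath ([a, b] @ ys)"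
  shows "cpath (xs @ [a, b] @ ys)"
proof (cases "ys = []")
  case False
  have 1: "adj b (hd ys) \<and> comp a b (hd ys) \<and> (2 \<le> length ys \<longrightarrow> comp b (hd ys) (ys ! 1)) \<and> cpath ys"
    using assms(2) False cpath_append[of "[a, b]" ys] by auto
  have "cpath ((xs @ [a, b]) @ ys)"
    using False assms(1) 1 by (subst cpath_append) (auto simp: nth_append)
  then show ?thesis by simp
qed (use assms in simp)

text \<open>Markov's inequality for the number of missing pairs at a vertex.\<close>

lemma card_not_good:
  fixes \<tau> :: real
  assumes "finite X" "finite Y" "0 < \<tau>"
  shows "real (card {x \<in> X. \<not> real (card {y \<in> Y. R x y}) \<le> \<tau>}) * \<tau> \<le> badn R X Y"
proof -
  let ?B = "{x \<in> X. \<not> real (card {y \<in> Y. R x y}) \<le> \<tau>}"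
  have "real (card ?B) * \<tau> = (\<Sum>x\<in>?B. \<tau>)" by simp
  also have "\<dots> \<le> (\<Sum>x\<in>?B. \<Sum>y\<in>Y. of_bool (R x y))"
    by (rule sum_mono) (simp only: sum_of_bool_card[OF assms(2)] mem_Collect_eq not_le less_imp_le)
  also have "\<dots> \<le> badn R X Y" unfolding badn_def
    by (rule sum_mono2) (use assms in \<open>auto intro: sum_nonneg\<close>)
  finally show ?thesis .
qed

text \<open>The tiny term in \<open>\<Delta>\<close> is paid for by weakening one factor N/32 to
  N/33; what remains is that \<open>5 * 18 / 100000\<close> is less than 1/1056.\<close>

lemma switch_size:
  fixes N :: real
  assumes "700 \<le> N" "real k \<ge> N / 32" "\<Delta> \<le> N / 400000000" "B \<le> 18 / 100000 * N\<^sup>2"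
  shows "5 * B + 12 * real k * \<Delta> < (real k)\<^sup>2"
proof -
  have "N / 33 \<le> real k - 12 * \<Delta>" using assms by simp
  then have "(N / 32) * (N / 33) \<le> real k * (real k - 12 * \<Delta>)"
    using assms by (intro mult_mono) auto
  moreover have "0 < N\<^sup>2" using assms by simp
  moreover have "(N / 32) * (N / 33) = N\<^sup>2 / 1056" by (simp add: power2_eq_square)
  moreover have "real k * (real k - 12 * \<Delta>) = (real k)\<^sup>2 - 12 * real k * \<Delta>"
    by (simp add: power2_eq_square algebra_simps)
  ultimately show ?thesis using assms(4) by linarith
qed

text \<open>If each edge of \<open>ms\<close> counts as one item, \<open>Y\<close> has as many items
  as \<open>X\<close> has vertices. A balanced cycle through vertices with few missing pairs
  therefore leaves equally many items on both sides, and these are absorbed in pairs. The vertices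
  on \<open>ms\<close> are not insertion points, as they can have neighbours inside
  \<open>Y\<close>.\<close>

lemma bipartite_hamilton:
  fixes N :: real
  assumes N: "700 \<le> N" "\<Delta> \<le> N / 400000000" and part: "X \<union> Y = V" "X \<inter> Y = {}"
    and ms: "\<And>u. u \<in> set ms \<Longrightarrow> length u = 2 \<and> cpath u" "distinct (concat ms)" "set (concat ms) \<subseteq> Y"
    and XY: "card Y = card X + length ms" "499 / 1000 * N \<le> card X" "card X \<le> N / 2" "length ms \<le> N / 1000"
    and ins: "insertable X Y X (Y - set (concat ms))"
    and deg: "\<And>x. x \<in> X \<Longrightarrow> 239 / 1000 * N \<le> card {y \<in> Y. adj x y}"
      "\<And>y. y \<in> Y \<Longrightarrow> 239 / 1000 * N \<le> card {x \<in> X. adj y x}"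
    and bad: "badn nonadj X Y \<le> 18 / 100000 * N\<^sup>2"
  shows "\<exists>C. ccycle C \<and> set C = V"
proof -
  define Z where "Z = set (concat ms)"
  define Yi where "Yi = Y - Z"
  have fin: "finite X" "finite Y" using finite_V part finite_subset by blast+
  have ms2: "length (concat ms) = 2 * length ms"
  proof -
    have "map length ms = map (\<lambda>_. 2) ms" using ms(1) by simp
    then show ?thesis unfolding length_concat by (simp only: sum_list_replicate map_replicate_const) simp
  qed
  then have cZ: "card Z = 2 * length ms" unfolding Z_def using distinct_card[OF ms(2)] by simp
  have ZY: "Z \<subseteq> Y" "finite Z" using ms Z_def by auto
  have cYi: "card Yi + length ms = card X"
    using card_Diff_subset[OF ZY(2,1)] XY(1) cZ card_mono[OF fin(2) ZY(1)] unfolding Yi_def by simp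
  \<comment> \<open>The product of 14/1000 and 13/1000 is slightly above 18/100000, so at most
    \<open>13 / 1000 * N\<close> vertices of a side miss more than \<open>\<tau>\<close> vertices of
    the other.\<close>
  define \<tau> where "\<tau> = 14 / 1000 * N"
  have \<tau>: "0 < \<tau>" using N \<tau>_def by simp
  define Xg where "Xg = {x \<in> X. real (card {y \<in> Y. nonadj x y}) \<le> \<tau>}"
  define Yg where "Yg = {y \<in> Y. real (card {x \<in> X. nonadj y x}) \<le> \<tau>} - Z"
  have nb: "b \<le> 13 / 1000 * N" if "b * \<tau> \<le> badn nonadj X Y" for b
  proof -
    have "0 \<le> N\<^sup>2" by simp
    moreover have "(13 / 1000 * N) * \<tau> = 182 / 1000000 * N\<^sup>2" unfolding \<tau>_def by (simp add: power2_eq_square)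
    ultimately have "b * \<tau> \<le> (13 / 1000 * N) * \<tau>" using that bad by linarith
    then show ?thesis using \<tau> by (simp only: mult_le_cancel_right_pos)
  qed
  have "X - Xg = {x \<in> X. \<not> real (card {y \<in> Y. nonadj x y}) \<le> \<tau>}" unfolding Xg_def by blast
  then have "real (card (X - Xg)) \<le> 13 / 1000 * N"
    using nb[OF card_not_good[OF fin \<tau>, of nonadj]] by simp
  then have cXg: "real (card Xg) \<ge> 486 / 1000 * N"
    using card_Diff_subset[of Xg X] card_mono[of X Xg] fin XY(2) unfolding Xg_def by auto
  have "real (card (Yi - Yg)) \<le> real (card {y \<in> Y. \<not> real (card {x \<in> X. nonadj y x}) \<le> \<tau>})"
    unfolding of_nat_le_iff by (rule card_mono) (use fin in \<open>auto simp: Yi_def Yg_def\<close>)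
  also have "\<dots> \<le> 13 / 1000 * N"
    by (rule nb) (use card_not_good[OF fin(2,1) \<tau>, of nonadj] badn_nonadj_sym[of Y X] in simp)
  finally have "real (card (Yi - Yg)) \<le> 13 / 1000 * N" .
  moreover have YgYi: "Yg \<subseteq> Yi" "finite Yi" "finite Yg" using fin unfolding Yg_def Yi_def by auto
  ultimately have cYg: "real (card Yg) \<ge> 485 / 1000 * N"
    using card_Diff_subset[of Yg Yi] card_mono[of Yi Yg] cYi XY(2,4) by auto
  have gX: "real (card {y \<in> Q. \<not> adj x y}) \<le> \<tau>" if "x \<in> Xg" "Q \<subseteq> Y" for x Q
  proof -
    have "card {y \<in> Q. \<not> adj x y} \<le> card {y \<in> Y. nonadj x y}"
      by (rule card_mono) (use fin that part in \<open>auto simp: Xg_def\<close>)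
    then show ?thesis using that unfolding Xg_def by auto
  qed
  have gY: "real (card {x \<in> P. \<not> adj y x}) \<le> \<tau>" if "y \<in> Yg" "P \<subseteq> X" for y P
  proof -
    have "card {x \<in> P. \<not> adj y x} \<le> card {x \<in> X. nonadj y x}"
      by (rule card_mono) (use fin that part in \<open>auto simp: Yg_def\<close>)
    then show ?thesis using that unfolding Yg_def by auto
  qed
  have "0 < real (card Xg)" using cXg N by linarith
  then obtain s where s: "s \<in> Xg" using ex_in_card_pos by blast
  have "\<exists>t\<in>Yg. adj s t"
  proof (rule ccontr)
    assume "\<not> ?thesis"
    then have "{y \<in> Yg. \<not> adj s y} = Yg" by auto
    then show False using gX[OF s, of Yg] cYg N unfolding \<tau>_def Yg_def by auto
  qed
  then obtain t where t: "t \<in> Yg" "adj s t" by blast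
  define P where "P = Xg - {s}"
  define Q where "Q = Yg - {t}"
  have sub: "P \<subseteq> X" "Q \<subseteq> Yi" "Xg \<subseteq> X" "Yg \<subseteq> Y" "Yi \<subseteq> Y"
    unfolding P_def Q_def Xg_def Yg_def Yi_def by auto
  have finPQ: "finite P" "finite Q" using sub fin finite_subset YgYi by blast+
  have disPQ: "P \<inter> Q = {}" using sub part by blast
  have cP: "real (card P) = real (card Xg) - 1" "real (card Q) = real (card Yg) - 1"
  proof -
    have "finite Xg" using fin sub finite_subset by blast
    then show "real (card P) = real (card Xg) - 1" "real (card Q) = real (card Yg) - 1"
      unfolding P_def Q_def using s t(1) YgYi card_gt_0_iff[of Xg] card_gt_0_iff[of Yg]
      by (auto simp: card_Diff_singleton)
  qed
  \<comment> \<open>Small enough to leave room for \<open>2 * \<tau>\<close> in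
    \<open>long_path\<close>, and large enough that at most \<open>5 / 100 * N\<close> vertices of
    \<open>X\<close>, or of \<open>Yi\<close>, remain to be absorbed.\<close>
  define r where "r = nat \<lfloor>45 / 100 * N\<rfloor>"
  have r: "real r \<le> 45 / 100 * N" "45 / 100 * N - 1 \<le> real r" unfolding r_def using N by linarith+
  \<comment> \<open>The same edge \<open>st\<close> is prescribed at both ends, so the path closes
    into a cycle.\<close>
  have "\<exists>W. distinct W \<and> set W \<subseteq> P \<union> Q \<and> card (set W \<inter> P) = r + 1 \<and> card (set W \<inter> Q) = r + 1 \<and>
     cpath ([s, t] @ W @ [s, t])"
  proof (rule long_path[OF finPQ disPQ t(2) adj_sym[OF t(2)]])
    show "real (card {q \<in> Q. \<not> adj p q}) \<le> \<tau>" if "p \<in> P" for p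
      using gX[of p Q] that sub P_def by auto
    show "real (card {p \<in> P. \<not> adj q p}) \<le> \<tau>" if "q \<in> Q" for q
      using gY[of q P] that sub Q_def by auto
    show "real (card {p \<in> P. \<not> adj t p}) \<le> \<tau>" using gY[OF t(1) sub(1)] .
    show "real (card {q \<in> Q. \<not> adj s q}) \<le> \<tau>" using gX[OF s, of Q] sub by blast
    show "real r + 2 * \<tau> + 3 * \<Delta> + 1 \<le> real (card P)" "real r + 2 * \<tau> + 3 * \<Delta> + 1 \<le> real (card Q)"
      using r N cP cXg cYg unfolding \<tau>_def by linarith+
  qed
  then obtain W where W: "distinct W" "set W \<subseteq> P \<union> Q" "card (set W \<inter> P) = r + 1" "card (set W \<inter> Q) = r + 1"
     "cpath ([s, t] @ W @ [s, t])" by blast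
  define C0 where "C0 = [s, t] @ W"
  have st: "s \<in> X" "t \<in> Yi" "s \<notin> P \<union> Q" "t \<notin> P \<union> Q" "s \<noteq> t"
    using s t YgYi sub part unfolding P_def Q_def by auto
  have stW: "s \<notin> set W" "t \<notin> set W" using st W by auto
  have "W \<noteq> []" using W(3) by auto
  then have "1 \<le> length W" by (cases W) auto
  then have C0: "ccycle C0"
    using W(1,5) st stW unfolding ccycle_def C0_def by auto
  have "X \<inter> set C0 = insert s (set W \<inter> P)" "Yi \<inter> set C0 = insert t (set W \<inter> Q)"
    using st W(2) sub part unfolding C0_def set_append list.set by blast+
  then have cC0: "card (X \<inter> set C0) = r + 2" "card (Yi \<inter> set C0) = r + 2"
    using W(3,4) stW by auto
  have C0sub: "set C0 \<subseteq> X \<union> Yi" using st W(2) sub unfolding C0_def by auto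
  have cl: "card (X - set C0) + (r + 2) = card X" "card (Yi - set C0) + (r + 2) = card Yi"
    using card_Diff_subset_Int[of X "set C0"] card_Diff_subset_Int[of Yi "set C0"] cC0
      card_mono[OF fin(1), of "X \<inter> set C0"] card_mono[OF YgYi(2), of "Yi \<inter> set C0"] by auto
  obtain xs where xs: "set xs = X - set C0" "distinct xs" using finite_distinct_list fin(1) by (metis finite_Diff)
  obtain ys where ys: "set ys = Yi - set C0" "distinct ys" using finite_distinct_list YgYi(2) by (metis finite_Diff)
  define us where "us = map (\<lambda>y. [y]) ys @ ms"
  have cus: "concat us = ys @ concat ms" unfolding us_def by simp
  have len: "length xs = length us"
    using distinct_card[OF xs(2)] distinct_card[OF ys(2)] xs(1) ys(1) cl cYi unfolding us_def by simp
  define k where "k = nat \<lceil>N / 32\<rceil>"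
  have k: "N / 32 \<le> real k" "real k \<le> N / 32 + 1" unfolding k_def using N by linarith+
  have lt: "5 * badn nonadj X Y + 12 * real k * \<Delta> < (real k)\<^sup>2"
    by (rule switch_size[OF N(1) k(1) N(2) bad])
  have lX: "real (card (X - set C0)) \<le> 5 / 100 * N" "real (card (Yi - set C0)) \<le> 5 / 100 * N"
    using cl r XY(3) cYi by linarith+
  have dX: "4 * k + 10 \<le> card {w \<in> set C0. w \<in> Yi \<and> adj x w}" if "x \<in> X" for x
  proof -
    let ?S = "{w \<in> set C0. w \<in> Yi \<and> adj x w}"
    have "{y \<in> Y. adj x y} \<subseteq> ?S \<union> Z \<union> (Yi - set C0)" unfolding Yi_def by auto
    then have "card {y \<in> Y. adj x y} \<le> card (?S \<union> Z \<union> (Yi - set C0))"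
      by (rule card_mono[rotated]) (use ZY YgYi in auto)
    then have "card {y \<in> Y. adj x y} \<le> card ?S + card Z + card (Yi - set C0)"
      using card_Un_le[of "?S \<union> Z" "Yi - set C0"] card_Un_le[of ?S Z] by linarith
    then have "real (card {y \<in> Y. adj x y}) \<le> real (card ?S) + real (card Z) + real (card (Yi - set C0))"
      by linarith
    then have "4 * real k + 10 \<le> real (card ?S)"
      using deg(1)[OF that] cZ XY(4) lX(2) k(2) N(1) by linarith
    then show ?thesis by linarith
  qed
  have dY: "4 * k + 10 \<le> card {w \<in> set C0. w \<in> X \<and> adj y w}" if "y \<in> Y" for y
  proof -
    let ?S = "{w \<in> set C0. w \<in> X \<and> adj y w}"
    have "{x \<in> X. adj y x} \<subseteq> ?S \<union> (X - set C0)" by auto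
    then have "card {x \<in> X. adj y x} \<le> card (?S \<union> (X - set C0))"
      by (rule card_mono[rotated]) (use fin in auto)
    then have "real (card {x \<in> X. adj y x}) \<le> real (card ?S) + real (card (X - set C0))"
      using card_Un_le[of ?S "X - set C0"] by linarith
    then have "4 * real k + 10 \<le> real (card ?S)"
      using deg(2)[OF that] lX(1) k(2) N(1) by linarith
    then show ?thesis by linarith
  qed
  have "\<exists>C'. ccycle C' \<and> set C' = set C0 \<union> set xs \<union> set (concat us)"
  proof (rule insert_pairs[OF ins lt len _ _ C0 subset_refl])
    show "4 * k + 10 \<le> card {w \<in> set C0. w \<in> Y - set (concat ms) \<and> adj v w}" if "v \<in> set xs" for v
      using dX[of v] that xs(1) unfolding Yi_def Z_def by auto
    show "u \<noteq> [] \<and> cpath u \<and> 4 * k + 10 \<le> card {w \<in> set C0. w \<in> X \<and> adj (hd u) w}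
         \<and> 4 * k + 10 \<le> card {w \<in> set C0. w \<in> X \<and> adj (last u) w}" if "u \<in> set us" for u
    proof -
      have "u \<noteq> [] \<and> cpath u \<and> set u \<subseteq> Y"
      proof (cases "u \<in> set ms")
        case True
        then have "set u \<subseteq> set (concat ms)" by auto
        then show ?thesis using ms(1)[OF True] ms(3) by (cases u) auto
      next
        case False
        then obtain y where "u = [y]" "y \<in> set ys" using \<open>u \<in> set us\<close> unfolding us_def by auto
        then show ?thesis using ys(1) sub by auto
      qed
      then show ?thesis using dY[of "hd u"] dY[of "last u"] hd_in_set[of u] last_in_set[of u] by blast
    qed
    have "distinct C0" using C0 ccycle_def by blast
    moreover have "set C0 \<inter> Z = {}" using C0sub sub part ZY unfolding Yi_def by blast
    moreover have "set xs \<inter> (set ys \<union> Z) = {}" "set ys \<inter> Z = {}" "set C0 \<inter> (set xs \<union> set ys) = {}"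
      using xs(1) ys(1) part ZY sub unfolding Yi_def by blast+
    ultimately show "distinct (C0 @ xs @ concat us)"
      using xs(2) ys(2) ms(2) unfolding cus Z_def distinct_append set_append by blast
  qed
  moreover have "set C0 \<union> set xs \<union> set (concat us) = V"
    using xs(1) ys(1) C0sub part sub ZY unfolding cus Yi_def Z_def by auto
  ultimately show ?thesis by auto
qed

text \<open>The good vertices of \<open>U\<close> are divided arbitrarily into halves
  \<open>P\<close> and \<open>Q\<close>, which reduces the task to the bipartite
  \<open>long_path\<close>. The ends \<open>x\<close> and \<open>y\<close> may miss many vertices;
  they are therefore linked to good vertices \<open>a\<close> and \<open>b\<close> by edges
  compatible with the outer edges at \<open>x\<close> and \<open>y\<close>.\<close>

lemma clique_path:
  fixes N :: real
  assumes N: "700 \<le> N" "\<Delta> \<le> N / 400000000" and U: "U \<subseteq> V" "49 / 100 * N \<le> card U"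
    and ends: "x \<in> U" "y \<in> U" "x \<noteq> y" "adj x' x" "adj y' y" "x' \<notin> U" "y' \<notin> U"
    and deg: "249 / 1000 * N \<le> card {w \<in> U. adj x w}" "249 / 1000 * N \<le> card {w \<in> U. adj y w}"
    and bad: "badn nonadj U U \<le> 18 / 100000 * N\<^sup>2"
  shows "\<exists>W. distinct W \<and> set W \<subseteq> U - {x, y} \<and> cpath ([x', x] @ W @ [y, y']) \<and>
    card (U - set W) \<le> 8 / 100 * N"
proof -
  have fin: "finite U" using U finite_V finite_subset by blast
  define \<tau> where "\<tau> = 14 / 1000 * N"
  have \<tau>: "0 < \<tau>" using N \<tau>_def by simp
  define G where "G = {x \<in> U. real (card {y \<in> U. nonadj x y}) \<le> \<tau>}"
  have GU: "G \<subseteq> U" "finite G" using fin unfolding G_def by auto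
  have cG: "real (card (U - G)) \<le> 13 / 1000 * N"
  proof -
    have "U - G = {x \<in> U. \<not> real (card {y \<in> U. nonadj x y}) \<le> \<tau>}" unfolding G_def by blast
    then have "real (card (U - G)) * \<tau> \<le> badn nonadj U U"
      using card_not_good[OF fin fin \<tau>, of nonadj] by simp
    moreover have "0 \<le> N\<^sup>2" by simp
    moreover have "(13 / 1000 * N) * \<tau> = 182 / 1000000 * N\<^sup>2" unfolding \<tau>_def by (simp add: power2_eq_square)
    ultimately have "real (card (U - G)) * \<tau> \<le> (13 / 1000 * N) * \<tau>" using bad by linarith
    then show ?thesis using \<tau> by (simp only: mult_le_cancel_right_pos)
  qed
  have good: "real (card {q \<in> S. \<not> adj p q}) \<le> \<tau>" if "p \<in> G" "S \<subseteq> U" "p \<notin> S" for p S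
  proof -
    have "card {q \<in> S. \<not> adj p q} \<le> card {y \<in> U. nonadj p y}"
      by (rule card_mono) (use fin that in auto)
    then show ?thesis using that unfolding G_def by auto
  qed
  have pick: "\<exists>g\<in>G. g \<notin> T \<and> adj v g \<and> comp v' v g"
    if "249 / 1000 * N \<le> card {w \<in> U. adj v w}" "adj v' v" "card T \<le> 3" "finite T" for v v' T
  proof -
    let ?S = "{p \<in> {w \<in> U. adj v w}. p \<notin> T \<union> (U - G) \<and> adj v p \<and> comp v' v p}"
    have "{p \<in> {w \<in> U. adj v w}. \<not> adj v p} = {}" by auto
    then have 0: "real (card {p \<in> {w \<in> U. adj v w}. \<not> adj v p}) \<le> 0" by simp
    have "card ((T \<union> (U - G)) \<inter> {w \<in> U. adj v w}) \<le> card (T \<union> (U - G))"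
      by (rule card_mono) (use fin that in auto)
    then have "real (card ((T \<union> (U - G)) \<inter> {w \<in> U. adj v w})) \<le> 3 + 13 / 1000 * N"
      using card_Un_le[of T "U - G"] that(3) cG by linarith
    from card_available[OF _ 0 that(2) this] have "0 < real (card ?S)"
      using that(1) N fin by fastforce
    then show ?thesis using ex_in_card_pos[of ?S] by blast
  qed
  have c3: "card {x, y} \<le> 3" "card {x, y, z} \<le> 3" for z by (simp_all add: card_insert_if)
  obtain a where a: "a \<in> G" "a \<notin> {x, y}" "adj x a" "comp x' x a"
    using pick[OF deg(1) ends(4) c3(1)] by blast
  obtain b where b: "b \<in> G" "b \<notin> {x, y, a}" "adj y b" "comp y' y b"
    using pick[OF deg(2) ends(5) c3(2)] by blast
  define H where "H = G - {x, y, a, b}"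
  define h where "h = card H div 2"
  have finH: "finite H" using GU H_def by auto
  have cH: "real (card U) - 13 / 1000 * N - 4 \<le> real (card H)"
  proof -
    have "U \<subseteq> H \<union> {x, y, a, b} \<union> (U - G)" unfolding H_def by auto
    then have "card U \<le> card (H \<union> {x, y, a, b} \<union> (U - G))" using fin finH by (intro card_mono) auto
    also have "\<dots> \<le> card H + card {x, y, a, b} + card (U - G)"
      using card_Un_le[of "H \<union> {x, y, a, b}" "U - G"] card_Un_le[of H "{x, y, a, b}"] by linarith
    also have "card {x, y, a, b} \<le> 4" by (simp add: card_insert_if)
    finally show ?thesis using cG by linarith
  qed
  have "h \<le> card H" unfolding h_def by simp
  then obtain P where P: "P \<subseteq> H" "card P = h" "finite P" by (rule obtain_subset_with_card_n)
  have "h \<le> card (H - P)" using P finH unfolding h_def by (simp add: card_Diff_subset)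
  then obtain Q where Q: "Q \<subseteq> H - P" "card Q = h" "finite Q" by (rule obtain_subset_with_card_n)
  have rh: "real (card H) \<le> 2 * real h + 1" unfolding h_def by linarith
  define r where "r = nat \<lfloor>real h - 2 * \<tau> - 3 * \<Delta> - 1\<rfloor>"
  have "0 \<le> real h - 2 * \<tau> - 3 * \<Delta> - 1" using rh cH U(2) N unfolding \<tau>_def by linarith
  then have r: "real r \<le> real h - 2 * \<tau> - 3 * \<Delta> - 1" "real h - 2 * \<tau> - 3 * \<Delta> - 2 \<le> real r"
    unfolding r_def by linarith+
  have sub: "P \<subseteq> U" "Q \<subseteq> U" "P \<subseteq> G" "Q \<subseteq> G" "P \<inter> Q = {}" "a \<notin> P \<union> Q" "b \<notin> P \<union> Q"
    "x \<notin> P \<union> Q" "y \<notin> P \<union> Q"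
    using P Q GU unfolding H_def by auto
  have "\<exists>W. distinct W \<and> set W \<subseteq> P \<union> Q \<and> card (set W \<inter> P) = r + 1 \<and> card (set W \<inter> Q) = r + 1 \<and>
     cpath ([x, a] @ W @ [b, y])"
  proof (rule long_path[OF P(3) Q(3) sub(5) a(3) b(3)])
    show "real (card {q \<in> Q. \<not> adj p q}) \<le> \<tau>" if "p \<in> P" for p
      by (rule good) (use that sub in auto)
    show "real (card {q \<in> P. \<not> adj p q}) \<le> \<tau>" if "p \<in> Q" for p
      by (rule good) (use that sub in auto)
    show "real (card {q \<in> P. \<not> adj a q}) \<le> \<tau>" by (rule good) (use a sub in auto)
    show "real (card {q \<in> Q. \<not> adj b q}) \<le> \<tau>" by (rule good) (use b sub in auto)
    show "real r + 2 * \<tau> + 3 * \<Delta> + 1 \<le> real (card P)" "real r + 2 * \<tau> + 3 * \<Delta> + 1 \<le> real (card Q)"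
      using r P Q by linarith+
  qed
  then obtain W where W: "distinct W" "set W \<subseteq> P \<union> Q" "card (set W \<inter> P) = r + 1" "card (set W \<inter> Q) = r + 1"
     "cpath ([x, a] @ W @ [b, y])" by blast
  have "cpath (x' # ([x, a] @ W @ [b, y]))"
    using W(5) ends a by (subst cpath_Cons) auto
  moreover have "(x' # [x, a] @ W @ [b, y]) ! (length (x' # [x, a] @ W @ [b, y]) - 2) = b"
    using penult_snoc[of "x' # [x, a] @ W @ [b]" y] by simp
  ultimately have "cpath ((x' # ([x, a] @ W @ [b, y])) @ [y'])"
    using adj_sym[OF ends(5)] comp_sym[OF b(4)] by (subst cpath_snoc) auto
  then have 1: "cpath ([x', x] @ (a # W @ [b]) @ [y, y'])" by simp
  have "(set W \<inter> P) \<union> (set W \<inter> Q) = set W" using W(2) by blast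
  moreover have "card ((set W \<inter> P) \<union> (set W \<inter> Q)) = card (set W \<inter> P) + card (set W \<inter> Q)"
    by (rule card_Un_disjoint) (use sub(5) in auto)
  ultimately have "card (set W) = card (set W \<inter> P) + card (set W \<inter> Q)" by simp
  then have cW: "card (set W) = 2 * r + 2" using W by simp
  have WU: "set W \<subseteq> U" using W sub by auto
  have "card (U - set (a # W @ [b])) \<le> card (U - set W)" by (rule card_mono) (use fin in auto)
  also have "\<dots> = card U - (2 * r + 2)" using card_Diff_subset[of "set W" U] WU cW by simp
  finally have "real (card (U - set (a # W @ [b]))) \<le> 8 / 100 * N"
    using r(2) rh cH N unfolding \<tau>_def by linarith
  moreover have "distinct (a # W @ [b])" "set (a # W @ [b]) \<subseteq> U - {x, y}"
    using W a b sub GU by auto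
  ultimately show ?thesis using 1 by blast
qed

text \<open>A long path in each part is glued along the edges \<open>xx'\<close> and
  \<open>yy'\<close>, and the rest of each part is absorbed within that part. The ends of the two
  crossing edges are not insertion points, since they have neighbours in the other part.\<close>

lemma two_clique_hamilton:
  fixes N :: real
  assumes N: "700 \<le> N" "\<Delta> \<le> N / 400000000" and part: "U \<union> U' = V" "U \<inter> U' = {}"
    and card: "49 / 100 * N \<le> card U" "49 / 100 * N \<le> card U'"
    and ends: "x \<in> U" "y \<in> U" "x \<noteq> y" "x' \<in> U'" "y' \<in> U'" "x' \<noteq> y'" "adj x x'" "adj y y'"
    and ins: "insertable U U (U - {x, y}) (U - {x, y})" "insertable U' U' (U' - {x', y'}) (U' - {x', y'})"
    and deg: "\<And>v. v \<in> U \<Longrightarrow> 249 / 1000 * N \<le> card {w \<in> U. adj v w}"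
      "\<And>v. v \<in> U' \<Longrightarrow> 249 / 1000 * N \<le> card {w \<in> U'. adj v w}"
    and bad: "badn nonadj U U \<le> 18 / 100000 * N\<^sup>2" "badn nonadj U' U' \<le> 18 / 100000 * N\<^sup>2"
  shows "\<exists>C. ccycle C \<and> set C = V"
proof -
  have sub: "U \<subseteq> V" "U' \<subseteq> V" using part by auto
  have fin: "finite U" "finite U'" using sub finite_V finite_subset by blast+
  obtain W where W: "distinct W" "set W \<subseteq> U - {x, y}" "cpath ([x', x] @ W @ [y, y'])"
    "card (U - set W) \<le> 8 / 100 * N"
    using clique_path[OF N sub(1) card(1) ends(1-3) adj_sym[OF ends(7)] adj_sym[OF ends(8)] _ _
        deg(1)[OF ends(1)] deg(1)[OF ends(2)] bad(1)] ends part by blast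
  obtain W' where W': "distinct W'" "set W' \<subseteq> U' - {y', x'}" "cpath ([y, y'] @ W' @ [x', x])"
    "card (U' - set W') \<le> 8 / 100 * N"
    using clique_path[OF N sub(2) card(2) ends(5,4) ends(6)[symmetric] ends(8,7) _ _
        deg(2)[OF ends(5)] deg(2)[OF ends(4)] bad(2)] ends part by blast
  define C0 where "C0 = [x', x] @ W @ [y, y'] @ W'"
  have "cpath (([x', x] @ W) @ [y, y'] @ (W' @ [x', x]))"
    by (rule cpath_glue) (use W W' in simp_all)
  then have C0: "ccycle C0"
    using W(1,2) W'(1,2) ends part unfolding C0_def ccycle_def by auto
  define k where "k = nat \<lceil>N / 32\<rceil>"
  have k: "N / 32 \<le> real k" "real k \<le> N / 32 + 1" unfolding k_def using N by linarith+
  have lt: "5 * badn nonadj U U + 12 * real k * \<Delta> < (real k)\<^sup>2" "5 * badn nonadj U' U' + 12 * real k * \<Delta> < (real k)\<^sup>2"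
    by (rule switch_size[OF N(1) k(1) N(2)]; use bad in simp)+
  have cnt: "4 * k + 8 \<le> card {w \<in> set C0. w \<in> T - {p, q} \<and> adj v w}"
    if "finite T" "249 / 1000 * N \<le> card {w \<in> T. adj v w}" "card (T - S) \<le> 8 / 100 * N" "S \<subseteq> set C0" for T p q v S
  proof -
    let ?S = "{w \<in> set C0. w \<in> T - {p, q} \<and> adj v w}"
    have "{w \<in> T. adj v w} \<subseteq> ?S \<union> (T - S) \<union> {p, q}" using that by auto
    then have "card {w \<in> T. adj v w} \<le> card (?S \<union> (T - S) \<union> {p, q})"
      by (rule card_mono[rotated]) (use that in auto)
    also have "\<dots> \<le> card ?S + card (T - S) + card {p, q}"
      using card_Un_le[of "?S \<union> (T - S)" "{p, q}"] card_Un_le[of ?S "T - S"] by linarith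
    also have "card {p, q} \<le> 2" by (simp add: card_insert_if)
    finally have "4 * real k + 8 \<le> real (card ?S)" using that(2,3) k(2) N(1) by linarith
    then show ?thesis by linarith
  qed
  obtain vs where vs: "set vs = U - set C0" "distinct vs" using finite_distinct_list fin(1) by (metis finite_Diff)
  obtain ws where ws: "set ws = U' - set C0" "distinct ws" using finite_distinct_list fin(2) by (metis finite_Diff)
  have "\<exists>C'. ccycle C' \<and> set C' = set C0 \<union> set vs"
  proof (rule insert_singletons[OF ins(1) lt(1) _ C0 subset_refl])
    show "4 * k + 8 \<le> card {w \<in> set C0. w \<in> U - {x, y} \<and> adj v w}" if "v \<in> set vs" for v
      by (rule cnt[OF fin(1) deg(1) W(4)]) (use that vs C0_def in auto)
  qed (use vs in auto)
  then obtain C1 where C1: "ccycle C1" "set C1 = set C0 \<union> set vs" by blast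
  have "\<exists>C'. ccycle C' \<and> set C' = set C1 \<union> set ws"
  proof (rule insert_singletons[OF ins(2) lt(2) _ C1(1), of _ "set C0"])
    show "4 * k + 8 \<le> card {w \<in> set C0. w \<in> U' - {x', y'} \<and> adj v w}" if "v \<in> set ws" for v
      by (rule cnt[OF fin(2) deg(2) W'(4)]) (use that ws C0_def in auto)
  qed (use ws C1 vs part in auto)
  moreover have "set C1 \<union> set ws = V"
    using C1 vs ws part W(2) W'(2) ends unfolding C0_def by auto
  ultimately show ?thesis by auto
qed

end

section \<open>Graphs with an incompatibility system\<close>

locale incompat_graph =
  fixes V :: "'a set" and E :: "'a set set" and F :: "'a \<Rightarrow> 'a set set set" and \<Delta> :: real
  assumes graph: "simple_graph V E" and system: "incompatibility_system V E F"
    and bounded: "bounded_system V E F \<Delta>" and \<Delta>_nonneg: "0 \<le> \<Delta>"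
begin

definition compat :: "'a \<Rightarrow> 'a \<Rightarrow> 'a \<Rightarrow> bool" where
  "compat u v w \<longleftrightarrow> \<not> incompatible F {u, v} {v, w}"

lemma finite_V: "finite V" using graph simple_graph_def by blast

lemma edge_V: "{u, v} \<in> E \<Longrightarrow> u \<in> V \<and> v \<in> V \<and> u \<noteq> v"
proof -
  assume "{u, v} \<in> E"
  then obtain a b where "{u, v} = {a, b}" "a \<in> V" "b \<in> V" "a \<noteq> b"
    using graph unfolding simple_graph_def by blast
  then show ?thesis by (auto simp: doubleton_eq_iff)
qed

lemma incompatibleD:
  assumes "{e, e'} \<in> F z" shows "z \<in> V" "e \<inter> e' = {z}" "e \<noteq> e'" "e \<in> E" "e' \<in> E"
proof -
  have "\<forall>v. v \<notin> V \<longrightarrow> F v = {}" using system unfolding incompatibility_system_def by (rule conjunct2)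
  then show zV: "z \<in> V" using assms by (metis empty_iff)
  have "\<forall>p\<in>F z. \<exists>e e'. p = {e, e'} \<and> e \<in> E \<and> e' \<in> E \<and> e \<noteq> e' \<and> e \<inter> e' = {z}"
    using system zV unfolding incompatibility_system_def by simp
  then obtain f f' where f: "{e, e'} = {f, f'}" "f \<in> E" "f' \<in> E" "f \<noteq> f'" "f \<inter> f' = {z}"
    using assms by meson
  then have "(e = f \<and> e' = f') \<or> (e = f' \<and> e' = f)" by (metis doubleton_eq_iff)
  then show "e \<inter> e' = {z}" "e \<noteq> e'" "e \<in> E" "e' \<in> E" using f by auto
qed

text \<open>Passing to a subgraph can only remove incompatible partners, so every symmetric
  subrelation of the edge relation inherits the bound. This freedom is used to adapt
  \<open>adj\<close> to each configuration.\<close>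

lemma compat_graph:
  assumes sub: "\<And>u v. adj u v \<Longrightarrow> {u, v} \<in> E" and sym: "\<And>u v. adj u v \<Longrightarrow> adj v u"
  shows "compat_graph adj compat V \<Delta>"
proof
  fix u v w
  show "finite V" by (rule finite_V)
  show "0 \<le> \<Delta>" by (rule \<Delta>_nonneg)
  show "adj u v \<Longrightarrow> u \<in> V" using sub edge_V by blast
  show "adj u v \<Longrightarrow> adj v u" by (rule sym)
  show "\<not> adj u u" using sub edge_V by blast
  show "compat u v w \<Longrightarrow> compat w v u"
    unfolding compat_def incompatible_def by (simp add: insert_commute)
  assume uv: "adj u v"
  let ?e = "{u, v}"
  let ?S = "{e'. e' \<in> E \<and> v \<in> e' \<and> e' \<noteq> ?e \<and> {?e, e'} \<in> F v}"
  have fS: "finite ?S"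
    by (rule finite_subset[of _ "Pow V"]) (use graph finite_V in \<open>auto simp: simple_graph_def\<close>)
  have inj: "inj_on (\<lambda>w. {v, w}) {w. adj v w \<and> \<not> compat u v w}"
    by (rule inj_onI) (metis doubleton_eq_iff)
  have img: "(\<lambda>w. {v, w}) ` {w. adj v w \<and> \<not> compat u v w} \<subseteq> ?S"
  proof (rule image_subsetI)
    fix w assume "w \<in> {w. adj v w \<and> \<not> compat u v w}"
    then obtain z where z: "{?e, {v, w}} \<in> F z" unfolding compat_def incompatible_def by blast
    have "v \<in> ?e \<inter> {v, w}" by simp
    then have "z = v" using incompatibleD(2)[OF z] by simp
    then show "{v, w} \<in> ?S" using incompatibleD[OF z] z by auto
  qed
  have "card {w. adj v w \<and> \<not> compat u v w} \<le> card ?S" by (rule card_inj_on_le[OF inj img fS])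
  moreover have "real (card ?S) \<le> \<Delta>"
    using bounded edge_V[OF sub[OF uv]] sub[OF uv] unfolding bounded_system_def by blast
  ultimately show "real (card {w. adj v w \<and> \<not> compat u v w}) \<le> \<Delta>" by linarith
qed

text \<open>Incompatible edges share a vertex, and distinct edges of a cycle that share a vertex are
  consecutive; for those the path condition applies.\<close>

lemma hamilton_if_ccycle:
  assumes sub: "\<And>u v. adj u v \<Longrightarrow> {u, v} \<in> E" and sym: "\<And>u v. adj u v \<Longrightarrow> adj v u"
    and C: "compat_graph.ccycle adj compat C" "set C = V"
  shows "hamilton_cycle V E C \<and> compatible_cycle F C"
proof -
  interpret compat_graph adj compat V \<Delta> using compat_graph[OF sub sym] .
  let ?L = "length C" and ?D = "C @ take 2 C"
  have c: "distinct C" "3 \<le> ?L" "cpath ?D" using C(1) unfolding ccycle_def by auto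
  have D: "?D ! i = C ! (i mod ?L)" if "i < ?L + 2" for i
  proof (cases "i < ?L")
    case False
    then have "i mod ?L = i - ?L" using that c(2) by (simp add: mod_if)
    then show ?thesis using False that c(2) by (simp add: nth_append)
  qed (simp add: nth_append)
  have len: "length ?D = ?L + 2" using c(2) by simp
  have a: "adj (C ! i) (C ! ((i + 1) mod ?L))" if "i < ?L" for i
    using cpath_nth_adj[OF c(3), of i] D[of i] D[of "i + 1"] len that by simp
  have k: "compat (C ! i) (C ! ((i + 1) mod ?L)) (C ! ((i + 2) mod ?L))" if "i < ?L" for i
    using cpath_nth_comp[OF c(3), of i] D[of i] D[of "i + 1"] D[of "i + 2"] len that by simp
  have "cycle_edges C \<subseteq> E" unfolding cycle_edges_def using a sub by blast
  then have 1: "hamilton_cycle V E C" unfolding hamilton_cycle_def using c C(2) by blast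
  have cons: "\<not> incompatible F {C ! i, C ! ((i + 1) mod ?L)} {C ! j, C ! ((j + 1) mod ?L)}"
    if "i < ?L" "j = (i + 1) mod ?L" for i j
  proof -
    have "(j + 1) mod ?L = (i + 2) mod ?L" using that by (simp add: mod_Suc_eq)
    then show ?thesis using k[OF that(1)] that(2) unfolding compat_def by simp
  qed
  have inc_sym: "incompatible F e e' \<longleftrightarrow> incompatible F e' e" for e e'
    unfolding incompatible_def by (simp add: insert_commute)
  have idx: "i = j" if "C ! i = C ! j" "i < ?L" "j < ?L" for i j
    using nth_eq_iff_index_eq[OF c(1)] that by blast
  have "compatible_cycle F C"
    unfolding compatible_cycle_def
  proof (intro ballI impI notI)
    fix e e' assume e: "e \<in> cycle_edges C" "e' \<in> cycle_edges C" "e \<noteq> e'" "incompatible F e e'"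
    obtain i j where i: "i < ?L" "e = {C ! i, C ! ((i + 1) mod ?L)}"
      and j: "j < ?L" "e' = {C ! j, C ! ((j + 1) mod ?L)}"
      using e unfolding cycle_edges_def by blast
    obtain z where "{e, e'} \<in> F z" using e(4) unfolding incompatible_def by blast
    then have "z \<in> e" "z \<in> e'" using incompatibleD(2)[of e e' z] by auto
    moreover have m: "(i + 1) mod ?L < ?L" "(j + 1) mod ?L < ?L"
      by (rule mod_less_divisor; use c(2) in linarith)+
    moreover have "i = j" if "(i + 1) mod ?L = (j + 1) mod ?L"
      using that i j by (simp add: mod_Suc split: if_splits)
    ultimately have "i = j \<or> i = (j + 1) mod ?L \<or> j = (i + 1) mod ?L"
      using i j idx by blast
    then show False
      using e i j cons[of i j] cons[of j i] inc_sym by blast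
  qed
  then show ?thesis using 1 by blast
qed

end

locale dirac_graph = incompat_graph +
  fixes n :: nat
  assumes card_V: "card V = n" and n_pos: "0 < n"
    and min_degree: "\<And>v. v \<in> V \<Longrightarrow> real n / 2 \<le> real (degree E v)"
begin

section \<open>Degrees into a set and missing pairs\<close>

definition dg :: "'a set \<Rightarrow> 'a \<Rightarrow> real" where
  "dg S v = real (card {u \<in> S. {u, v} \<in> E})"

text \<open>Diagonal pairs count as missing here, which gives the exact formula
  \<open>NB_eq\<close>. The count of \<open>nonadj\<close> pairs, which omits the diagonal, is
  bounded by this one.\<close>

definition NB :: "'a set \<Rightarrow> 'a set \<Rightarrow> real" where
  "NB S T = badn (\<lambda>x y. {x, y} \<notin> E) S T"

lemma finite_sub: "S \<subseteq> V \<Longrightarrow> finite S"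
  using finite_V finite_subset by blast

lemma dg_nonneg: "0 \<le> dg S v" by (simp add: dg_def)

lemma dg_Un: "finite S \<Longrightarrow> finite T \<Longrightarrow> S \<inter> T = {} \<Longrightarrow> dg (S \<union> T) v = dg S v + dg T v"
proof -
  assume h: "finite S" "finite T" "S \<inter> T = {}"
  have "{u \<in> S \<union> T. {u, v} \<in> E} = {u \<in> S. {u, v} \<in> E} \<union> {u \<in> T. {u, v} \<in> E}" by auto
  then show ?thesis unfolding dg_def using h by (simp add: card_Un_disjoint disjoint_iff)
qed

lemma dg_le_card: "finite S \<Longrightarrow> dg S v \<le> real (card S)"
  unfolding dg_def by (auto intro: card_mono)

lemma dg_mono: "finite T \<Longrightarrow> S \<subseteq> T \<Longrightarrow> dg S v \<le> dg T v"
  unfolding dg_def by (auto intro!: card_mono)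

lemma dg_diff: "finite S \<Longrightarrow> finite T \<Longrightarrow> dg S v - real (card (S - T)) \<le> dg T v"
proof -
  assume h: "finite S" "finite T"
  have "dg S v = dg (S \<inter> T) v + dg (S - T) v"
    by (subst dg_Un[symmetric]) (use h in \<open>auto simp: Int_Diff_Un\<close>)
  then show ?thesis using dg_mono[of T "S \<inter> T" v] dg_le_card[of "S - T" v] h by auto
qed

lemma dg_V: "v \<in> V \<Longrightarrow> real n / 2 \<le> dg V v"
proof -
  assume "v \<in> V"
  have "{u. {u, v} \<in> E} = {u \<in> V. {u, v} \<in> E}" using edge_V by auto
  then show ?thesis using min_degree[OF \<open>v \<in> V\<close>] unfolding dg_def degree_def by simp
qed

lemma dg_compl: "S \<subseteq> V \<Longrightarrow> v \<in> V \<Longrightarrow> real n / 2 - dg S v \<le> dg (V - S) v"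
  using dg_Un[of S "V - S" v] dg_V[of v] finite_sub[of S] finite_V by (simp add: Un_absorb1)

lemma card_nonadj: "finite T \<Longrightarrow> (\<Sum>y\<in>T. of_bool ({x, y} \<notin> E)) = real (card T) - dg T x"
proof -
  assume T: "finite T"
  have "card T = card {y \<in> T. {x, y} \<notin> E} + card {y \<in> T. {y, x} \<in> E}"
    by (subst card_Un_disjoint[symmetric]) (use T in \<open>auto intro!: arg_cong[of _ _ card] simp: insert_commute\<close>)
  then show ?thesis unfolding dg_def sum_of_bool_card[OF T] by simp
qed

lemma NB_eq: "finite T \<Longrightarrow> NB S T = (\<Sum>x\<in>S. real (card T) - dg T x)"
  unfolding NB_def badn_def by (simp only: card_nonadj)

lemma NB_sym: "NB S T = NB T S"
  unfolding NB_def by (subst badn_swap) (simp add: insert_commute)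

lemma NB_mono: "finite S' \<Longrightarrow> finite T' \<Longrightarrow> S \<subseteq> S' \<Longrightarrow> T \<subseteq> T' \<Longrightarrow> NB S T \<le> NB S' T'"
  unfolding NB_def by (rule badn_mono) auto

lemma NB_le_card: "finite T \<Longrightarrow> NB S T \<le> real (card S) * real (card T)"
  unfolding NB_def by (rule badn_row_le) (auto intro!: card_mono)

lemma NB_Un_left: "finite S \<Longrightarrow> finite S' \<Longrightarrow> NB (S \<union> S') T \<le> NB S T + NB S' T"
proof -
  assume h: "finite S" "finite S'"
  have "NB (S \<union> S') T = NB S T + NB (S' - S) T"
    unfolding NB_def badn_def by (subst sum.union_disjoint[symmetric]) (use h in auto)
  also have "NB (S' - S) T \<le> NB S' T"
    unfolding NB_def badn_def by (rule sum_mono2) (use h in \<open>auto intro: sum_nonneg\<close>)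
  finally show ?thesis by simp
qed

lemma sum_dg: "finite S \<Longrightarrow> finite T \<Longrightarrow> (\<Sum>x\<in>S. dg T x) = real (e_between E S T)"
proof -
  assume h: "finite S" "finite T"
  have "(\<Sum>x\<in>S. dg T x) = badn (\<lambda>x y. {x, y} \<in> E) S T"
    unfolding badn_def dg_def
    by (rule sum.cong) (use h in \<open>auto simp only: sum_of_bool_card insert_commute\<close>)
  then show ?thesis unfolding badn_card[OF h] e_between_def .
qed

lemma sum_dg_sym: "finite S \<Longrightarrow> finite T \<Longrightarrow> (\<Sum>x\<in>S. dg T x) = (\<Sum>y\<in>T. dg S y)"
proof -
  assume h: "finite S" "finite T"
  have "e_between E S T = e_between E T S" unfolding e_between_def
    by (rule bij_betw_same_card[of prod.swap])
      (auto simp: bij_betw_def inj_on_def insert_commute image_iff)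
  then show ?thesis using sum_dg[OF h] sum_dg[OF h(2,1)] by simp
qed

lemma card_mult_le_sum:
  fixes c :: real
  assumes "finite S" "T \<subseteq> S" "\<And>x. x \<in> T \<Longrightarrow> c \<le> f x" "\<And>x. x \<in> S \<Longrightarrow> 0 \<le> f x"
  shows "real (card T) * c \<le> (\<Sum>x\<in>S. f x)"
proof -
  have "real (card T) * c = (\<Sum>x\<in>T. c)" by simp
  also have "\<dots> \<le> (\<Sum>x\<in>T. f x)" by (rule sum_mono) (use assms in auto)
  also have "\<dots> \<le> (\<Sum>x\<in>S. f x)" by (rule sum_mono2) (use assms in auto)
  finally show ?thesis .
qed

end

subsection \<open>Balancing a nearly complete bipartite graph\<close>

text \<open>The hypotheses of the theorem give \<open>\<mu> \<le> 1 / 400000000\<close>, and \<open>e(A,B) = 0\<close> below 700 vertices.\<close>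

locale large_dirac_graph = dirac_graph +
  assumes n_ge: "700 \<le> n" and \<Delta>_le: "\<Delta> \<le> real n / 400000000"
begin

text \<open>Edges are written as two-element lists so that they can be absorbed directly as
  paths.\<close>

definition is_matching :: "'a set \<Rightarrow> 'a list list \<Rightarrow> bool" where
  "is_matching Y ms \<longleftrightarrow> distinct (concat ms) \<and> set (concat ms) \<subseteq> Y \<and>
     (\<forall>u\<in>set ms. \<exists>a b. u = [a, b] \<and> {a, b} \<in> E)"

lemma matching_length: "is_matching Y ms \<Longrightarrow> card (set (concat ms)) = 2 * length ms"
proof -
  assume h: "is_matching Y ms"
  have "map length ms = map (\<lambda>_. 2) ms" using h unfolding is_matching_def by force
  then have "length (concat ms) = 2 * length ms"
    unfolding length_concat by (simp only: sum_list_replicate map_replicate_const) simp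
  then show ?thesis using h distinct_card unfolding is_matching_def by metis
qed

lemma matching_take: "is_matching Y ms \<Longrightarrow> is_matching Y (take k ms)"
proof -
  assume h: "is_matching Y ms"
  have "concat ms = concat (take k ms) @ concat (drop k ms)"
    by (metis append_take_drop_id concat_append)
  then show ?thesis using h in_set_takeD[of _ k ms] unfolding is_matching_def by auto
qed

text \<open>A maximum matching with \<open>s < m\<close> edges leaves an independent set
  \<open>U\<close>, each vertex of which has at least m/2 neighbours among the matched vertices.
  Without an augmenting path, every matching edge receives at most \<open>24 / 100 * n\<close> edges
  from \<open>U\<close>. Double counting bounds \<open>U\<close> by \<open>48 / 100 * n\<close>,
  whereas \<open>U\<close> has nearly n/2 vertices.\<close>

lemma exists_matching:
  assumes XY: "X \<union> Y = V" "X \<inter> Y = {}" and m: "card Y = card X + m" "real m \<le> real n / 4000"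
    and small: "m \<le> 1 \<or> (\<forall>y\<in>Y. dg Y y \<le> 24 / 100 * real n)"
  shows "\<exists>ms. is_matching Y ms \<and> length ms = m"
proof -
  have fin: "finite X" "finite Y" using XY finite_sub by blast+
  have cn: "real n = 2 * real (card X) + real m"
    using card_Un_disjoint[OF fin XY(2)] XY(1) card_V m(1) by simp
  \<comment> \<open>\<open>X\<close> has exactly (n - m)/2 vertices, so at least m/2 neighbours of
    \<open>y\<close> lie in \<open>Y\<close>.\<close>
  have inY: "real m / 2 \<le> dg Y y" if "y \<in> Y" for y
  proof -
    have h: "V - X = Y" "X \<subseteq> V" "y \<in> V" using XY that by auto
    show ?thesis using dg_compl[OF h(2,3)] dg_le_card[OF fin(1), of y] cn unfolding h(1) by linarith
  qed
  have ex: "\<exists>ms. is_matching Y ms \<and> m \<le> length ms"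
  proof (cases "m \<le> 1")
    case True
    show ?thesis
    proof (cases "m = 0")
      case False
      then have m1: "m = 1" using True by simp
      then have "card Y \<noteq> 0" using m by simp
      then obtain y where y: "y \<in> Y" by (metis card.empty ex_in_conv)
      have "0 < dg Y y" using inY[OF y] m1 by simp
      then obtain z where z: "z \<in> Y" "{z, y} \<in> E"
        unfolding dg_def by (metis (mono_tags, lifting) card.empty empty_Collect_eq less_irrefl of_nat_0)
      then have "is_matching Y [[z, y]]" using y edge_V unfolding is_matching_def by auto
      then show ?thesis using m1 by force
    qed (auto simp: is_matching_def intro: exI[of _ "[]"])
  next
    case False
    then have sm: "dg Y y \<le> 24 / 100 * real n" if "y \<in> Y" for y using small that by blast
    have bd: "length ms \<le> card Y" if "is_matching Y ms" for ms
    proof -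
      have "2 * length ms \<le> card Y"
        using matching_length[OF that] that card_mono[OF fin(2), of "set (concat ms)"]
        unfolding is_matching_def by simp
      then show ?thesis by simp
    qed
    define s where "s = (GREATEST k. \<exists>ms. is_matching Y ms \<and> length ms = k)"
    have P0: "\<exists>ms. is_matching Y ms \<and> length ms = 0" by (auto simp: is_matching_def)
    have "\<exists>ms. is_matching Y ms \<and> length ms = s" unfolding s_def
      by (rule GreatestI_nat[where P = "\<lambda>k. \<exists>ms. is_matching Y ms \<and> length ms = k" and b = "card Y", OF P0])
        (use bd in auto)
    then obtain ms where ms: "is_matching Y ms" "length ms = s" by blast
    have max: "length ms' \<le> s" if "is_matching Y ms'" for ms' unfolding s_def
      by (rule Greatest_le_nat[where P = "\<lambda>k. \<exists>ms. is_matching Y ms \<and> length ms = k" and b = "card Y"])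
        (use bd that in auto)
    have "m \<le> s"
    proof (rule ccontr)
      assume "\<not> m \<le> s"
      then have sm1: "s < m" by simp
      define Z where "Z = set (concat ms)"
      define U where "U = Y - Z"
      have Z: "Z \<subseteq> Y" "finite Z" "card Z = 2 * s"
        using ms matching_length[OF ms(1)] unfolding Z_def is_matching_def by auto
      have finU: "finite U" using fin U_def by auto
      have cU: "real (card U) = real (card Y) - 2 * real s"
        using card_Diff_subset[OF Z(2,1)] card_mono[OF fin(2) Z(1)] Z(3) unfolding U_def by simp
      have indep: "{a, b} \<notin> E" if "a \<in> U" "b \<in> U" for a b
      proof
        assume ab: "{a, b} \<in> E"
        have "is_matching Y ([a, b] # ms)"
          using ab that edge_V[OF ab] ms(1) unfolding is_matching_def U_def Z_def by auto
        then show False using max ms(2) by fastforce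
      qed
      have dU: "dg U y = 0" if "y \<in> U" for y
      proof -
        have "{u \<in> U. {u, y} \<in> E} = {}" using indep that by blast
        then show ?thesis unfolding dg_def by (simp only: card.empty of_nat_0)
      qed
      have "real m / 2 \<le> dg Z y" if "y \<in> U" for y
      proof -
        have "dg Y y = dg Z y + dg U y"
          using dg_Un[of Z U y] Z finU unfolding U_def by (simp add: Un_absorb1)
        then show ?thesis using dU[OF that] inY[of y] that U_def by auto
      qed
      then have "real (card U) * (real m / 2) \<le> (\<Sum>y\<in>U. dg Z y)"
        by (intro card_mult_le_sum finU) (auto simp: dg_nonneg)
      also have "\<dots> = (\<Sum>z\<in>Z. dg U z)" by (rule sum_dg_sym[OF finU Z(2)])
      also have "\<dots> = sum_list (map (dg U) (concat ms))"
        using ms(1) unfolding Z_def is_matching_def by (simp add: sum_list_distinct_conv_sum_set)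
      also have "\<dots> = sum_list (map (\<lambda>u. sum_list (map (dg U) u)) ms)"
        by (induction ms) auto
      also have "\<dots> \<le> sum_list (map (\<lambda>u. 24 / 100 * real n) ms)"
      proof (rule sum_list_mono)
        fix u assume u: "u \<in> set ms"
        then obtain a b where ab: "u = [a, b]" "{a, b} \<in> E" using ms(1) unfolding is_matching_def by blast
        have "set u \<subseteq> Z" using u unfolding Z_def by auto
        then have abY: "a \<in> Y" "b \<in> Y" using ab(1) Z(1) by auto
        \<comment> \<open>Two different neighbours \<open>z\<close> of \<open>a\<close> and
          \<open>z'\<close> of \<open>b\<close> in \<open>U\<close> would allow \<open>ab\<close> to
          be replaced by \<open>az\<close> and \<open>bz'\<close>. Hence either one of
          \<open>a\<close>, \<open>b\<close> has no neighbour in \<open>U\<close>, or each has at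
          most one.\<close>
        have no: "z = z'" if "z \<in> U" "z' \<in> U" "{z, a} \<in> E" "{z', b} \<in> E" for z z'
        proof (rule ccontr)
          assume zz: "z \<noteq> z'"
          obtain l1 l2 where l: "ms = l1 @ [a, b] # l2" using u ab(1) by (meson split_list)
          have "is_matching Y (l1 @ [a, z] # [b, z'] # l2)"
            using ms(1) that zz abY unfolding is_matching_def l U_def Z_def by (auto simp: insert_commute)
          then show False using max ms(2) l by fastforce
        qed
        have le: "dg U a \<le> 24 / 100 * real n" "dg U b \<le> 24 / 100 * real n"
          using sm[OF abY(1)] sm[OF abY(2)] dg_mono[OF fin(2), of U a] dg_mono[OF fin(2), of U b]
          unfolding U_def by (meson Diff_subset order_trans)+
        have "dg U a + dg U b \<le> 24 / 100 * real n"
        proof (cases "dg U a = 0 \<or> dg U b = 0")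
          case False
          then have "{z \<in> U. {z, a} \<in> E} \<noteq> {}" "{z \<in> U. {z, b} \<in> E} \<noteq> {}" unfolding dg_def by fastforce+
          then obtain z z' where z: "z \<in> U" "{z, a} \<in> E" "z' \<in> U" "{z', b} \<in> E" by blast
          have "{w \<in> U. {w, a} \<in> E} \<subseteq> {z'}" "{w \<in> U. {w, b} \<in> E} \<subseteq> {z}" using no z by blast+
          then have "card {w \<in> U. {w, a} \<in> E} \<le> card {z'}" "card {w \<in> U. {w, b} \<in> E} \<le> card {z}"
            by (meson card_mono finite.emptyI finite.insertI)+
          then have "dg U a \<le> 1" "dg U b \<le> 1" unfolding dg_def by auto
          then show ?thesis using n_ge by linarith
        qed (use le in auto)
        then show "sum_list (map (dg U) u) \<le> 24 / 100 * real n" using ab by simp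
      qed
      also have "\<dots> = real s * (24 / 100 * real n)" using ms(2) by (simp add: sum_list_triv)
      also have "\<dots> \<le> real m * (24 / 100 * real n)" using sm1 by (intro mult_right_mono) auto
      finally have le: "real m * (real (card U) / 2) \<le> real m * (24 / 100 * real n)" by (simp add: mult_ac)
      have "0 < real m" using sm1 by simp
      then have "real (card U) / 2 \<le> 24 / 100 * real n" using le by (simp only: mult_le_cancel_left_pos)
      then show False using cU sm1 m cn n_ge by linarith
    qed
    then show ?thesis using ms by blast
  qed
  then obtain ms where "is_matching Y ms" "m \<le> length ms" by blast
  then show ?thesis using matching_take[of Y ms m] by (intro exI[of _ "take m ms"]) simp
qed

text \<open>A vertex of \<open>Y\<close> with many neighbours in \<open>Y\<close> is just as good in
  \<open>X\<close>, and moving it lowers the surplus by two. Such vertices are moved until the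
  surplus is at most one or none of them is left, the two alternatives in which a matching of the
  right size exists. Edges inside a side are deleted unless they belong to the matching.\<close>

lemma bipartite_case:
  assumes XY: "X \<union> Y = V" "X \<inter> Y = {}" and le: "card X \<le> card Y"
    and diff: "real (card Y) - real (card X) \<le> real n / 4000"
    and degX: "\<And>x. x \<in> X \<Longrightarrow> 2499 / 10000 * real n \<le> dg Y x"
    and degY: "\<And>y. y \<in> Y \<Longrightarrow> 2499 / 10000 * real n \<le> dg X y"
    and nb: "NB X Y \<le> 115 / 1000000 * (real n)\<^sup>2"
  shows "\<exists>vs. hamilton_cycle V E vs \<and> compatible_cycle F vs"
proof -
  have fin: "finite X" "finite Y" using XY finite_sub by blast+
  define m where "m = card Y - card X"
  have m: "card Y = card X + m" "real m \<le> real n / 4000" using le diff unfolding m_def by auto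
  have cn: "real n = 2 * real (card X) + real m"
    using card_Un_disjoint[OF fin XY(2)] XY(1) card_V m(1) by simp
  define S0 where "S0 = {y \<in> Y. 24 / 100 * real n \<le> dg Y y}"
  obtain S where S: "S \<subseteq> S0" "card S \<le> m div 2"
    "m - 2 * card S \<le> 1 \<or> (\<forall>y\<in>Y - S. dg Y y \<le> 24 / 100 * real n)"
  proof (cases "m div 2 \<le> card S0")
    case True
    then obtain S where S: "S \<subseteq> S0" "card S = m div 2" "finite S" by (rule obtain_subset_with_card_n)
    have "m - 2 * (m div 2) \<le> 1" by presburger
    then show ?thesis by (intro that[of S] disjI1) (simp_all add: S)
  next
    case False
    then show ?thesis using that[of S0] unfolding S0_def by force
  qed
  have "S0 \<subseteq> Y" unfolding S0_def by auto
  then have SY: "S \<subseteq> Y" "finite S" using S(1) finite_subset[OF _ fin(2), of S] by auto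
  define X' where "X' = X \<union> S"
  define Y' where "Y' = Y - S"
  define m' where "m' = m - 2 * card S"
  have S2: "2 * card S \<le> m" using S(2) by linarith
  have XY': "X' \<union> Y' = V" "X' \<inter> Y' = {}" using XY SY unfolding X'_def Y'_def by auto
  have fin': "finite X'" "finite Y'" using XY' finite_sub by blast+
  have cX': "card X' = card X + card S"
    unfolding X'_def using card_Un_disjoint[OF fin(1) SY(2)] XY(2) SY(1) by blast
  have cY': "card Y' + card S = card Y"
    unfolding Y'_def using card_Diff_subset[OF SY(2,1)] card_mono[OF fin(2) SY(1)] by simp
  have m': "card Y' = card X' + m'" "real m' \<le> real n / 4000" using cX' cY' m S2 unfolding m'_def by linarith+
  have cS: "real (card S) \<le> real n / 8000" using S2 m(2) by linarith
  have sub': "Y' \<subseteq> Y" "X \<subseteq> X'" unfolding X'_def Y'_def by auto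
  have "\<exists>ms. is_matching Y' ms \<and> length ms = m'"
  proof (rule exists_matching[OF XY' m'])
    show "m' \<le> 1 \<or> (\<forall>y\<in>Y'. dg Y' y \<le> 24 / 100 * real n)"
      using S(3) dg_mono[OF fin(2) sub'(1)] unfolding m'_def Y'_def by (meson order_trans)
  qed
  then obtain ms where ms: "is_matching Y' ms" "length ms = m'" by blast
  define adj where "adj u v \<longleftrightarrow> {u, v} \<in> E \<and> ((u \<in> X' \<and> v \<in> Y') \<or> (u \<in> Y' \<and> v \<in> X') \<or>
     [u, v] \<in> set ms \<or> [v, u] \<in> set ms)" for u v
  have adjE: "{u, v} \<in> E" if "adj u v" for u v using that adj_def by blast
  have adjs: "adj v u" if "adj u v" for u v using that unfolding adj_def by (auto simp: insert_commute)
  interpret H: compat_graph adj compat V \<Delta> by (rule compat_graph[OF adjE adjs])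
  have msY: "a \<in> set (concat ms) \<and> b \<in> set (concat ms)" if "[a, b] \<in> set ms" for a b
    using that by force
  have msY': "set (concat ms) \<subseteq> Y'" using ms(1) unfolding is_matching_def by blast
  have adjX: "adj x y \<longleftrightarrow> {x, y} \<in> E" if "x \<in> X'" "y \<in> Y'" for x y
    using that by (simp add: adj_def)
  have "\<exists>C. H.ccycle C \<and> set C = V"
  proof (rule H.bipartite_hamilton[of "real n" X' Y' ms])
    show "length u = 2 \<and> H.cpath u" if u: "u \<in> set ms" for u
    proof -
      obtain a b where ab: "u = [a, b]" "{a, b} \<in> E" using u ms(1) unfolding is_matching_def by blast
      then have "adj a b" using u unfolding adj_def by blast
      then show ?thesis using ab(1) by simp
    qed
    show "distinct (concat ms)" "set (concat ms) \<subseteq> Y'" using ms(1) unfolding is_matching_def by auto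
    show "card Y' = card X' + length ms" using m' ms by simp
    show "499 / 1000 * real n \<le> real (card X')" "real (card X') \<le> real n / 2" "real (length ms) \<le> real n / 1000"
      using cX' cn m S2 m'(2) ms(2) n_ge unfolding m'_def by linarith+
    show "H.insertable X' Y' X' (Y' - set (concat ms))"
      unfolding H.insertable_def using XY' msY msY' unfolding adj_def by blast
    show "239 / 1000 * real n \<le> real (card {y \<in> Y'. adj x y})" if x: "x \<in> X'" for x
    proof -
      have "{y \<in> Y'. adj x y} = {y \<in> Y'. {y, x} \<in> E}" using adjX[OF x] by (auto simp: insert_commute)
      then have e: "real (card {y \<in> Y'. adj x y}) = dg Y' x" unfolding dg_def by simp
      have "Y - Y' = S" using SY unfolding Y'_def by auto
      then have "dg Y x - real (card S) \<le> dg Y' x" using dg_diff[OF fin(2) fin'(2), of x] by simp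
      moreover have "24 / 100 * real n \<le> dg Y x"
        using degX[of x] x S(1) unfolding X'_def S0_def by fastforce
      ultimately show ?thesis using e cS by linarith
    qed
    show "239 / 1000 * real n \<le> real (card {x \<in> X'. adj y x})" if y: "y \<in> Y'" for y
    proof -
      have "{x \<in> X'. adj y x} = {x \<in> X'. {x, y} \<in> E}" using adjX[OF _ y] adjs by blast
      then have "real (card {x \<in> X'. adj y x}) = dg X' y" unfolding dg_def by simp
      moreover have "dg X y \<le> dg X' y" by (rule dg_mono[OF fin'(1) sub'(2)])
      ultimately show ?thesis using degY[of y] y sub' by fastforce
    qed
    \<comment> \<open>At most n/8000 vertices have moved; the missing pairs they bring, added to
      \<open>115 / 1000000 * n^2\<close>, still stay below \<open>18 / 100000 * n^2\<close>.\<close>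
    have "badn H.nonadj X' Y' \<le> NB X' Y'"
      unfolding NB_def by (rule badn_mono[OF fin']) (use adjX in auto)
    also have "\<dots> \<le> NB X Y' + NB S Y'" unfolding X'_def by (rule NB_Un_left[OF fin(1) SY(2)])
    also have "NB X Y' \<le> NB X Y" by (rule NB_mono) (use fin sub' in auto)
    also have "NB S Y' \<le> real (card S) * real (card Y')" by (rule NB_le_card[OF fin'(2)])
    also have "real (card S) * real (card Y') \<le> (real n / 8000) * (501 / 1000 * real n)"
      using cS cY' cn m n_ge by (intro mult_mono) linarith+
    also have "\<dots> = 501 / 8000000 * (real n)\<^sup>2" by (simp add: power2_eq_square)
    finally have "badn H.nonadj X' Y' \<le> NB X Y + 501 / 8000000 * (real n)\<^sup>2" by simp
    then show "badn H.nonadj X' Y' \<le> 18 / 100000 * (real n)\<^sup>2"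
      using nb zero_le_power2[of "real n"] by linarith
  qed (use n_ge \<Delta>_le XY' in auto)
  then show ?thesis using hamilton_if_ccycle[of adj, OF adjE adjs] by blast
qed

end

subsection \<open>Two nearly complete graphs\<close>

context large_dirac_graph
begin

text \<open>Every vertex of the smaller part has a neighbour in the other part, and at least two if
  the sizes differ, so distinct ends can be chosen. If the sizes agree, vertices of both parts have
  neighbours across, and a second vertex of \<open>U'\<close> resolves the case in which two chosen
  edges meet.\<close>

lemma disjoint_cross_edges_aux:
  assumes UU: "U \<union> U' = V" "U \<inter> U' = {}" and le: "card U \<le> card U'" and two: "2 \<le> card U"
  shows "\<exists>x\<in>U. \<exists>y\<in>U. \<exists>x'\<in>U'. \<exists>y'\<in>U'. x \<noteq> y \<and> x' \<noteq> y' \<and> {x, x'} \<in> E \<and> {y, y'} \<in> E"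
proof -
  have fin: "finite U" "finite U'" using UU finite_sub by blast+
  have cn: "n = card U + card U'" using card_Un_disjoint[OF fin UU(2)] UU(1) card_V by simp
  have out: "real n / 2 - real (card T) + 1 \<le> dg T' v"
    if "T \<union> T' = V" "T \<inter> T' = {}" "v \<in> T" for T T' v
  proof -
    have h: "V - T = T'" "T \<subseteq> V" "v \<in> V" "finite T" using that finite_sub by auto
    have "{u \<in> T. {u, v} \<in> E} \<subseteq> T - {v}" using edge_V by auto
    then have "card {u \<in> T. {u, v} \<in> E} \<le> card (T - {v})" using h by (intro card_mono) auto
    also have "\<dots> = card T - 1" using that by simp
    finally have "dg T v \<le> real (card T - 1)" unfolding dg_def by simp
    moreover have "0 < card T" using that h card_gt_0_iff by blast
    ultimately have "dg T v \<le> real (card T) - 1" by simp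
    then show ?thesis using dg_compl[OF h(2,3)] unfolding h(1) by linarith
  qed
  have nb: "\<exists>w\<in>T. {v, w} \<in> E \<and> w \<notin> W" if "finite T" "real (card W) < dg T v" "finite W" for T W v
  proof (rule ccontr)
    assume "\<not> ?thesis"
    then have "{u \<in> T. {u, v} \<in> E} \<subseteq> W" by (auto simp: insert_commute)
    then have "card {u \<in> T. {u, v} \<in> E} \<le> card W" using that by (intro card_mono) auto
    then show False using that unfolding dg_def by linarith
  qed
  obtain x y where xy: "x \<in> U" "y \<in> U" "x \<noteq> y"
    using two fin by (metis card_le_Suc0_iff_eq not_less_eq_eq numeral_2_eq_2)
  have dx: "1 \<le> dg U' v" if "v \<in> U" for v using out[OF UU that] cn le by linarith
  have wit: ?thesis if "a \<in> U" "b \<in> U" "a' \<in> U'" "b' \<in> U'" "a \<noteq> b" "a' \<noteq> b'" "{a, a'} \<in> E" "{b, b'} \<in> E"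
    for a b a' b' using that by (intro bexI[of _ a] bexI[of _ b] bexI[of _ a'] bexI[of _ b'] conjI)
  show ?thesis
  proof (cases "card U < card U'")
    case True
    obtain x' where x': "x' \<in> U'" "{x, x'} \<in> E" using nb[OF fin(2), of "{}" x] dx[OF xy(1)] by auto
    have "1 < dg U' y" using out[OF UU xy(2)] cn True by linarith
    then have "real (card {x'}) < dg U' y" by simp
    then have "\<exists>w\<in>U'. {y, w} \<in> E \<and> w \<notin> {x'}" by (rule nb[OF fin(2)]) simp
    then obtain y' where y': "y' \<in> U'" "{y, y'} \<in> E" "y' \<noteq> x'" by blast
    show ?thesis by (rule wit[OF xy(1,2) x'(1) y'(1) xy(3) y'(3)[symmetric] x'(2) y'(2)])
  next
    case False
    have UU': "U' \<union> U = V" "U' \<inter> U = {}" using UU by auto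
    have dx': "1 \<le> dg U v" if "v \<in> U'" for v using out[OF UU' that] cn le False by linarith
    obtain x' where x': "x' \<in> U'" "{x, x'} \<in> E" using nb[OF fin(2), of "{}" x] dx[OF xy(1)] by auto
    have "2 \<le> card U'" using two le by simp
    then obtain w' where w': "w' \<in> U'" "w' \<noteq> x'"
      using fin by (metis card_le_Suc0_iff_eq not_less_eq_eq numeral_2_eq_2)
    obtain w where w: "w \<in> U" "{w', w} \<in> E" using nb[OF fin(1), of "{}" w'] dx'[OF w'(1)] by auto
    obtain u' where u': "u' \<in> U'" "{y, u'} \<in> E" using nb[OF fin(2), of "{}" y] dx[OF xy(2)] by auto
    have ww: "{w, w'} \<in> E" using w by (simp add: insert_commute)
    show ?thesis
    proof (cases "w = x")
      case True
      show ?thesis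
      proof (cases "u' = x'")
        case True
        have 1: "{y, x'} \<in> E" "{x, w'} \<in> E" using True u'(2) ww \<open>w = x\<close> by simp_all
        show ?thesis by (rule wit[OF xy(2,1) x'(1) w'(1) xy(3)[symmetric] w'(2)[symmetric] 1])
      next
        case False
        show ?thesis by (rule wit[OF xy(1,2) x'(1) u'(1) xy(3) False[symmetric] x'(2) u'(2)])
      qed
    next
      case False
      show ?thesis by (rule wit[OF xy(1) w(1) x'(1) w'(1) False[symmetric] w'(2)[symmetric] x'(2) ww])
    qed
  qed
qed

lemma disjoint_cross_edges:
  assumes UU: "U \<union> U' = V" "U \<inter> U' = {}" and two: "2 \<le> card U" "2 \<le> card U'"
  obtains x y x' y' where "x \<in> U" "y \<in> U" "x' \<in> U'" "y' \<in> U'" "x \<noteq> y" "x' \<noteq> y'" "{x, x'} \<in> E" "{y, y'} \<in> E"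
proof (cases "card U \<le> card U'")
  case True
  then show ?thesis using that disjoint_cross_edges_aux[OF UU True two(1)] by blast
next
  case False
  have UU': "U' \<union> U = V" "U' \<inter> U = {}" using UU by auto
  obtain x y x' y' where "x \<in> U'" "y \<in> U'" "x' \<in> U" "y' \<in> U" "x \<noteq> y" "x' \<noteq> y'" "{x, x'} \<in> E" "{y, y'} \<in> E"
    using disjoint_cross_edges_aux[OF UU' _ two(2)] False by auto
  then show ?thesis using that[of x' y' x y] by (simp add: insert_commute)
qed

text \<open>All edges between the parts are deleted except two disjoint ones, so only the ends of
  these two can have neighbours in the other part.\<close>

lemma clique_case:
  assumes UU: "U \<union> U' = V" "U \<inter> U' = {}"
    and card: "49 / 100 * real n \<le> real (card U)" "49 / 100 * real n \<le> real (card U')"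
    and deg: "\<And>v. v \<in> U \<Longrightarrow> 249 / 1000 * real n \<le> dg U v" "\<And>v. v \<in> U' \<Longrightarrow> 249 / 1000 * real n \<le> dg U' v"
    and nb: "NB U U \<le> 18 / 100000 * (real n)\<^sup>2" "NB U' U' \<le> 18 / 100000 * (real n)\<^sup>2"
  shows "\<exists>vs. hamilton_cycle V E vs \<and> compatible_cycle F vs"
proof -
  have fin: "finite U" "finite U'" using UU finite_sub by blast+
  have "2 \<le> card U" "2 \<le> card U'" using card n_ge by linarith+
  then obtain x y x' y' where e: "x \<in> U" "y \<in> U" "x' \<in> U'" "y' \<in> U'" "x \<noteq> y" "x' \<noteq> y'"
    "{x, x'} \<in> E" "{y, y'} \<in> E" using disjoint_cross_edges[OF UU] by metis
  define adj where "adj u v \<longleftrightarrow> {u, v} \<in> E \<and> ((u \<in> U \<and> v \<in> U) \<or> (u \<in> U' \<and> v \<in> U') \<or>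
     {u, v} = {x, x'} \<or> {u, v} = {y, y'})" for u v
  have adjE: "{u, v} \<in> E" if "adj u v" for u v using that unfolding adj_def by blast
  have adjs: "adj v u" if "adj u v" for u v using that unfolding adj_def by (simp add: insert_commute) blast
  interpret H: compat_graph adj compat V \<Delta> by (rule compat_graph[OF adjE adjs])
  have adjT: "adj u v \<longleftrightarrow> {u, v} \<in> E" if "(u \<in> U \<and> v \<in> U) \<or> (u \<in> U' \<and> v \<in> U')" for u v
    using that unfolding adj_def by blast
  have dgT: "real (card {w \<in> T. adj v w}) = dg T v" if "T = U \<or> T = U'" "v \<in> T" for T v
  proof -
    have "{w \<in> T. adj v w} = {w \<in> T. {w, v} \<in> E}"
      using adjT[of v] that by (auto simp: insert_commute)
    then show ?thesis unfolding dg_def by simp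
  qed
  have nbT: "badn H.nonadj T T \<le> NB T T" if "T = U \<or> T = U'" for T
    unfolding NB_def by (rule badn_mono) (use that fin adjT in auto)
  have "\<exists>C. H.ccycle C \<and> set C = V"
  proof (rule H.two_clique_hamilton[of "real n" U U' x y x' y'])
    show "adj x x'" "adj y y'" using e(7,8) unfolding adj_def by blast+
    have 1: "w \<in> U" if "v \<in> U - {x, y}" "adj v w" for v w
    proof -
      have "v \<notin> {x, x'}" "v \<notin> {y, y'}" "v \<notin> U'" using that(1) e UU(2) by auto
      then show ?thesis using that(2) unfolding adj_def by blast
    qed
    have 2: "w \<in> U'" if "v \<in> U' - {x', y'}" "adj v w" for v w
    proof -
      have "v \<notin> {x, x'}" "v \<notin> {y, y'}" "v \<notin> U" using that(1) e UU(2) by auto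
      then show ?thesis using that(2) unfolding adj_def by blast
    qed
    show "H.insertable U U (U - {x, y}) (U - {x, y})" "H.insertable U' U' (U' - {x', y'}) (U' - {x', y'})"
      unfolding H.insertable_def using 1 2 UU(1) by blast+
    show "badn H.nonadj U U \<le> 18 / 100000 * (real n)\<^sup>2" "badn H.nonadj U' U' \<le> 18 / 100000 * (real n)\<^sup>2"
      using nbT[OF disjI1[OF refl]] nbT[OF disjI2[OF refl]] nb by linarith+
  qed (use n_ge \<Delta>_le UU card e deg dgT in auto)
  then show ?thesis using hamilton_if_ccycle[of adj, OF adjE adjs] by blast
qed

end

subsection \<open>The two extremal structures\<close>

locale extremal_graph = dirac_graph +
  fixes A B :: "'a set" and \<nu> \<eta> :: real
  assumes AB: "A \<subseteq> V" "B \<subseteq> V" and cA: "(1/2 - \<nu>) * real n \<le> real (card A)"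
    and cB: "(1/2 - \<nu>) * real n \<le> real (card B)"
    and eAB: "real (e_between E A B) \<le> \<eta> * (real n)\<^sup>2"
    and par: "110 * \<nu> + 250 * \<eta> < 1 / 2000"
begin

abbreviation N :: real where "N \<equiv> real n"

lemma finAB: "finite A" "finite B" using AB finite_sub by auto

lemma N_pos: "0 < N" "0 < N\<^sup>2" using n_pos by auto

lemma card_le_N: "S \<subseteq> V \<Longrightarrow> real (card S) \<le> N"
  using card_mono[OF finite_V] card_V by simp

lemma sum_AB: "(\<Sum>x\<in>A. dg B x) \<le> \<eta> * N\<^sup>2" "(\<Sum>x\<in>B. dg A x) \<le> \<eta> * N\<^sup>2"
  using sum_dg[OF finAB] eAB sum_dg_sym[OF finAB] by auto

lemma card_compl: "S \<subseteq> V \<Longrightarrow> real (card (V - S)) = N - real (card S)"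
  using card_Diff_subset[OF finite_sub, of S V] card_mono[OF finite_V, of S] card_V by simp

text \<open>A vertex with few neighbours in \<open>T\<close> has nearly N/2 neighbours in
  \<open>V - T\<close>. If \<open>V - T\<close> is not much larger than N/2, it misses little of
  that set.\<close>

lemma NB_compl:
  assumes "S \<subseteq> V" "T \<subseteq> V"
  shows "NB S (V - T) \<le> real (card S) * (N / 2 - real (card T)) + (\<Sum>x\<in>S. dg T x)"
proof -
  have "NB S (V - T) = (\<Sum>x\<in>S. real (card (V - T)) - dg (V - T) x)"
    by (rule NB_eq) (use finite_V in auto)
  also have "\<dots> \<le> (\<Sum>x\<in>S. N / 2 - real (card T) + dg T x)"
  proof (rule sum_mono)
    fix x assume "x \<in> S"
    then have "N / 2 - dg T x \<le> dg (V - T) x" using dg_compl[OF assms(2)] assms(1) by blast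
    then show "real (card (V - T)) - dg (V - T) x \<le> N / 2 - real (card T) + dg T x"
      using card_compl[OF assms(2)] by linarith
  qed
  also have "\<dots> = real (card S) * (N / 2 - real (card T)) + (\<Sum>x\<in>S. dg T x)"
    by (simp add: sum.distrib)
  finally show ?thesis .
qed

lemma NB_compl_le:
  assumes "S \<subseteq> V" "T \<subseteq> V" "(1/2 - \<nu>) * N \<le> real (card T)" "(\<Sum>x\<in>S. dg T x) \<le> \<eta> * N\<^sup>2"
  shows "NB S (V - T) \<le> real (card S) * \<nu> * N + \<eta> * N\<^sup>2"
proof -
  have "real (card S) * (N / 2 - real (card T)) \<le> real (card S) * (\<nu> * N)"
    using assms(3) by (intro mult_left_mono) (auto simp: algebra_simps)
  then show ?thesis using NB_compl[OF assms(1,2)] assms(4) by (simp add: mult.assoc)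
qed

lemma \<eta>_nonneg: "0 \<le> \<eta>"
proof -
  have "0 \<le> \<eta> * N\<^sup>2" using eAB by (meson of_nat_0_le_iff order_trans)
  then show ?thesis using N_pos by (simp add: zero_le_mult_iff)
qed

text \<open>For negative \<open>\<nu>\<close> the minimum degree forces edges between \<open>A\<close> and \<open>B\<close>, which bounds \<open>\<eta>\<close> from below.\<close>

lemma \<nu>_lower: "0 \<le> \<nu> / 2 + \<eta>"
proof (cases "0 \<le> \<nu>")
  case False
  have "N / 2 \<le> (1/2 - \<nu>) * N" using False N_pos by (simp add: algebra_simps mult_nonpos_nonneg)
  then have "N / 2 \<le> real (card A)" using cA by linarith
  then have "real (card A) * (\<nu> * N) \<le> (N / 2) * (\<nu> * N)"
    using False N_pos by (intro mult_right_mono_neg) (auto simp: mult_nonpos_nonneg)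
  moreover have "0 \<le> NB A (V - B)" unfolding NB_def by (rule badn_nonneg)
  ultimately have "0 \<le> (N / 2) * (\<nu> * N) + \<eta> * N\<^sup>2"
    using NB_compl_le[OF AB cB sum_AB(1)] by (simp add: mult.assoc)
  also have "\<dots> = (\<nu> / 2 + \<eta>) * N\<^sup>2" by (simp add: power2_eq_square algebra_simps)
  finally show ?thesis using N_pos by (simp add: zero_le_mult_iff)
qed (use \<eta>_nonneg in simp)

text \<open>Inserting \<open>\<nu> \<ge> - 2 * \<eta>\<close> into \<open>par\<close> leaves
  \<open>30 * \<eta> < 1 / 2000\<close>. The upper bound on \<open>\<nu>\<close> then uses
  \<open>\<eta> \<ge> 0\<close>, and the lower one uses \<open>\<nu> \<ge> - 2 * \<eta>\<close>
  again.\<close>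

lemma bounds: "\<eta> \<le> 1 / 60000" "\<nu> \<le> 1 / 220000" "- (1 / 30000) \<le> \<nu>"
  using \<nu>_lower \<eta>_nonneg par by linarith+

lemma \<eta>_le: "\<eta> * N\<^sup>2 \<le> N\<^sup>2 / 60000"
  using mult_right_mono[OF bounds(1), of "N\<^sup>2"] by simp

lemma card_\<nu>_le: "S \<subseteq> V \<Longrightarrow> real (card S) * \<nu> * N \<le> N\<^sup>2 / 220000"
proof -
  assume "S \<subseteq> V"
  have "real (card S) * \<nu> \<le> N * (1 / 220000)"
  proof (cases "0 \<le> \<nu>")
    case True
    then show ?thesis using card_le_N[OF \<open>S \<subseteq> V\<close>] bounds(2) N_pos by (intro mult_mono) auto
  next
    case False
    then have "real (card S) * \<nu> \<le> 0" by (simp add: mult_nonneg_nonpos)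
    then show ?thesis using N_pos by linarith
  qed
  then have "real (card S) * \<nu> * N \<le> N * (1 / 220000) * N" using N_pos by (intro mult_right_mono) auto
  then show ?thesis by (simp add: power2_eq_square)
qed

lemma NB_AB: "NB A (V - B) \<le> 214 / 10000000 * N\<^sup>2" "NB B (V - A) \<le> 214 / 10000000 * N\<^sup>2"
  using NB_compl_le[OF AB cB sum_AB(1)] NB_compl_le[OF AB(2,1) cA sum_AB(2)] \<eta>_le N_pos
    card_\<nu>_le[OF AB(1)] card_\<nu>_le[OF AB(2)] by linarith+

definition p :: real where "p = real (card (A \<inter> B))"
definition q :: real where "q = real (card (A - B))"

lemma p_q: "p + q = real (card A)" "0 \<le> p" "0 \<le> q" "p \<le> N"
proof -
  have "card A = card (A \<inter> B) + card (A - B)"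
    by (subst card_Un_disjoint[symmetric]) (use finAB in \<open>auto intro!: arg_cong[of _ _ card]\<close>)
  then show "p + q = real (card A)" unfolding p_def q_def by simp
  show "p \<le> N" unfolding p_def by (rule card_le_N) (use AB in auto)
qed (auto simp: p_def q_def)

text \<open>All pairs between \<open>A \<inter> B\<close> and \<open>A - B\<close> are counted. A
  missing one is also missing between \<open>A \<inter> B\<close> and \<open>V - B\<close>, where
  few are missing; an edge is counted by e(A,B), having one end in \<open>B\<close> and the other in
  \<open>A\<close>.\<close>

lemma p_q_prod: "p * q \<le> p * \<nu> * N + 2 * (\<eta> * N\<^sup>2)"
proof -
  let ?P = "A \<inter> B" and ?Q = "A - B"
  have fin: "finite ?P" "finite ?Q" using finAB by auto
  have "p * q = (\<Sum>x\<in>?P. real (card ?Q) - dg ?Q x) + (\<Sum>x\<in>?P. dg ?Q x)"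
    by (simp add: sum.distrib[symmetric] p_def q_def)
  also have "(\<Sum>x\<in>?P. real (card ?Q) - dg ?Q x) = NB ?P ?Q" by (rule NB_eq[OF fin(2), symmetric])
  also have "NB ?P ?Q \<le> NB ?P (V - B)" by (rule NB_mono) (use fin finite_V AB in auto)
  also have "NB ?P (V - B) \<le> p * \<nu> * N + \<eta> * N\<^sup>2"
    unfolding p_def
  proof (rule NB_compl_le)
    show "(\<Sum>x\<in>?P. dg B x) \<le> \<eta> * N\<^sup>2"
      using sum_AB(1) sum_mono2[OF finAB(1), of ?P "dg B"] dg_nonneg by fastforce
  qed (use AB cB in auto)
  also have "(\<Sum>x\<in>?P. dg ?Q x) \<le> \<eta> * N\<^sup>2"
  proof -
    have "(\<Sum>x\<in>?P. dg ?Q x) \<le> (\<Sum>x\<in>B. dg ?Q x)"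
      by (rule sum_mono2) (use finAB dg_nonneg in auto)
    also have "\<dots> \<le> (\<Sum>x\<in>B. dg A x)" by (rule sum_mono) (use finAB in \<open>auto intro: dg_mono\<close>)
    finally show ?thesis using sum_AB(2) by linarith
  qed
  finally show ?thesis by linarith
qed

text \<open>\<open>p + q\<close> is at least \<open>499 / 1000 * N\<close>, so if both exceeded
  \<open>N / 10000\<close>, their product would exceed roughly \<open>N^2 / 20000\<close>, while it
  is at most about \<open>38 / 1000000 * N^2\<close>.\<close>

lemma small_part: "p \<le> N / 10000 \<or> q \<le> N / 10000"
proof (rule ccontr)
  assume "\<not> ?thesis"
  then have "0 < (p - N / 10000) * (q - N / 10000)" by (intro mult_pos_pos) auto
  moreover have "(p - N / 10000) * (q - N / 10000) = p * q - (p + q) * N / 10000 + N\<^sup>2 / 100000000"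
    by (simp add: power2_eq_square algebra_simps)
  moreover have "(499 / 1000) * N * N \<le> (p + q) * N"
  proof (rule mult_right_mono)
    have "(499 / 1000) * N \<le> (1/2 - \<nu>) * N" using bounds(2) by (intro mult_right_mono) auto
    then show "(499 / 1000) * N \<le> p + q" using p_q(1) cA by linarith
  qed simp
  then have "(499 / 1000) * N\<^sup>2 \<le> (p + q) * N" by (simp add: power2_eq_square)
  moreover have "p * \<nu> * N \<le> N\<^sup>2 / 220000"
    unfolding p_def by (rule card_\<nu>_le) (use AB in auto)
  ultimately show False using p_q_prod \<eta>_le N_pos by linarith
qed

lemma \<nu>_N: "\<nu> * N \<le> N / 220000" using mult_right_mono[OF bounds(2), of N] by simp

lemma scale: "a \<le> b \<Longrightarrow> a * N \<le> b * N" using N_pos by (simp add: mult_right_mono)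

lemma le_of_mult_le:
  assumes "c * (k * N) \<le> b * N\<^sup>2" "b \<le> d * k" "0 < k"
  shows "c \<le> d * N"
proof -
  have "b * N\<^sup>2 \<le> d * k * N\<^sup>2" using assms(2) by (intro mult_right_mono) auto
  also have "\<dots> = (d * N) * (k * N)" by (simp add: power2_eq_square)
  finally have "c * (k * N) \<le> (d * N) * (k * N)" using assms(1) by linarith
  then show ?thesis using assms(3) N_pos by (subst (asm) mult_le_cancel_right_pos) auto
qed

end

locale large_extremal_graph = extremal_graph + large_dirac_graph
begin

text \<open>\<open>P = A \<inter> B\<close> makes up almost all of \<open>A\<close> and spans few
  edges, so it is nearly one side. The exact sides are fixed by whether a vertex has N/4 neighbours
  in \<open>P\<close>, which guarantees every vertex about N/4 neighbours across.\<close>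

lemma bipartite_like:
  assumes q: "q \<le> N / 10000"
  shows "\<exists>vs. hamilton_cycle V E vs \<and> compatible_cycle F vs"
proof -
  define P where "P = A \<inter> B"
  have P: "P \<subseteq> V" "finite P" "real (card P) = p" using AB finAB unfolding P_def p_def by auto
  have cA': "N / 2 - \<nu> * N \<le> real (card A)" using cA by (simp add: algebra_simps)
  have p0: "4998 / 10000 * N \<le> p" using p_q(1) cA' \<nu>_N q N_pos by linarith
  \<comment> \<open>As \<open>p\<close> is near N/2, the product bound improves the crude estimate
    \<open>N / 10000\<close>; the factor 4002/1000 is just above 2 divided by 4998/10000.\<close>
  have q1: "q - \<nu> * N \<le> 4002 / 1000 * (\<eta> * N)"
  proof (rule ccontr)
    assume neg: "\<not> ?thesis"
    have e0: "0 \<le> \<eta> * N" using \<eta>_nonneg N_pos by simp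
    then have "(4998 / 10000 * N) * (4002 / 1000 * (\<eta> * N)) < p * (q - \<nu> * N)"
      using neg p0 N_pos by (intro mult_le_less_imp_less) auto
    moreover have "p * (q - \<nu> * N) \<le> 2 * (\<eta> * N\<^sup>2)" using p_q_prod by (simp add: algebra_simps)
    moreover have "0 \<le> \<eta> * N\<^sup>2" using \<eta>_nonneg by simp
    moreover have "(4998 / 10000 * N) * (4002 / 1000 * (\<eta> * N)) = (4998 / 10000 * (4002 / 1000)) * (\<eta> * N\<^sup>2)"
      by (simp add: power2_eq_square)
    ultimately show False by linarith
  qed
  \<comment> \<open>The combined inequality \<open>par\<close> is essential here: separate bounds on
    \<open>\<nu>\<close> and \<open>\<eta>\<close> would be too weak.\<close>
  have "(2 * \<nu> + 4002 / 1000 * \<eta>) * N \<le> 1 / 100000 * N"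
    by (rule scale) (use par \<eta>_nonneg \<nu>_lower in linarith)
  then have p1: "N / 2 - N / 100000 \<le> p" using q1 p_q(1) cA' by (simp add: algebra_simps)
  have sP: "(\<Sum>x\<in>P. dg P x) \<le> N\<^sup>2 / 60000"
  proof -
    have "(\<Sum>x\<in>P. dg P x) \<le> (\<Sum>x\<in>A. dg P x)"
      by (rule sum_mono2) (use finAB dg_nonneg in \<open>auto simp: P_def\<close>)
    also have "\<dots> \<le> (\<Sum>x\<in>A. dg B x)" by (rule sum_mono) (use finAB in \<open>auto intro: dg_mono simp: P_def\<close>)
    finally show ?thesis using sum_AB(1) \<eta>_le by linarith
  qed
  \<comment> \<open>In a larger \<open>P\<close> every vertex would have at least
    \<open>p - N / 2\<close> neighbours inside \<open>P\<close>, which is more than e(A,B)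
    permits.\<close>
  have p2: "p \<le> N / 2 + 34 / 1000000 * N"
  proof (rule ccontr)
    assume neg: "\<not> ?thesis"
    have "p - N / 2 \<le> dg P x" if "x \<in> P" for x
    proof -
      have "N / 2 - dg (V - P) x \<le> dg (V - (V - P)) x" by (rule dg_compl) (use that P in auto)
      moreover have "V - (V - P) = P" using P by auto
      moreover have "dg (V - P) x \<le> N - p" using dg_le_card[of "V - P" x] finite_V card_compl[OF P(1)] P(3) by simp
      ultimately show ?thesis by simp
    qed
    then have "real (card P) * (p - N / 2) \<le> (\<Sum>x\<in>P. dg P x)"
      by (intro card_mult_le_sum) (use P dg_nonneg in auto)
    moreover have "(N / 2) * (34 / 1000000 * N) < p * (p - N / 2)"
      using neg N_pos by (intro mult_strict_mono) auto
    moreover have "(N / 2) * (34 / 1000000 * N) = 17 / 1000000 * N\<^sup>2" by (simp add: power2_eq_square)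
    ultimately show False using sP N_pos unfolding P(3) by linarith
  qed
  have nbP: "NB P (V - P) \<le> 22 / 1000000 * N\<^sup>2"
  proof -
    have "p * (N / 2 - p) \<le> p * (N / 100000)" using p1 p_q by (intro mult_left_mono) auto
    also have "\<dots> \<le> (501 / 1000 * N) * (N / 100000)" using p2 N_pos by (intro mult_right_mono) auto
    finally have "p * (N / 2 - p) \<le> 501 / 100000000 * N\<^sup>2" by (simp add: power2_eq_square)
    then show ?thesis using NB_compl[OF P(1) P(1), unfolded P(3)] sP N_pos by linarith
  qed
  define Y where "Y = {v \<in> V. N / 4 \<le> dg P v}"
  define X where "X = V - Y"
  have XY: "X \<union> Y = V" "X \<inter> Y = {}" unfolding X_def Y_def by auto
  have fin: "finite X" "finite Y" using XY finite_sub by blast+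
  have c1: "real (card (P \<inter> Y)) \<le> N / 15000"
  proof -
    have "real (card (P \<inter> Y)) * (N / 4) \<le> (\<Sum>x\<in>P. dg P x)"
      by (intro card_mult_le_sum) (use P dg_nonneg in \<open>auto simp: Y_def\<close>)
    moreover have "real (card (P \<inter> Y)) * (1 / 4 * N) = real (card (P \<inter> Y)) * (N / 4)" by simp
    ultimately have "real (card (P \<inter> Y)) * (1 / 4 * N) \<le> 1 / 60000 * N\<^sup>2" using sP by linarith
    then have "real (card (P \<inter> Y)) \<le> 1 / 15000 * N" by (rule le_of_mult_le) simp_all
    then show ?thesis by simp
  qed
  have c2: "real (card (X - P)) \<le> 89 / 1000000 * N"
  proof -
    have "real (card (X - P)) * (p - N / 4) \<le> (\<Sum>x\<in>V - P. real (card P) - dg P x)"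
      using P dg_le_card[OF P(2)] finite_V
      by (intro card_mult_le_sum) (auto simp: X_def Y_def not_le intro: less_imp_le)
    also have "\<dots> = NB P (V - P)" using NB_eq[OF P(2), of "V - P"] NB_sym[of P "V - P"] by simp
    finally have 1: "real (card (X - P)) * (p - N / 4) \<le> 22 / 1000000 * N\<^sup>2" using nbP by linarith
    have "real (card (X - P)) * (2499 / 10000 * N) \<le> real (card (X - P)) * (p - N / 4)"
      using p1 N_pos by (intro mult_left_mono) auto
    then have "real (card (X - P)) * (2499 / 10000 * N) \<le> 22 / 1000000 * N\<^sup>2" using 1 by linarith
    then show ?thesis by (rule le_of_mult_le) simp_all
  qed
  have cX: "real (card X) = p - real (card (P \<inter> Y)) + real (card (X - P))"
  proof -
    have "X = (P - P \<inter> Y) \<union> (X - P)" using P XY unfolding X_def by auto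
    then have "card X = card (P - P \<inter> Y) + card (X - P)"
      using card_Un_disjoint[of "P - P \<inter> Y" "X - P"] P fin by auto
    moreover have "card (P - P \<inter> Y) + card (P \<inter> Y) = card P"
      using card_Diff_subset[of "P \<inter> Y" P] card_mono[of P "P \<inter> Y"] P by simp
    ultimately show ?thesis using P(3) by simp
  qed
  have cXY: "real (card X) + real (card Y) = N" using card_Un_disjoint[OF fin XY(2)] XY(1) card_V by simp
  have sX: "49992 / 100000 * N \<le> real (card X)" "real (card X) \<le> 500124 / 1000000 * N"
    using cX p1 p2 c1 c2 N_pos by linarith+
  have degX: "2499 / 10000 * N \<le> dg Y x" if "x \<in> X" for x
  proof -
    have "x \<in> V" "dg P x < N / 4" using that unfolding X_def Y_def by auto
    then have "N / 4 \<le> dg (V - P) x" using dg_compl[OF P(1)] by fastforce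
    moreover have "(V - P) - Y = X - P" unfolding X_def by auto
    then have "dg (V - P) x - real (card (X - P)) \<le> dg Y x"
      using dg_diff[of "V - P" Y x] finite_V fin by simp
    ultimately show ?thesis using c2 N_pos by linarith
  qed
  have degY: "2499 / 10000 * N \<le> dg X y" if "y \<in> Y" for y
  proof -
    have "N / 4 \<le> dg P y" using that unfolding Y_def by auto
    moreover have "P - X = P \<inter> Y" using P unfolding X_def by auto
    then have "dg P y - real (card (P \<inter> Y)) \<le> dg X y" using dg_diff[OF P(2) fin(1), of y] by simp
    ultimately show ?thesis using c1 N_pos by linarith
  qed
  have nb: "NB X Y \<le> 115 / 1000000 * N\<^sup>2"
  proof -
    have "NB X Y \<le> NB (P \<union> (X - P)) Y" by (rule NB_mono) (use P fin in auto)
    also have "\<dots> \<le> NB P Y + NB (X - P) Y" by (rule NB_Un_left) (use P fin in auto)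
    also have "NB P Y \<le> NB ((V - P) \<union> (P \<inter> Y)) P"
      unfolding NB_sym[of P Y] by (rule NB_mono) (use P fin finite_V XY in auto)
    also have "\<dots> \<le> NB (V - P) P + NB (P \<inter> Y) P" by (rule NB_Un_left) (use P finite_V in auto)
    also have "NB (V - P) P \<le> 22 / 1000000 * N\<^sup>2" using nbP NB_sym[of P "V - P"] by simp
    also have "NB (P \<inter> Y) P \<le> real (card (P \<inter> Y)) * real (card P)" by (rule NB_le_card[OF P(2)])
    also have "\<dots> \<le> (N / 15000) * (501 / 1000 * N)"
      using c1 p2 P(3) N_pos by (intro mult_mono) auto
    also have "NB (X - P) Y \<le> real (card (X - P)) * real (card Y)" by (rule NB_le_card[OF fin(2)])
    also have "\<dots> \<le> (89 / 1000000 * N) * (501 / 1000 * N)"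
      using c2 sX(1) cXY N_pos by (intro mult_mono) auto
    finally have "NB X Y \<le> 22 / 1000000 * N\<^sup>2 + (N / 15000) * (501 / 1000 * N) + (89 / 1000000 * N) * (501 / 1000 * N)"
      by linarith
    also have "\<dots> = (22 / 1000000 + 501 / 15000000 + 89 * 501 / 1000000000) * N\<^sup>2"
      by (simp add: power2_eq_square algebra_simps)
    also have "\<dots> \<le> 115 / 1000000 * N\<^sup>2" by (intro mult_right_mono) auto
    finally show ?thesis .
  qed
  show ?thesis
  proof (cases "card X \<le> card Y")
    case True
    show ?thesis by (rule bipartite_case[OF XY True _ degX degY nb]) (use sX cXY N_pos in linarith)
  next
    case False
    have YX: "Y \<union> X = V" "Y \<inter> X = {}" using XY by auto
    have nb': "NB Y X \<le> 115 / 1000000 * N\<^sup>2" using nb NB_sym[of X Y] by simp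
    show ?thesis by (rule bipartite_case[OF YX _ _ degY degX nb']) (use False sX cXY N_pos in linarith)+
  qed
qed

lemma NB_near:
  assumes "finite U" "finite K"
  shows "NB U U \<le> NB K K + 2 * (real (card (U - K)) * real (card U))"
proof -
  have "NB U U \<le> NB (U \<inter> K) U + NB (U - K) U"
    using NB_Un_left[of "U \<inter> K" "U - K" U] assms by (simp add: Int_Diff_Un)
  moreover have "NB (U \<inter> K) U \<le> NB (U \<inter> K) (U \<inter> K) + NB (U - K) (U \<inter> K)"
    using NB_Un_left[of "U \<inter> K" "U - K" "U \<inter> K"] assms NB_sym[of "U \<inter> K" U] by (simp add: Int_Diff_Un)
  moreover have "NB (U \<inter> K) (U \<inter> K) \<le> NB K K" "NB (U - K) (U \<inter> K) \<le> NB (U - K) U"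
    by (rule NB_mono; use assms in auto)+
  moreover have "NB (U - K) U \<le> real (card (U - K)) * real (card U)" by (rule NB_le_card[OF assms(1)])
  ultimately show ?thesis by linarith
qed

text \<open>\<open>K = A - B\<close> lies in \<open>A\<close> and in \<open>V - B\<close>, between
  which few pairs are missing, so it is nearly complete; the same holds for
  \<open>L = B - A\<close>, and what is left is tiny. Dividing by the threshold N/4 for neighbours
  in \<open>B\<close> gives every vertex, exceptional ones included, about N/4 neighbours in its own
  part.\<close>

lemma clique_like:
  assumes p: "p \<le> N / 10000"
  shows "\<exists>vs. hamilton_cycle V E vs \<and> compatible_cycle F vs"
proof -
  define K where "K = A - B"
  define L where "L = B - A"
  define P where "P = A \<inter> B"
  define R where "R = V - (A \<union> B)"
  have fin: "finite K" "finite L" "finite P" "finite R" using finAB finite_V unfolding K_def L_def P_def R_def by auto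
  have cA': "N / 2 - \<nu> * N \<le> real (card A)" "N / 2 - \<nu> * N \<le> real (card B)" using cA cB by (simp_all add: algebra_simps)
  have p1: "p \<le> 4002 / 1000 * (\<eta> * N)"
  proof (rule ccontr)
    assume neg: "\<not> ?thesis"
    have e0: "0 \<le> \<eta> * N" using \<eta>_nonneg N_pos by simp
    have "4998 / 10000 * N \<le> q - \<nu> * N" using p_q(1) cA'(1) \<nu>_N p N_pos by linarith
    then have "(4002 / 1000 * (\<eta> * N)) * (4998 / 10000 * N) < p * (q - \<nu> * N)"
      using neg e0 N_pos by (intro mult_less_le_imp_less) auto
    moreover have "p * (q - \<nu> * N) \<le> 2 * (\<eta> * N\<^sup>2)" using p_q_prod by (simp add: algebra_simps)
    moreover have "0 \<le> \<eta> * N\<^sup>2" using \<eta>_nonneg by simp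
    moreover have "(4002 / 1000 * (\<eta> * N)) * (4998 / 10000 * N) = (4998 / 10000 * (4002 / 1000)) * (\<eta> * N\<^sup>2)"
      by (simp add: power2_eq_square)
    ultimately show False by linarith
  qed
  have cP: "real (card P) = p" unfolding P_def p_def ..
  have cK: "real (card K) = real (card A) - p" using p_q(1) unfolding K_def q_def by linarith
  have cL: "real (card L) = real (card B) - p"
  proof -
    have "card B = card (A \<inter> B) + card (B - A)"
      by (subst card_Un_disjoint[symmetric]) (use finAB in \<open>auto intro!: arg_cong[of _ _ card]\<close>)
    then show ?thesis unfolding L_def p_def by simp
  qed
  have cR: "real (card R) = N - real (card A) - real (card B) + p"
  proof -
    have "card (A \<union> B) + card (A \<inter> B) = card A + card B" using card_Un_Int[OF finAB] by simp
    then show ?thesis using card_compl[of "A \<union> B"] AB unfolding R_def p_def by simp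
  qed
  \<comment> \<open>A linear combination of \<open>par\<close> and \<open>\<nu>_lower\<close>;
    separate bounds on \<open>\<nu>\<close> and \<open>\<eta>\<close> would give about twice as
    much.\<close>
  have "(2 * \<nu> + 8004 / 1000 * \<eta>) * N \<le> 68 / 1000000 * N"
    by (rule scale) (use par \<eta>_nonneg \<nu>_lower in linarith)
  then have pR: "p + real (card R) \<le> 68 / 1000000 * N" using cR cA' p1 by (simp add: algebra_simps)
  have "(\<nu> + 4002 / 1000 * \<eta>) * N \<le> 4 / 100000 * N"
    by (rule scale) (use par \<eta>_nonneg \<nu>_lower in linarith)
  then have sKL: "49996 / 100000 * N \<le> real (card K)" "49996 / 100000 * N \<le> real (card L)"
    using cK cL cA' p1 by (simp_all add: algebra_simps)
  define U where "U = {v \<in> V. dg B v < N / 4}"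
  define U' where "U' = {v \<in> V. N / 4 \<le> dg B v}"
  have UU: "U \<union> U' = V" "U \<inter> U' = {}" unfolding U_def U'_def by auto
  have finU: "finite U" "finite U'" using UU finite_sub by blast+
  have c1: "real (card (K \<inter> U')) \<le> N / 15000"
  proof -
    have "real (card (K \<inter> U')) * (N / 4) \<le> (\<Sum>x\<in>A. dg B x)"
      by (intro card_mult_le_sum) (use finAB dg_nonneg in \<open>auto simp: U'_def K_def\<close>)
    moreover have "real (card (K \<inter> U')) * (1 / 4 * N) = real (card (K \<inter> U')) * (N / 4)" by simp
    ultimately have "real (card (K \<inter> U')) * (1 / 4 * N) \<le> 1 / 60000 * N\<^sup>2"
      using sum_AB(1) \<eta>_le by linarith
    then have "real (card (K \<inter> U')) \<le> 1 / 15000 * N" by (rule le_of_mult_le) simp_all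
    then show ?thesis by simp
  qed
  \<comment> \<open>A vertex of \<open>L\<close> with fewer than N/4 neighbours in \<open>B\<close>
    misses nearly half of \<open>L\<close>, and \<open>L\<close> is contained in
    \<open>V - A\<close>, to which \<open>B\<close> is almost completely joined.\<close>
  have c2: "real (card (L \<inter> U)) \<le> 89 / 1000000 * N"
  proof -
    have "real (card (L \<inter> U)) * (2499 / 10000 * N) \<le> (\<Sum>x\<in>L \<inter> U. real (card L) - dg L x)"
    proof (rule card_mult_le_sum)
      fix x assume "x \<in> L \<inter> U"
      then have "dg L x < N / 4" using dg_mono[OF finAB(2), of L x] unfolding L_def U_def by auto
      then show "2499 / 10000 * N \<le> real (card L) - dg L x" using sKL(2) N_pos by linarith
    qed (use fin dg_le_card[OF fin(2)] in auto)
    also have "\<dots> = NB (L \<inter> U) L" by (rule NB_eq[OF fin(2), symmetric])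
    also have "\<dots> \<le> NB B (V - A)" by (rule NB_mono) (use finAB finite_V AB in \<open>auto simp: L_def\<close>)
    finally have "real (card (L \<inter> U)) * (2499 / 10000 * N) \<le> 214 / 10000000 * N\<^sup>2" using NB_AB(2) by linarith
    then show ?thesis by (rule le_of_mult_le) simp_all
  qed
  have card_Un3: "real (card S) \<le> real (card T1) + real (card T2) + real (card T3)"
    if "S \<subseteq> T1 \<union> T2 \<union> T3" "finite T1" "finite T2" "finite T3" for S T1 T2 T3 :: "'a set"
  proof -
    have "card S \<le> card (T1 \<union> T2 \<union> T3)" using that by (intro card_mono) auto
    then show ?thesis using card_Un_le[of "T1 \<union> T2" T3] card_Un_le[of T1 T2] by linarith
  qed
  have d1: "real (card (U - K)) \<le> 157 / 1000000 * N"
    using card_Un3[of "U - K" "L \<inter> U" P R] fin c2 pR cP unfolding U_def K_def L_def P_def R_def by fastforce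
  have d2: "real (card (U' - L)) \<le> 157 / 1000000 * N"
    using card_Un3[of "U' - L" "K \<inter> U'" P R] fin c1 pR cP N_pos unfolding U'_def K_def L_def P_def R_def by fastforce
  have KV: "K \<subseteq> U \<union> (K \<inter> U') \<union> {}" "L \<subseteq> U' \<union> (L \<inter> U) \<union> {}"
    using UU AB unfolding K_def L_def by auto
  have cUU: "real (card U) + real (card U') = N" using card_Un_disjoint[OF finU UU(2)] UU(1) card_V by simp
  have sU: "49980 / 100000 * N \<le> real (card U)" "49980 / 100000 * N \<le> real (card U')"
    using card_Un3[OF KV(1)] card_Un3[OF KV(2)] finU fin sKL c1 c2 N_pos by simp_all
  have degU: "249 / 1000 * N \<le> dg U v" if "v \<in> U" for v
  proof -
    have "v \<in> V" "dg B v < N / 4" using that unfolding U_def by auto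
    then have "N / 4 \<le> dg (V - B) v" using dg_compl[OF AB(2)] by fastforce
    moreover have "real (card ((V - B) - U)) \<le> real (card (K \<inter> U')) + real (card R) + real (card ({} :: 'a set))"
      by (rule card_Un3) (use fin in \<open>auto simp: U_def U'_def K_def R_def\<close>)
    moreover have "dg (V - B) v - real (card ((V - B) - U)) \<le> dg U v"
      by (rule dg_diff) (use finite_V finU in auto)
    ultimately show ?thesis using c1 pR p_q(2) N_pos by simp
  qed
  have degU': "249 / 1000 * N \<le> dg U' v" if "v \<in> U'" for v
  proof -
    have "N / 4 \<le> dg B v" using that unfolding U'_def by auto
    moreover have "real (card (B - U')) \<le> real (card (L \<inter> U)) + real (card P) + real (card ({} :: 'a set))"
      by (rule card_Un3) (use fin AB in \<open>auto simp: U_def U'_def L_def P_def\<close>)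
    moreover have "dg B v - real (card (B - U')) \<le> dg U' v" by (rule dg_diff[OF finAB(2) finU(2)])
    moreover have "p \<le> 68 / 1000000 * N" using pR by simp
    ultimately show ?thesis using c2 cP N_pos by simp
  qed
  \<comment> \<open>The constants are tight here: \<open>214 / 10000000\<close> plus twice the
    product of \<open>157 / 1000000\<close> and \<open>5002 / 10000\<close> is just below
    \<open>18 / 100000\<close>.\<close>
  have nb: "NB T T \<le> 18 / 100000 * N\<^sup>2"
    if "finite T" "finite M" "NB M M \<le> 214 / 10000000 * N\<^sup>2" "real (card (T - M)) \<le> 157 / 1000000 * N"
      "real (card T) \<le> 5002 / 10000 * N" for T M
  proof -
    have "real (card (T - M)) * real (card T) \<le> (157 / 1000000 * N) * (5002 / 10000 * N)"
      using that by (intro mult_mono) auto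
    also have "\<dots> = (157 * 5002 / 10000000000) * N\<^sup>2" by (simp add: power2_eq_square)
    finally show ?thesis using NB_near[OF that(1,2)] that(3) N_pos(2) by linarith
  qed
  have "NB K K \<le> NB A (V - B)" "NB L L \<le> NB B (V - A)"
    by (rule NB_mono; use finAB finite_V AB in \<open>auto simp: K_def L_def\<close>)+
  then have nbU: "NB U U \<le> 18 / 100000 * N\<^sup>2" "NB U' U' \<le> 18 / 100000 * N\<^sup>2"
    using nb[OF finU(1) fin(1) _ d1] nb[OF finU(2) fin(2) _ d2] NB_AB sU cUU by simp_all
  show ?thesis
    by (rule clique_case[OF UU _ _ degU degU' nbU]) (use sU N_pos in simp_all)
qed

lemma compatible_hamilton: "\<exists>vs. hamilton_cycle V E vs \<and> compatible_cycle F vs"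
  using small_part bipartite_like clique_like by blast

end

subsection \<open>Few vertices\<close>

fun alternating :: "'a set \<Rightarrow> 'a set \<Rightarrow> 'a list \<Rightarrow> bool" where
  "alternating X Y [] \<longleftrightarrow> True"
| "alternating X Y (x # xs) \<longleftrightarrow> x \<in> X \<and> alternating Y X xs"

lemma alternating_splice:
  assumes "length xs = length ys" "set xs \<subseteq> X" "set ys \<subseteq> Y" "alternating X Y zs"
  shows "alternating X Y (splice xs ys @ zs)"
  using assms by (induction xs ys rule: list_induct2) auto

lemma (in compat_graph) cpath_alternating:
  assumes "\<And>x y. x \<in> X \<Longrightarrow> y \<in> Y \<Longrightarrow> adj x y"
    and "\<And>u v w. adj u v \<Longrightarrow> adj v w \<Longrightarrow> comp u v w"
    and "alternating X Y zs"
  shows "cpath zs"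
proof -
  have "(alternating X Y zs \<longrightarrow> cpath zs) \<and> (alternating Y X zs \<longrightarrow> cpath zs)"
    by (induction zs rule: cpath.induct) (use assms(1,2) adj_sym in auto)
  then show ?thesis using assms(3) by blast
qed

context extremal_graph
begin

text \<open>The approximate hypotheses round to exact ones: there is no edge between
  \<open>A\<close> and \<open>B\<close>, and both sets have at least n/2 vertices. A vertex of
  \<open>A\<close> then has its n/2 or more neighbours in \<open>V - B\<close>, which has at most
  n/2 elements, so it is joined to all of \<open>V - B\<close>.\<close>

lemma small_complete_bipartite:
  assumes n: "n < 700"
  shows "A = B \<and> 2 * card A = n \<and> (\<forall>x\<in>A. \<forall>y\<in>V - A. {x, y} \<in> E)"
proof -
  have N: "N \<le> 699" using n by simp
  \<comment> \<open>For negative \<open>\<nu>\<close> both sets exceed n/2, so every vertex of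
    \<open>A\<close> has a neighbour in \<open>B\<close>. That makes more than n/2 edges, too many
    for so small an \<open>n\<close>.\<close>
  have \<nu>0: "0 \<le> \<nu>"
  proof (rule ccontr)
    assume neg: "\<not> 0 \<le> \<nu>"
    have "N / 2 < (1/2 - \<nu>) * N" using neg N_pos by (simp add: algebra_simps mult_neg_pos)
    then have AB2: "N / 2 < real (card A)" "N / 2 < real (card B)" using cA cB by linarith+
    have "1 \<le> dg B a" if "a \<in> A" for a
    proof -
      have "N / 2 - dg (V - B) a \<le> dg (V - (V - B)) a" by (rule dg_compl) (use that AB in auto)
      moreover have "V - (V - B) = B" using AB by auto
      moreover have "dg (V - B) a \<le> N - real (card B)"
        using dg_le_card[of "V - B" a] finite_V card_compl[OF AB(2)] by simp
      ultimately have "0 < dg B a" using AB2(2) by simp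
      then show ?thesis unfolding dg_def by simp
    qed
    then have "real (card A) * 1 \<le> (\<Sum>x\<in>A. dg B x)"
      by (intro card_mult_le_sum) (use finAB dg_nonneg in auto)
    then have "N / 2 < N\<^sup>2 / 60000" using sum_AB(1) \<eta>_le AB2 by linarith
    also have "N\<^sup>2 \<le> 699 * N" using N N_pos by (simp add: power2_eq_square)
    finally show False using N_pos by simp
  qed
  \<comment> \<open>For \<open>\<nu> \<ge> 0\<close> the parameter inequality gives
    \<open>\<eta> \<le> 1 / 500000\<close>, and 699^2 < 500000. This is where the threshold 700
    comes from.\<close>
  have "\<eta> * N\<^sup>2 \<le> (1 / 500000) * 699\<^sup>2"
    using par \<nu>0 \<eta>_nonneg N N_pos by (intro mult_mono power_mono) auto
  then have "real (e_between E A B) < 1" using eAB by simp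
  then have "(\<Sum>x\<in>A. dg B x) = 0" using sum_dg[OF finAB] by simp
  then have d0: "dg B a = 0" if "a \<in> A" for a
    using that sum_nonneg_eq_0_iff[OF finAB(1), of "dg B"] dg_nonneg by auto
  have \<nu>1: "\<nu> * N \<le> 699 / 220000" using mult_mono[OF bounds(2) N] \<nu>0 by simp
  have cA': "N / 2 - \<nu> * N \<le> real (card A)" "N / 2 - \<nu> * N \<le> real (card B)" using cA cB by (simp_all add: algebra_simps)
  have cVB: "real (card (V - B)) \<le> N / 2 + 699 / 220000" using card_compl[OF AB(2)] cA' \<nu>1 by linarith
  then have cVB2: "2 * card (V - B) \<le> n" by linarith
  have full: "{u \<in> V - B. {u, a} \<in> E} = V - B" "2 * card (V - B) = n" if "a \<in> A" for a
  proof -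
    let ?T = "{u \<in> V - B. {u, a} \<in> E}"
    have "N / 2 \<le> real (card ?T)" using dg_compl[OF AB(2), of a] d0[OF that] that AB unfolding dg_def by auto
    then have 1: "n \<le> 2 * card ?T" by linarith
    have 2: "card ?T \<le> card (V - B)" by (rule card_mono) (use finite_V in auto)
    show "?T = V - B" by (rule card_subset_eq) (use 1 2 cVB2 finite_V in auto)
    show "2 * card (V - B) = n" using 1 2 cVB2 by linarith
  qed
  have sub: "A \<subseteq> B"
  proof
    fix a assume a: "a \<in> A"
    have "a \<notin> V - B" using full(1)[OF a] edge_V by blast
    then show "a \<in> B" using a AB by blast
  qed
  have "n \<le> 2 * card A" using cA' \<nu>1 by linarith
  moreover from this have "A \<noteq> {}" using n_pos by auto
  then have "2 * card (V - B) = n" using full(2) by blast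
  then have "2 * card B = n" using card_compl[OF AB(2)] by linarith
  ultimately have "A = B" "2 * card A = n"
    using card_mono[OF finAB(2) sub] card_subset_eq[OF finAB(2) sub] by auto
  moreover have "{x, y} \<in> E" if "x \<in> A" "y \<in> V - B" for x y
    using full(1)[OF that(1)] that(2) by (auto simp: insert_commute)
  ultimately show ?thesis by auto
qed

text \<open>With a bound below 1 no two edges are incompatible, so any cyclic order alternating
  between the two halves works.\<close>

lemma small_hamilton:
  assumes n: "n < 700" "3 \<le> n" and \<Delta>1: "\<Delta> < 1"
  shows "\<exists>vs. hamilton_cycle V E vs \<and> compatible_cycle F vs"
proof -
  define adj where "adj u v \<longleftrightarrow> {u, v} \<in> E" for u v
  have adjE: "{u, v} \<in> E" if "adj u v" for u v using that unfolding adj_def .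
  have adjs: "adj v u" if "adj u v" for u v using that unfolding adj_def by (simp add: insert_commute)
  interpret H: compat_graph adj compat V \<Delta> by (rule compat_graph[OF adjE adjs])
  have comp: "compat u v w" if "adj u v" "adj v w" for u v w
  proof (rule ccontr)
    assume "\<not> compat u v w"
    then have "{w. adj v w \<and> \<not> compat u v w} \<noteq> {}" using that by blast
    then have "0 < card {w. adj v w \<and> \<not> compat u v w}"
      by (simp only: card_gt_0_iff H.finite_adj) simp
    then show False using H.comp_bound[OF that(1)] \<Delta>1 by linarith
  qed
  have A: "2 * card A = n" "\<And>x y. x \<in> A \<Longrightarrow> y \<in> V - A \<Longrightarrow> adj x y"
    using small_complete_bipartite[OF n(1)] unfolding adj_def by auto
  have cVA: "card (V - A) = card A" using card_compl[OF AB(1)] A(1) by linarith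
  obtain xs where xs: "set xs = A" "distinct xs" using finite_distinct_list[OF finAB(1)] by blast
  obtain ys where ys: "set ys = V - A" "distinct ys" using finite_distinct_list finite_V by (metis finite_Diff)
  have len: "length xs = length ys" "2 \<le> length xs"
    using distinct_card[OF xs(2)] distinct_card[OF ys(2)] xs(1) ys(1) cVA A(1) n(2) by auto
  define C where "C = splice xs ys"
  have sh: "C \<in> shuffles xs ys" unfolding C_def by (rule splice_in_shuffles)
  obtain x xs' y ys' where e: "xs = x # xs'" "ys = y # ys'" using len by (cases xs; cases ys) auto
  have alt: "alternating A (V - A) (C @ take 2 C)"
    unfolding C_def by (rule alternating_splice) (use len xs ys e in auto)
  have "H.cpath (C @ take 2 C)"
    by (rule H.cpath_alternating[of A "V - A"]) (use A(2) comp alt in auto)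
  moreover have "distinct C" using distinct_disjoint_shuffles[OF xs(2) ys(2) _ sh] xs(1) ys(1) by auto
  moreover have "3 \<le> length C" unfolding C_def using len by simp
  ultimately have "H.ccycle C" unfolding H.ccycle_def by blast
  moreover have "set C = V" using set_shuffles[OF sh] xs(1) ys(1) AB by auto
  ultimately show ?thesis using hamilton_if_ccycle[of adj, OF adjE adjs] by blast
qed

end

theorem theorem3p2:
  fixes \<mu> \<nu> \<eta> :: real and V :: "'a set" and E :: "'a set set"
    and F :: "'a \<Rightarrow> 'a set set set" and A B :: "'a set" and n :: nat
  assumes "\<mu> > 0"
    and "110 * \<nu> + 250 * \<eta> + 10 * sqrt \<mu> < 1 / 2000"
    and "simple_graph V E" and "card V = n" and "n \<ge> 3"
    and "\<forall>v\<in>V. real (degree E v) \<ge> real n / 2"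
    and "incompatibility_system V E F" and "bounded_system V E F (\<mu> * real n)"
    and "A \<subseteq> V" and "B \<subseteq> V"
    and "real (card A) \<ge> (1/2 - \<nu>) * real n" and "real (card B) \<ge> (1/2 - \<nu>) * real n"
    and "real (e_between E A B) \<le> \<eta> * (real n)^2"
  shows "\<exists>vs. hamilton_cycle V E vs \<and> compatible_cycle F vs"
proof -
  have sq: "0 < sqrt \<mu>" using assms(1) by simp
  have par: "110 * \<nu> + 250 * \<eta> < 1 / 2000" using assms(2) sq by linarith
  interpret extremal_graph V E F "\<mu> * real n" n A B \<nu> \<eta>
    by unfold_locales (use assms par in auto)
  \<comment> \<open>Since \<open>\<nu> \<ge> - 2 * \<eta>\<close>, the sum
    \<open>110 * \<nu> + 250 * \<eta>\<close> is at least \<open>30 * \<eta> \<ge> 0\<close>, and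
    \<open>10 * sqrt \<mu>\<close> alone stays below 1/2000.\<close>
  have "sqrt \<mu> \<le> 1 / 20000" using assms(2) \<nu>_lower \<eta>_nonneg by linarith
  then have "(sqrt \<mu>)\<^sup>2 \<le> (1 / 20000)\<^sup>2" using sq by (intro power_mono) auto
  then have \<mu>: "\<mu> \<le> 1 / 400000000" using assms(1) by (simp add: power2_eq_square)
  have \<Delta>: "\<mu> * real n \<le> real n / 400000000"
    using mult_right_mono[OF \<mu>, of "real n"] by simp
  show ?thesis
  proof (cases "n < 700")
    case True
    then show ?thesis using small_hamilton assms(5) \<Delta> by simp
  next
    case False
    interpret large_extremal_graph V E F "\<mu> * real n" n A B \<nu> \<eta>
      by unfold_locales (use False \<Delta> in auto)
    show ?thesis by (rule compatible_hamilton)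
  qed
qed

end
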